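(* Let $h\in(0,1)$ and $k\ge 2$. Let $\phi$ be strictly convex and $\mathcal{C}^2$ on the convex set $\Omega\subset\mathbb{R}^d$, and assume $F_0=\overline{\mathrm{conv}(\mathrm{supp}(P))}\subset\mathring{\Omega}$. Assume that $P\|u\|^p<\infty$, where $p\ge 2$, and that $R^*_{k-1,h}-R^*_{k,h}>0$. Then there is a constant $C_P>0$ (not depending on $n$ or $x$) such that, for $n$ large enough and $x>0$, with probability larger than $1-n^{-p/2}-2e^{-x}$, \[ R_h(\hat{\mathbf{c}}_{n,h})-R_h(\mathbf{c}^*_h)\le\frac{C_P}{\sqrt n}\left(1+\sqrt x\right). \]
   Context: For $x,y\in\Omega$, $d_\phi(x,y)=\phi(x)-\phi(y)-\langle\nabla_y\phi,x-y\rangle$ (Bregman divergence). A $j$-point codebook is $\mathbf{c}=(c_1,\dots,c_j)\in\Omega^{(j)}$ (a $j$-tuple of points of $\Omega$), and $d_\phi(x,\mathbf{c})=\min_{i}d_\phi(x,c_i)$. $P$ is a probability distribution on $\mathbb{R}^d$; $Qf(u)$ denotes the integral of $f$ with respect to $Q$; $\|\cdot\|$ is the Euclidean norm. $B_\phi(\mathbf{c},r)=\{x:\sqrt{d_\phi(x,\mathbf{c})}<r\}$, and $\bar B_\phi(\mathbf{c},r)$ is the same set with $\le$. $r_h(\mathbf{c})$ is the smallest $r\ge 0$ such that $P(B_\phi(\mathbf{c},r))\le h\le P(\bar B_\phi(\mathbf{c},r))$. $\mathcal{P}_h$ is the set of probability measures $\frac1h Q$ where $Q$ is a sub-measure of $P$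 (i.e. $Q(A)\le P(A)$ for all Borel $A$) with $Q(\mathbb{R}^d)=h$. $\mathcal{P}_h(\mathbf{c})$ is the set of $\tilde P\in\mathcal{P}_h$ that coincide with $P/h$ on $B_\phi(\mathbf{c},r_h(\mathbf{c}))$ and have support included in $\bar B_\phi(\mathbf{c},r_h(\mathbf{c}))$. The $h$-trimmed distortion is $R_h(\mathbf{c})=h\,\tilde P_{\mathbf{c}}d_\phi(u,\mathbf{c})$ for any $\tilde P_{\mathbf{c}}\in\mathcal{P}_h(\mathbf{c})$ (the value does not depend on the choice). $R^*_{j,h}=\inf_{\mathbf{c}\in\Omega^{(j)}}R_h(\mathbf{c})$ is the $h$-trimmed optimal distortion with $j$ points, and $\mathbf{c}^*_h$ is a minimizer of $R_h$ over $\Omega^{(k)}$. $X_1,\dots,X_n$ are i.i.d. with law $P$, $P_n$ is the empirical distribution, $R_{n,h}$ is the $h$-trimmed distortion defined with $P_n$ in place of $P$, and $\hat{\mathbf{c}}_{n,h}$ is a minimizer of $R_{n,h}$ over $\Omega^{(k)}$. *)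

theory Defs
  imports "HOL-Probability.Probability"
begin

definition strictly_convex_on :: "'a::real_vector set \<Rightarrow> ('a \<Rightarrow> real) \<Rightarrow> bool" where
  "strictly_convex_on S f \<longleftrightarrow>
     (\<forall>x\<in>S. \<forall>y\<in>S. \<forall>t. x \<noteq> y \<longrightarrow> 0 < t \<longrightarrow> t < 1 \<longrightarrow>
        f ((1 - t) *\<^sub>R x + t *\<^sub>R y) < (1 - t) * f x + t * f y)"

(* Derivatives are taken within S, so S need not be open. On an open S this is the usual
   notion; on a convex S with nonempty interior the derivatives within S are still unique. *)
definition C2_on :: "'a::euclidean_space set \<Rightarrow> ('a \<Rightarrow> real) \<Rightarrow> bool" where
  "C2_on S f \<longleftrightarrow>
     (\<exists>(f' :: 'a \<Rightarrow> 'a \<Rightarrow>\<^sub>L real) (f'' :: 'a \<Rightarrow> 'a \<Rightarrow>\<^sub>L 'a \<Rightarrow>\<^sub>L real).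
        (\<forall>x\<in>S. (f has_derivative blinfun_apply (f' x)) (at x within S)) \<and>
        (\<forall>x\<in>S. (f' has_derivative blinfun_apply (f'' x)) (at x within S)) \<and>
        continuous_on S f'')"

definition gradient_on :: "'a::euclidean_space set \<Rightarrow> ('a \<Rightarrow> real) \<Rightarrow> 'a \<Rightarrow> 'a" where
  "gradient_on S f y = (THE D. (f has_derivative (\<lambda>v. D \<bullet> v)) (at y within S))"

definition bregman :: "'a::euclidean_space set \<Rightarrow> ('a \<Rightarrow> real) \<Rightarrow> 'a \<Rightarrow> 'a \<Rightarrow> real" where
  "bregman \<Omega> \<phi> x y = \<phi> x - \<phi> y - gradient_on \<Omega> \<phi> y \<bullet> (x - y)"

definition codebooks :: "'a set \<Rightarrow> nat \<Rightarrow> 'a list set" where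
  "codebooks \<Omega> j = {c. length c = j \<and> set c \<subseteq> \<Omega>}"

definition bregman_cb ::
  "'a::euclidean_space set \<Rightarrow> ('a \<Rightarrow> real) \<Rightarrow> 'a \<Rightarrow> 'a list \<Rightarrow> real" where
  "bregman_cb \<Omega> \<phi> x c = Min (bregman \<Omega> \<phi> x ` set c)"

definition bball ::
  "'a::euclidean_space set \<Rightarrow> ('a \<Rightarrow> real) \<Rightarrow> 'a list \<Rightarrow> real \<Rightarrow> 'a set" where
  "bball \<Omega> \<phi> c r = {x \<in> \<Omega>. sqrt (bregman_cb \<Omega> \<phi> x c) < r}"

definition bcball ::
  "'a::euclidean_space set \<Rightarrow> ('a \<Rightarrow> real) \<Rightarrow> 'a list \<Rightarrow> real \<Rightarrow> 'a set" where
  "bcball \<Omega> \<phi> c r = {x \<in> \<Omega>. sqrt (bregman_cb \<Omega> \<phi> x c) \<le> r}"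

definition msupport :: "'a::topological_space measure \<Rightarrow> 'a set" where
  "msupport P = {x. \<forall>U. open U \<longrightarrow> x \<in> U \<longrightarrow> emeasure P U > 0}"

(* A convex set need not be Borel, and phi is unconstrained outside Omega, so Bregman balls
   need not be Borel sets. They differ from Borel sets only outside the support of P, hence
   probabilities of balls and integrals of divergences are taken in the completion. *)
definition trim_radius ::
  "'a::euclidean_space set \<Rightarrow> ('a \<Rightarrow> real) \<Rightarrow> 'a measure \<Rightarrow> real \<Rightarrow> 'a list \<Rightarrow> real" where
  "trim_radius \<Omega> \<phi> P h c =
     (LEAST r. 0 \<le> r \<and> measure (completion P) (bball \<Omega> \<phi> c r) \<le> h
                     \<and> h \<le> measure (completion P) (bcball \<Omega> \<phi> c r))"

definition trimmed_measures :: "'a::topological_space measure \<Rightarrow> real \<Rightarrow> 'a measure set" where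
  "trimmed_measures P h =
     {scale_measure (ennreal (1 / h)) Q | Q.
        sets Q = sets borel \<and> (\<forall>A\<in>sets borel. emeasure Q A \<le> emeasure P A)
        \<and> emeasure Q UNIV = ennreal h}"

definition trimmed_measures_at ::
  "'a::euclidean_space set \<Rightarrow> ('a \<Rightarrow> real) \<Rightarrow> 'a measure \<Rightarrow> real \<Rightarrow> 'a list \<Rightarrow> 'a measure set" where
  "trimmed_measures_at \<Omega> \<phi> P h c =
     {P'. P' \<in> trimmed_measures P h \<and>
        (\<forall>A\<in>sets borel. A \<subseteq> bball \<Omega> \<phi> c (trim_radius \<Omega> \<phi> P h c) \<longrightarrow>
            measure P' A = measure P A / h) \<and>
        msupport P' \<subseteq> bcball \<Omega> \<phi> c (trim_radius \<Omega> \<phi> P h c)}"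

(* The integral is the same for every choice of the trimmed measure. *)
definition trimmed_distortion ::
  "'a::euclidean_space set \<Rightarrow> ('a \<Rightarrow> real) \<Rightarrow> 'a measure \<Rightarrow> real \<Rightarrow> 'a list \<Rightarrow> real" where
  "trimmed_distortion \<Omega> \<phi> P h c =
     h * (\<integral>u. bregman_cb \<Omega> \<phi> u c
            \<partial>completion (SOME P'. P' \<in> trimmed_measures_at \<Omega> \<phi> P h c))"

definition optimal_distortion ::
  "'a::euclidean_space set \<Rightarrow> ('a \<Rightarrow> real) \<Rightarrow> 'a measure \<Rightarrow> real \<Rightarrow> nat \<Rightarrow> real" where
  "optimal_distortion \<Omega> \<phi> P h j = (INF c\<in>codebooks \<Omega> j. trimmed_distortion \<Omega> \<phi> P h c)"

definition optimal_codebook ::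
  "'a::euclidean_space set \<Rightarrow> ('a \<Rightarrow> real) \<Rightarrow> 'a measure \<Rightarrow> real \<Rightarrow> nat \<Rightarrow> 'a list \<Rightarrow> bool" where
  "optimal_codebook \<Omega> \<phi> P h k c \<longleftrightarrow>
     is_arg_min (trimmed_distortion \<Omega> \<phi> P h) (\<lambda>c'. c' \<in> codebooks \<Omega> k) c"

definition empirical_measure :: "nat \<Rightarrow> (nat \<Rightarrow> 'a::topological_space) \<Rightarrow> 'a measure" where
  "empirical_measure n x = distr (uniform_count_measure {..<n}) borel x"

definition iid_sample ::
  "'w measure \<Rightarrow> 'a::topological_space measure \<Rightarrow> nat \<Rightarrow> (nat \<Rightarrow> 'w \<Rightarrow> 'a) \<Rightarrow> bool" where
  "iid_sample M P n X \<longleftrightarrow>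
     prob_space.indep_vars M (\<lambda>_. borel) X {..<n} \<and> (\<forall>i<n. distr M borel (X i) = P)"

end

theory Submission
  imports Defs
begin

text \<open>
  Trimming is linear programming: writing \<open>g\<^sub>c\<close> for the divergence to the codebook \<open>c\<close>, the trimmed
  distortion is \<open>max\<^sub>s (h s - E max 0 (s - g\<^sub>c))\<close>, attained at an \<open>h\<close>-quantile \<open>s\<close> of \<open>g\<^sub>c\<close>, and also the
  minimum of \<open>E (w g\<^sub>c)\<close> over weights \<open>0 \<le> w \<le> 1\<close> of mass \<open>h\<close>. As long as codebooks stay in a fixed compact
  subset of the interior of \<open>\<Omega>\<close>, the functions \<open>max 0 (s - g\<^sub>c)\<close> with bounded \<open>s\<close> form a bounded class
  that is Lipschitz in finitely many real parameters, and chaining with Hoeffding's inequality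
  gives a uniform deviation of order \<open>(1 + sqrt x) / sqrt n\<close> outside an event of probability \<open>2 exp (- x)\<close>.

  It remains to confine an empirically optimal codebook to a compact set. Drop the cells of small weight,
  replace every other codepoint by the mean of the part of its cell inside a large ball, and refill
  the lost mass inside a fixed ball at bounded cost. If a cell was dropped, the new codebook
  has at most \<open>k - 1\<close> points, which contradicts the gap between the optimal distortions; otherwise optimality
  forces each codepoint to be close, in divergence and hence in norm, to a mean lying in a compact set.
  This uses only Hoeffding bounds for three bounded functions and the first moment of \<open>P\<close>, so it fails
  with exponentially small probability, which is absorbed by \<open>n powr (- p / 2)\<close>.
\<close>

section \<open>Bregman divergences\<close>

text \<open>Two obstacles shape the argument. Divergences are unbounded on the support and only a
  moment of P is available; but a hinge max 0 (s - g_c) with s \<le> T vanishes outside a sublevel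
  set of the divergence, and these sets are bounded uniformly for centers in a compact subset of the
  interior of \<Omega>. Moreover the divergence is in general neither convex nor coercive in the
  center, so good codebooks might run off to the boundary of \<Omega>. Means of data lie in F,
  inside the interior, and replacing a center by the mean of its cell gains exactly the mass of the
  cell times the divergence from mean to center. Since the divergence increases along rays from its
  first argument, a small gain traps the center.

  Every level s gives a lower bound for the trimmed distortion, so comparing two measures takes a
  deviation bound only at the optimal level of one of them. The uniform bound is used twice: with
  parameter x for the rate, and with a parameter proportional to n for the confinement, because for
  large x its value may exceed the gap.\<close>

lemma has_derivative_segment_tendsto:
  fixes f :: "'a::real_normed_vector \<Rightarrow> real"
  assumes "(f has_derivative D) (at y within S)" "convex S" "y \<in> S" "z \<in> S"
  shows "((\<lambda>t. (f (y + t *\<^sub>R (z - y)) - f y) / t) \<longlongrightarrow> D (z - y)) (at_right 0)"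
proof -
  let ?g = "\<lambda>t::real. y + t *\<^sub>R (z - y)"
  have sub: "?g ` {0..1} \<subseteq> S"
  proof
    fix w assume "w \<in> ?g ` {0..1}"
    then obtain t where t: "0 \<le> t" "t \<le> 1" "w = y + t *\<^sub>R (z - y)" by auto
    then have "w = (1 - t) *\<^sub>R y + t *\<^sub>R z" by (simp add: algebra_simps)
    then show "w \<in> S" using convexD_alt[OF assms(2-4) t(1,2)] by simp
  qed
  have g: "(?g has_derivative (\<lambda>s. s *\<^sub>R (z - y))) (at 0 within {0..1})"
    by (auto intro!: derivative_eq_intros)
  have "(f has_derivative D) (at (?g 0) within ?g ` {0..1})"
    using has_derivative_subset[OF assms(1) sub] by simp
  from diff_chain_within[OF g this]
  have "(f \<circ> ?g has_derivative D \<circ> (\<lambda>s. s *\<^sub>R (z - y))) (at 0 within {0..1})" .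
  moreover have "D \<circ> (\<lambda>s. s *\<^sub>R (z - y)) = (*) (D (z - y))"
    using linear_cmul[OF bounded_linear.linear[OF has_derivative_bounded_linear[OF assms(1)]]]
    by (auto simp: fun_eq_iff)
  ultimately have "((f \<circ> ?g) has_field_derivative D (z - y)) (at 0 within {0..1})"
    by (simp add: has_field_derivative_def)
  then have "((\<lambda>t. (f (?g t) - f y) / t) \<longlongrightarrow> D (z - y)) (at 0 within {0..1})"
    by (simp add: has_field_derivative_iff)
  moreover have "at (0::real) within {0..1} = at_right 0"
    by (simp add: at_within_Icc_at_right)
  ultimately show ?thesis by simp
qed

text \<open>\<open>interior_ne\<close> makes derivatives within \<Omega> unique even at boundary
  points, so that the \<open>THE\<close> in \<open>gradient_on\<close> denotes the gradient.\<close>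

locale bregman_domain =
  fixes \<Omega> :: "'a::euclidean_space set" and \<phi> :: "'a \<Rightarrow> real"
  assumes convex_dom: "convex \<Omega>"
    and strict: "strictly_convex_on \<Omega> \<phi>"
    and smooth: "C2_on \<Omega> \<phi>"
    and interior_ne: "interior \<Omega> \<noteq> {}"
begin

abbreviation "grad \<equiv> gradient_on \<Omega> \<phi>"
abbreviation "d \<equiv> bregman \<Omega> \<phi>"

text \<open>Difference quotients at y see only directions z - y with z in \<Omega>. Subtracting two
  of them whose endpoints lie in a small ball inside \<Omega> reaches a multiple of every basis
  vector.\<close>

lemma derivative_unique:
  assumes "(f has_derivative D) (at y within \<Omega>)" "(f has_derivative D') (at y within \<Omega>)" "y \<in> \<Omega>"
  shows "D = (D' :: 'a \<Rightarrow> real)"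
proof -
  have lin: "linear D" "linear D'"
    using assms(1,2)[THEN has_derivative_bounded_linear, THEN bounded_linear.linear] by simp_all
  have eq: "D (z - y) = D' (z - y)" if "z \<in> \<Omega>" for z
    using has_derivative_segment_tendsto[OF assms(1) convex_dom assms(3) that]
      has_derivative_segment_tendsto[OF assms(2) convex_dom assms(3) that]
    by (rule tendsto_unique[OF trivial_limit_at_right_real])
  obtain z e where z: "e > 0" "cball z e \<subseteq> \<Omega>"
    using interior_ne by (auto simp: mem_interior_cball)
  have "D b = D' b" if "b \<in> Basis" for b
  proof -
    have "z \<in> \<Omega>" "z + e *\<^sub>R b \<in> \<Omega>"
      using z that by (auto intro!: subsetD[OF z(2)] simp: dist_norm)
    from eq[OF this(2)] eq[OF this(1)]
    have "D (z + e *\<^sub>R b - y) - D (z - y) = D' (z + e *\<^sub>R b - y) - D' (z - y)" by simp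
    then have "D (e *\<^sub>R b) = D' (e *\<^sub>R b)"
      using lin by (simp flip: linear_diff)
    then show ?thesis using lin z(1) by (simp add: linear_cmul)
  qed
  then show ?thesis using lin linear_eq_stdbasis by blast
qed

text \<open>Ties the witnesses of \<open>C2_on\<close> to \<open>gradient_on\<close>: by
  \<open>derivative_unique\<close> the gradient is the Riesz vector of the derivative. The
  functional-valued \<open>f'\<close> is kept because the second derivative \<open>f''\<close>
  belongs to it.\<close>

lemma ex_C2:
  "\<exists>(f' :: 'a \<Rightarrow> 'a \<Rightarrow>\<^sub>L real) f''.
     (\<forall>x\<in>\<Omega>. blinfun_apply (f' x) = (\<lambda>v. grad x \<bullet> v)) \<and>
     (\<forall>x\<in>\<Omega>. (\<phi> has_derivative (\<lambda>v. grad x \<bullet> v)) (at x within \<Omega>)) \<and>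
     (\<forall>x\<in>\<Omega>. (f' has_derivative blinfun_apply (f'' x)) (at x within \<Omega>)) \<and>
     continuous_on \<Omega> f''"
proof -
  from smooth[unfolded C2_on_def] obtain f' :: "'a \<Rightarrow> 'a \<Rightarrow>\<^sub>L real" and f'' where
    f0: "(\<forall>x\<in>\<Omega>. (\<phi> has_derivative blinfun_apply (f' x)) (at x within \<Omega>)) \<and>
      (\<forall>x\<in>\<Omega>. (f' has_derivative blinfun_apply (f'' x)) (at x within \<Omega>)) \<and> continuous_on \<Omega> f''"
    by (elim exE)
  note f = f0[THEN conjunct1] f0[THEN conjunct2, THEN conjunct1] f0[THEN conjunct2, THEN conjunct2]
  have g: "blinfun_apply (f' x) = (\<lambda>v. grad x \<bullet> v)" if x: "x \<in> \<Omega>" for x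
  proof -
    define E where "E = (\<Sum>b\<in>Basis. blinfun_apply (f' x) b *\<^sub>R b)"
    have E: "blinfun_apply (f' x) = (\<lambda>v. E \<bullet> v)"
    proof
      fix v
      have "blinfun_apply (f' x) v = blinfun_apply (f' x) (\<Sum>b\<in>Basis. (v \<bullet> b) *\<^sub>R b)"
        by (simp add: euclidean_representation)
      also have "\<dots> = E \<bullet> v"
        unfolding E_def blinfun.sum_right blinfun.scaleR_right inner_sum_left
        by (simp add: mult.commute inner_commute)
      finally show "blinfun_apply (f' x) v = E \<bullet> v" .
    qed
    have D: "(\<phi> has_derivative (\<lambda>v. E \<bullet> v)) (at x within \<Omega>)"
      using f(1)[rule_format, OF x] by (simp only: E)
    have "grad x = E" unfolding gradient_on_def
    proof (rule the_equality)
      fix E' assume "(\<phi> has_derivative (\<lambda>v. E' \<bullet> v)) (at x within \<Omega>)"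
      from fun_cong[OF derivative_unique[OF this D x], of "E' - E"]
      have "(E' - E) \<bullet> (E' - E) = 0" by (simp add: inner_diff_left)
      then show "E' = E" by simp
    qed (rule D)
    then show ?thesis by (simp only: E)
  qed
  show ?thesis
  proof (intro exI conjI)
    show "\<forall>x\<in>\<Omega>. blinfun_apply (f' x) = (\<lambda>v. grad x \<bullet> v)" by (intro ballI g)
    show "\<forall>x\<in>\<Omega>. (\<phi> has_derivative (\<lambda>v. grad x \<bullet> v)) (at x within \<Omega>)"
    proof
      fix x assume "x \<in> \<Omega>"
      then show "(\<phi> has_derivative (\<lambda>v. grad x \<bullet> v)) (at x within \<Omega>)"
        using f(1)[rule_format, of x] by (simp only: g)
    qed
  qed (rule f(2), rule f(3))
qed

lemma grad_derivative:
  assumes "x \<in> \<Omega>"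
  shows "(\<phi> has_derivative (\<lambda>v. grad x \<bullet> v)) (at x within \<Omega>)"
proof -
  from ex_C2 obtain f' :: "'a \<Rightarrow> 'a \<Rightarrow>\<^sub>L real" and f'' where f:
    "(\<forall>x\<in>\<Omega>. blinfun_apply (f' x) = (\<lambda>v. grad x \<bullet> v)) \<and>
     (\<forall>x\<in>\<Omega>. (\<phi> has_derivative (\<lambda>v. grad x \<bullet> v)) (at x within \<Omega>)) \<and>
     (\<forall>x\<in>\<Omega>. (f' has_derivative blinfun_apply (f'' x)) (at x within \<Omega>)) \<and>
     continuous_on \<Omega> f''"
    by (elim exE)
  from bspec[OF f[THEN conjunct2, THEN conjunct1] assms] show ?thesis .
qed

lemma continuous_phi: "continuous_on \<Omega> \<phi>"
  by (rule has_derivative_continuous_on[OF grad_derivative])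

text \<open>Testing the functional \<open>f' x - f' y\<close> on the vector
  \<open>grad x - grad y\<close> lets continuity and Lipschitz bounds pass from \<open>f'\<close> to
  the gradient.\<close>

lemma norm_grad_diff_le:
  assumes "\<And>x. x \<in> \<Omega> \<Longrightarrow> blinfun_apply (f' x) = (\<lambda>v. grad x \<bullet> v)" "x \<in> \<Omega>" "y \<in> \<Omega>"
  shows "norm (grad x - grad y) \<le> norm (f' x - f' y)"
proof -
  let ?v = "grad x - grad y"
  have "norm ?v * norm ?v = ?v \<bullet> ?v"
    by (simp add: power2_norm_eq_inner[symmetric] power2_eq_square)
  also have "\<dots> = blinfun_apply (f' x - f' y) ?v"
    using assms by (simp add: blinfun.diff_left inner_diff_left)
  also have "\<dots> \<le> norm (f' x - f' y) * norm ?v"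
    using norm_blinfun[of "f' x - f' y" ?v] by simp
  finally show ?thesis
    by (cases "?v = 0") (auto simp: mult_le_cancel_right)
qed

lemma continuous_grad: "continuous_on \<Omega> grad"
proof -
  obtain f' :: "'a \<Rightarrow> 'a \<Rightarrow>\<^sub>L real" and f'' where
    f': "(\<forall>x\<in>\<Omega>. blinfun_apply (f' x) = (\<lambda>v. grad x \<bullet> v)) \<and>
     (\<forall>x\<in>\<Omega>. (\<phi> has_derivative (\<lambda>v. grad x \<bullet> v)) (at x within \<Omega>)) \<and>
     (\<forall>x\<in>\<Omega>. (f' has_derivative blinfun_apply (f'' x)) (at x within \<Omega>)) \<and>
     continuous_on \<Omega> f''"
    using ex_C2 by (elim exE)
  note f = f'[THEN conjunct1, rule_format] f'[THEN conjunct2, THEN conjunct2, THEN conjunct1, rule_format]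
    f'[THEN conjunct2, THEN conjunct2, THEN conjunct2]
  have c: "continuous_on \<Omega> f'" by (rule has_derivative_continuous_on[OF f(2)])
  show ?thesis
    unfolding continuous_on_iff
  proof (intro ballI allI impI)
    fix x e assume x: "x \<in> \<Omega>" "(0::real) < e"
    with c have "\<exists>r>0. \<forall>y\<in>\<Omega>. dist y x < r \<longrightarrow> dist (f' y) (f' x) < e"
      by (simp add: continuous_on_iff)
    then show "\<exists>r>0. \<forall>y\<in>\<Omega>. dist y x < r \<longrightarrow> dist (grad y) (grad x) < e"
      using norm_grad_diff_le[OF f(1) _ x(1)] unfolding dist_norm by (meson le_less_trans)
  qed
qed

text \<open>By compactness the first and second derivatives are bounded on K; convexity of K then
  allows the mean value inequality.\<close>

lemma lipschitz_phi_grad: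
  assumes "compact K" "convex K" "K \<subseteq> \<Omega>"
  obtains L where "L \<ge> 0" "\<And>x. x \<in> K \<Longrightarrow> norm (grad x) \<le> L"
    "\<And>x y. x \<in> K \<Longrightarrow> y \<in> K \<Longrightarrow> \<bar>\<phi> x - \<phi> y\<bar> \<le> L * norm (x - y)"
    "\<And>x y. x \<in> K \<Longrightarrow> y \<in> K \<Longrightarrow> norm (grad x - grad y) \<le> L * norm (x - y)"
proof -
  obtain f' :: "'a \<Rightarrow> 'a \<Rightarrow>\<^sub>L real" and f'' where
    f': "(\<forall>x\<in>\<Omega>. blinfun_apply (f' x) = (\<lambda>v. grad x \<bullet> v)) \<and>
     (\<forall>x\<in>\<Omega>. (\<phi> has_derivative (\<lambda>v. grad x \<bullet> v)) (at x within \<Omega>)) \<and>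
     (\<forall>x\<in>\<Omega>. (f' has_derivative blinfun_apply (f'' x)) (at x within \<Omega>)) \<and>
     continuous_on \<Omega> f''"
    using ex_C2 by (elim exE)
  note f = f'[THEN conjunct1, rule_format] f'[THEN conjunct2, THEN conjunct2, THEN conjunct1, rule_format]
    f'[THEN conjunct2, THEN conjunct2, THEN conjunct2]
  have "bounded (grad ` K)" "bounded (f'' ` K)"
    using assms continuous_on_subset[OF continuous_grad] continuous_on_subset[OF f(3)]
    by (auto intro!: compact_imp_bounded compact_continuous_image)
  then obtain L1 L2 where L: "\<And>x. x \<in> K \<Longrightarrow> norm (grad x) \<le> L1" "\<And>x. x \<in> K \<Longrightarrow> norm (f'' x) \<le> L2"
    unfolding bounded_iff by (metis imageI)
  define L where "L = max 0 (max L1 L2)"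
  show thesis
  proof (rule that[of L])
    show "L \<ge> 0" by (simp add: L_def)
    show *: "norm (grad x) \<le> L" if "x \<in> K" for x
      using L that by (fastforce simp: L_def le_max_iff_disj)
    fix x y assume xy: "x \<in> K" "y \<in> K"
    have "norm (\<phi> x - \<phi> y) \<le> L * norm (x - y)"
    proof (rule differentiable_bound[OF assms(2)])
      fix z assume z: "z \<in> K"
      then show "(\<phi> has_derivative (\<lambda>v. grad z \<bullet> v)) (at z within K)"
        using has_derivative_subset[OF grad_derivative] assms by blast
      show "onorm (\<lambda>v. grad z \<bullet> v) \<le> L"
      proof (rule onorm_bound)
        show "norm (grad z \<bullet> v) \<le> L * norm v" for v
          using Cauchy_Schwarz_ineq2[of "grad z" v] *[OF z] mult_right_mono[of "norm (grad z)" L "norm v"]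
          by simp
      qed (simp add: L_def)
    qed (use xy in auto)
    then show "\<bar>\<phi> x - \<phi> y\<bar> \<le> L * norm (x - y)" by simp
    have "norm (f' x - f' y) \<le> L * norm (x - y)"
    proof (rule differentiable_bound[OF assms(2)])
      fix z assume z: "z \<in> K"
      then show "(f' has_derivative blinfun_apply (f'' z)) (at z within K)"
        using has_derivative_subset[OF f(2)] assms by blast
      show "onorm (blinfun_apply (f'' z)) \<le> L"
        using L(2)[OF z] by (simp add: norm_blinfun.rep_eq[symmetric] L_def)
    qed (use xy in auto)
    with norm_grad_diff_le[OF f(1)] xy assms
    show "norm (grad x - grad y) \<le> L * norm (x - y)" by (meson order_trans subsetD)
  qed
qed

section \<open>Convexity properties of the divergence\<close>

lemma phi_convex:
  assumes "x \<in> \<Omega>" "y \<in> \<Omega>" "0 \<le> t" "t \<le> 1"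
  shows "\<phi> ((1 - t) *\<^sub>R x + t *\<^sub>R y) \<le> (1 - t) * \<phi> x + t * \<phi> y"
proof (cases "x = y \<or> t = 0 \<or> t = 1")
  case True then show ?thesis by (auto simp: algebra_simps)
next
  case False 
  then show ?thesis using strict assms unfolding strictly_convex_on_def
    by (intro less_imp_le) auto
qed

lemma d_nonneg:
  assumes "x \<in> \<Omega>" "y \<in> \<Omega>"
  shows "0 \<le> d x y"
proof -
  \<comment> \<open>The tangent inequality: convexity bounds every difference quotient along the
    segment by \<open>\<phi> x - \<phi> y\<close>, and t tends to 0.\<close>
  have "grad y \<bullet> (x - y) \<le> \<phi> x - \<phi> y"
  proof (rule tendsto_upperbound)
    show "((\<lambda>t. (\<phi> (y + t *\<^sub>R (x - y)) - \<phi> y) / t) \<longlongrightarrow> grad y \<bullet> (x - y)) (at_right 0)"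
      by (rule has_derivative_segment_tendsto[OF grad_derivative convex_dom]) (use assms in auto)
    have "\<forall>\<^sub>F t in at_right (0::real). t \<in> {0<..<1}" by (rule eventually_at_right_real) simp
    then show "\<forall>\<^sub>F t in at_right 0. (\<phi> (y + t *\<^sub>R (x - y)) - \<phi> y) / t \<le> \<phi> x - \<phi> y"
    proof eventually_elim
      case (elim t)
      then have "\<phi> ((1 - t) *\<^sub>R y + t *\<^sub>R x) \<le> (1 - t) * \<phi> y + t * \<phi> x"
        by (intro phi_convex assms) auto
      moreover have "(1 - t) *\<^sub>R y + t *\<^sub>R x = y + t *\<^sub>R (x - y)" by (simp add: algebra_simps)
      ultimately show ?case using elim by (simp add: field_simps)
    qed
  qed simp
  then show ?thesis by (simp add: bregman_def)
qed

text \<open>Strict convexity at the midpoint of x and y is combined with the tangent inequality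
  \<open>d_nonneg\<close> at that midpoint.\<close>

lemma d_pos:
  assumes "x \<in> \<Omega>" "y \<in> \<Omega>" "x \<noteq> y"
  shows "0 < d x y"
proof -
  let ?m = "(1 - 1/2) *\<^sub>R x + (1/2) *\<^sub>R y"
  have m: "?m \<in> \<Omega>" using convex_dom assms by (intro convexD_alt) auto
  have "\<phi> ?m < (1 - 1/2) * \<phi> x + (1/2) * \<phi> y"
    using strict[unfolded strictly_convex_on_def, rule_format, of x y "1/2"] assms by simp
  moreover have "0 \<le> d ?m y" by (rule d_nonneg[OF m assms(2)])
  moreover have "?m - y = (1/2) *\<^sub>R (x - y)" by (simp add: algebra_simps flip: scaleR_add_left)
  ultimately show ?thesis by (simp add: bregman_def)
qed

lemma d_self [simp]: "d x x = 0" by (simp add: bregman_def)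

lemma continuous_d2: "continuous_on (\<Omega> \<times> \<Omega>) (\<lambda>p. d (fst p) (snd p))"
  unfolding bregman_def
  by (intro continuous_intros continuous_on_compose2[OF continuous_phi] continuous_on_compose2[OF continuous_grad])
     auto

lemma continuous_d: "y \<in> \<Omega> \<Longrightarrow> continuous_on \<Omega> (\<lambda>x. d x y)"
  unfolding bregman_def
  by (intro continuous_intros continuous_phi)

lemma d_three_points: "d x z = d x y + d y z + (grad y - grad z) \<bullet> (x - y)"
  by (simp add: bregman_def algebra_simps inner_diff_left inner_diff_right)

text \<open>A substitute for convexity in the second argument. In the three-point identity through
  the intermediate center, the inner product is nonnegative because the gradient of a convex
  function is monotone.\<close>

lemma d_mono_segment:
  assumes "x \<in> \<Omega>" "c \<in> \<Omega>" "0 \<le> s" "s \<le> 1"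
  shows "d x (x + s *\<^sub>R (c - x)) \<le> d x c"
proof -
  let ?y = "x + s *\<^sub>R (c - x)"
  have y: "?y = (1 - s) *\<^sub>R x + s *\<^sub>R c" by (simp add: algebra_simps)
  have "?y \<in> \<Omega>" unfolding y using convex_dom assms by (intro convexD_alt) auto
  have 1: "0 \<le> d c ?y + d ?y c" by (simp add: d_nonneg assms \<open>?y \<in> \<Omega>\<close>)
  have "d c ?y + d ?y c = (1 - s) * ((grad c - grad ?y) \<bullet> (c - x))"
    by (simp add: bregman_def algebra_simps inner_diff_left inner_diff_right)
  with 1 have *: "0 \<le> (1 - s) * ((grad c - grad ?y) \<bullet> (c - x))" by simp
  have eq: "(grad ?y - grad c) \<bullet> (x - ?y) = s * ((grad c - grad ?y) \<bullet> (c - x))"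
    by (simp add: algebra_simps inner_diff_left inner_diff_right)
  have "s = 1 \<or> 0 \<le> (grad c - grad ?y) \<bullet> (c - x)"
    using * assms by (auto simp: zero_le_mult_iff)
  then have "0 \<le> (grad ?y - grad c) \<bullet> (x - ?y)"
    unfolding eq using assms by auto
  with d_three_points[of x c ?y] d_nonneg[OF \<open>?y \<in> \<Omega>\<close> assms(2)] show ?thesis by simp
qed

lemma d_convex:
  assumes "x \<in> \<Omega>" "y \<in> \<Omega>" "0 \<le> t" "t \<le> 1"
  shows "d ((1 - t) *\<^sub>R x + t *\<^sub>R y) c \<le> (1 - t) * d x c + t * d y c"
  using phi_convex[OF assms] by (simp add: bregman_def algebra_simps inner_diff_right)

section \<open>Uniform estimates over compact sets of centers\<close>

lemma compact_tube:
  assumes "compact K" "K \<subseteq> interior \<Omega>"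
  obtains r where "r > 0" "\<And>x y. x \<in> K \<Longrightarrow> norm (y - x) \<le> r \<Longrightarrow> y \<in> interior \<Omega>"
proof -
  obtain r where r: "r > 0" "\<And>x. x \<in> K \<Longrightarrow> ball x r \<subseteq> interior \<Omega>"
    using compact_subset_open_imp_ball_epsilon_subset[OF assms(1) open_interior assms(2)]
    by (metis UN_subset_iff)
  show thesis
    by (rule that[of "r/2"]) (use r in \<open>force simp: subset_iff dist_norm norm_minus_commute\<close>)+
qed

text \<open>The pairs at distance r form a compact set of distinct points, on which a positive
  minimum is attained. Both orders of the arguments are recorded: one traps a codepoint near a mean,
  the other bounds sublevel sets.\<close>

lemma d_lower_tube:
  assumes K: "compact K" "K \<noteq> {}" and r: "r > 0" "\<And>x y. x \<in> K \<Longrightarrow> norm (y - x) \<le> r \<Longrightarrow> y \<in> \<Omega>"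
  obtains \<delta> where "\<delta> > 0" "\<And>x y. x \<in> K \<Longrightarrow> norm (y - x) = r \<Longrightarrow> \<delta> \<le> d x y \<and> \<delta> \<le> d y x"
proof -
  let ?T = "(\<lambda>p. (fst p, fst p + snd p)) ` (K \<times> sphere 0 r)"
  have T: "compact ?T"
    using K by (intro compact_continuous_image compact_Times continuous_intros) auto
  have Tsub: "?T \<subseteq> \<Omega> \<times> \<Omega>"
  proof
    fix q assume "q \<in> ?T"
    then obtain x v where "x \<in> K" "norm v = r" "q = (x, x + v)" by auto
    then show "q \<in> \<Omega> \<times> \<Omega>" using r(2)[of x x] r(2)[of x "x + v"] r(1) by simp
  qed
  have "continuous_on (\<Omega> \<times> \<Omega>) (\<lambda>p. d (snd p) (fst p))"
    by (rule continuous_on_compose2[OF continuous_d2, of _ "\<lambda>p. (snd p, fst p)", simplified])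
       (auto intro!: continuous_intros)
  then have c: "continuous_on ?T (\<lambda>p. min (d (fst p) (snd p)) (d (snd p) (fst p)))"
    using Tsub by (intro continuous_on_min continuous_on_subset[OF continuous_d2 Tsub] continuous_on_subset[OF _ Tsub])
  have "?T \<noteq> {}"
  proof -
    obtain b :: 'a where "b \<in> Basis" by (meson nonempty_Basis ex_in_conv)
    then have "r *\<^sub>R b \<in> sphere 0 r" using r by (simp add: )
    then show ?thesis using K(2) by blast
  qed
  then obtain p where p: "p \<in> ?T" "\<And>q. q \<in> ?T \<Longrightarrow> min (d (fst p) (snd p)) (d (snd p) (fst p)) \<le> min (d (fst q) (snd q)) (d (snd q) (fst q))"
    using continuous_attains_inf[OF T _ c] by blast
  show thesis
  proof (rule that)
    have "fst p \<in> \<Omega>" "snd p \<in> \<Omega>" "fst p \<noteq> snd p" using p(1) Tsub r(1) by auto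
    then show "min (d (fst p) (snd p)) (d (snd p) (fst p)) > 0" using d_pos by auto
    fix x y assume "x \<in> K" "norm (y - x) = r"
    then have "(x, y) \<in> ?T" by (intro image_eqI[of _ _ "(x, y - x)"]) auto
    from p(2)[OF this] show "min (d (fst p) (snd p)) (d (snd p) (fst p)) \<le> d x y \<and> min (d (fst p) (snd p)) (d (snd p) (fst p)) \<le> d y x" by auto
  qed
qed

text \<open>Monotonicity along the segment from x to c carries the bound from the sphere of radius r
  to all centers outside it.\<close>

lemma d_lower_far:
  assumes \<delta>: "\<And>x y. x \<in> K \<Longrightarrow> norm (y - x) = r \<Longrightarrow> \<delta> \<le> d x y" and r: "r > 0" 
    and x: "x \<in> K" "x \<in> \<Omega>" and c: "c \<in> \<Omega>" "r \<le> norm (c - x)"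
  shows "\<delta> \<le> d x c"
proof -
  let ?s = "r / norm (c - x)"
  have "\<delta> \<le> d x (x + ?s *\<^sub>R (c - x))" using x c r by (intro \<delta>) auto
  also have "\<dots> \<le> d x c" using c r x by (intro d_mono_segment) (auto simp: divide_le_eq)
  finally show ?thesis .
qed

text \<open>Convexity in the first argument and the value 0 at c force at least linear growth
  outside the sphere.\<close>

lemma d_growth_far:
  assumes \<delta>: "\<And>y. norm (y - c) = r \<Longrightarrow> \<delta> \<le> d y c" and r: "r > 0" 
    and x: "c \<in> \<Omega>" and u: "u \<in> \<Omega>" "r \<le> norm (u - c)"
  shows "\<delta> * norm (u - c) \<le> r * d u c"
proof -
  let ?s = "r / norm (u - c)"
  have "\<delta> \<le> d (c + ?s *\<^sub>R (u - c)) c" using u r by (intro \<delta>) auto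
  also have "c + ?s *\<^sub>R (u - c) = (1 - ?s) *\<^sub>R c + ?s *\<^sub>R u" by (simp add: algebra_simps)
  also have "d \<dots> c \<le> (1 - ?s) * d c c + ?s * d u c" using u r x by (intro d_convex) (auto simp: divide_le_eq)
  finally show ?thesis using u r by (cases "u = c") (auto simp: pos_le_divide_eq)
qed

text \<open>The term \<open>\<phi> u\<close> cancels in the difference, and what remains is affine
  in u; this is why the constant is uniform only over bounded u.\<close>

lemma d_lipschitz_center:
  assumes "compact K" "convex K" "K \<subseteq> \<Omega>"
  obtains L where "L \<ge> 0"
    "\<And>u x y. norm u \<le> R \<Longrightarrow> x \<in> K \<Longrightarrow> y \<in> K \<Longrightarrow> \<bar>d u x - d u y\<bar> \<le> L * norm (x - y)"
proof -
  obtain L where L: "L \<ge> 0" "\<And>x. x \<in> K \<Longrightarrow> norm (grad x) \<le> L"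
    "\<And>x y. x \<in> K \<Longrightarrow> y \<in> K \<Longrightarrow> \<bar>\<phi> x - \<phi> y\<bar> \<le> L * norm (x - y)"
    "\<And>x y. x \<in> K \<Longrightarrow> y \<in> K \<Longrightarrow> norm (grad x - grad y) \<le> L * norm (x - y)"
    using lipschitz_phi_grad[OF assms] by blast
  obtain B where B: "B \<ge> 0" "\<And>x. x \<in> K \<Longrightarrow> norm x \<le> B"
    using compact_imp_bounded[OF assms(1)] by (metis bounded_iff dual_order.trans norm_ge_zero linear)
  let ?R = "max 0 R"
  show thesis
  proof (rule that[of "L + L * (?R + B) + L"])
    show "L + L * (?R + B) + L \<ge> 0" using L(1) B(1) by simp
    fix u x y :: 'a assume u: "norm u \<le> R" and x: "x \<in> K" and y: "y \<in> K"
    have "d u x - d u y = (\<phi> y - \<phi> x) - (grad x - grad y) \<bullet> (u - x) + grad y \<bullet> (x - y)"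
      by (simp add: bregman_def algebra_simps inner_diff_left inner_diff_right)
    then have "\<bar>d u x - d u y\<bar> \<le> \<bar>\<phi> y - \<phi> x\<bar> + \<bar>(grad x - grad y) \<bullet> (u - x)\<bar> + \<bar>grad y \<bullet> (x - y)\<bar>"
      by linarith
    also have "\<dots> \<le> L * norm (x - y) + (L * norm (x - y)) * (?R + B) + L * norm (x - y)"
    proof (intro add_mono)
      show "\<bar>\<phi> y - \<phi> x\<bar> \<le> L * norm (x - y)" using L(3)[OF y x] by (simp add: norm_minus_commute)
      have "norm (u - x) \<le> ?R + B" using u B(2)[OF x] norm_triangle_ineq4[of u x] by linarith
      then show "\<bar>(grad x - grad y) \<bullet> (u - x)\<bar> \<le> (L * norm (x - y)) * (?R + B)"
        using L(4)[OF x y] L(1)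
        by (intro order_trans[OF Cauchy_Schwarz_ineq2] mult_mono) auto
      show "\<bar>grad y \<bullet> (x - y)\<bar> \<le> L * norm (x - y)"
        using L(2)[OF y] by (intro order_trans[OF Cauchy_Schwarz_ineq2] mult_right_mono) auto
    qed
    finally show "\<bar>d u x - d u y\<bar> \<le> (L + L * (?R + B) + L) * norm (x - y)"
      by (simp add: algebra_simps)
  qed
qed

lemma d_bounded:
  assumes "compact K" "K \<subseteq> \<Omega>" "compact K'" "K' \<subseteq> \<Omega>"
  obtains T where "T \<ge> 0" "\<And>u c. u \<in> K \<Longrightarrow> c \<in> K' \<Longrightarrow> d u c \<le> T"
proof -
  have "compact ((\<lambda>p. d (fst p) (snd p)) ` (K \<times> K'))"
    using assms by (intro compact_continuous_image compact_Times continuous_on_subset[OF continuous_d2]) auto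
  from compact_imp_bounded[OF this] obtain T where T: "\<forall>p\<in>K \<times> K'. \<bar>d (fst p) (snd p)\<bar> \<le> T"
    by (auto simp: bounded_iff)
  show thesis
  proof (rule that[of "max 0 T"])
    fix u c assume "u \<in> K" "c \<in> K'"
    with T have "\<bar>d u c\<bar> \<le> T" by auto
    then show "d u c \<le> max 0 T" by linarith
  qed simp
qed

text \<open>This neutralizes heavy tails: for levels up to T, data outside a fixed ball contribute
  nothing to the hinge functions.\<close>

lemma sublevel_bounded:
  assumes "compact K" "K \<subseteq> interior \<Omega>"
  obtains R where "\<And>u c. u \<in> \<Omega> \<Longrightarrow> c \<in> K \<Longrightarrow> d u c \<le> T \<Longrightarrow> norm u \<le> R"
proof (cases "K = {}")
  case False
  obtain r where r: "r > 0" "\<And>x y. x \<in> K \<Longrightarrow> norm (y - x) \<le> r \<Longrightarrow> y \<in> interior \<Omega>"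
    using compact_tube[OF assms] by blast
  obtain \<delta> where \<delta>: "\<delta> > 0" "\<And>x y. x \<in> K \<Longrightarrow> norm (y - x) = r \<Longrightarrow> \<delta> \<le> d x y \<and> \<delta> \<le> d y x"
    using d_lower_tube[OF assms(1) False r(1)] r(2) interior_subset by blast
  obtain B where B: "\<And>x. x \<in> K \<Longrightarrow> norm x \<le> B"
    using compact_imp_bounded[OF assms(1)] by (metis bounded_iff)
  show thesis
  proof (rule that)
    fix u c assume u: "u \<in> \<Omega>" "c \<in> K" "d u c \<le> T"
    have "norm (u - c) \<le> max r (r * T / \<delta>)"
    proof (cases "norm (u - c) \<le> r")
      case False
      then have "\<delta> * norm (u - c) \<le> r * d u c"
        using \<delta> u assms(2) interior_subset[of \<Omega>] by (intro d_growth_far r) auto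
      also have "\<dots> \<le> r * T" using u r(1) by (intro mult_left_mono) auto
      finally show ?thesis using \<delta>(1) by (simp add: field_simps le_max_iff_disj)
    qed auto
    then show "norm u \<le> B + max r (r * T / \<delta>)"
      using B[OF u(2)] norm_triangle_ineq[of "u - c" c] by simp
  qed
qed (use that in blast)

end

section \<open>Trimmed means of nonnegative functions\<close>

definition trim_dual :: "'b measure \<Rightarrow> real \<Rightarrow> ('b \<Rightarrow> real) \<Rightarrow> real \<Rightarrow> real" where
  "trim_dual M h g s = h * s - (\<integral>u. max 0 (s - g u) \<partial>M)"

definition is_trim_level :: "'b measure \<Rightarrow> real \<Rightarrow> ('b \<Rightarrow> real) \<Rightarrow> real \<Rightarrow> bool" where
  "is_trim_level M h g t \<longleftrightarrow> 0 \<le> t \<and> measure M {u \<in> space M. g u < t} \<le> h \<and> h \<le> measure M {u \<in> space M. g u \<le> t}"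

context prob_space begin

lemma integrable_hinge:
  assumes [measurable]: "g \<in> borel_measurable M" and "\<And>u. 0 \<le> (g u :: real)"
  shows "integrable M (\<lambda>u. max 0 (s - g u))"
proof (rule integrable_const_bound)
  show "AE u in M. norm (max 0 (s - g u)) \<le> \<bar>s\<bar>"
  proof (rule AE_I2)
    fix u show "norm (max 0 (s - g u)) \<le> \<bar>s\<bar>" using assms(2)[of u] by (auto simp: max_def)
  qed
qed simp

lemma integrable_event_indicator: "A \<in> events \<Longrightarrow> integrable M (indicat_real A)"
  by (intro integrable_real_indicator) (auto simp: emeasure_eq_measure)

text \<open>The one-sided derivatives in s of E max 0 (s - g) are the probabilities of g < s and of
  g \<le> s, so \<open>is_trim_level\<close> is the first-order optimality condition for the concave
  function \<open>trim_dual\<close>. The proof integrates the corresponding pointwise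
  bounds.\<close>

lemma trim_dual_le:
  assumes [measurable]: "g \<in> borel_measurable M" and g0: "\<And>u. 0 \<le> (g u :: real)"
    and t: "is_trim_level M h g t"
  shows "trim_dual M h g s \<le> trim_dual M h g t"
proof (cases "t \<le> s")
  case True
  have "(s - t) * h \<le> (s - t) * prob {u \<in> space M. g u \<le> t}"
    using t True by (intro mult_left_mono) (auto simp: is_trim_level_def)
  also have "\<dots> = (\<integral>u. (s - t) * indicator {u \<in> space M. g u \<le> t} u \<partial>M)"
    by simp
  also have "\<dots> \<le> (\<integral>u. max 0 (s - g u) - max 0 (t - g u) \<partial>M)"
    using True by (intro integral_mono Bochner_Integration.integrable_diff integrable_hinge g0 assms(1)
      integrable_mult_right integrable_event_indicator) (auto split: split_indicator)
  also have "\<dots> = (\<integral>u. max 0 (s - g u) \<partial>M) - (\<integral>u. max 0 (t - g u) \<partial>M)"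
    by (intro Bochner_Integration.integral_diff integrable_hinge g0 assms(1))
  finally show ?thesis by (simp add: trim_dual_def algebra_simps)
next
  case False
  have "(\<integral>u. max 0 (t - g u) \<partial>M) - (\<integral>u. max 0 (s - g u) \<partial>M) = (\<integral>u. max 0 (t - g u) - max 0 (s - g u) \<partial>M)"
    by (intro Bochner_Integration.integral_diff[symmetric] integrable_hinge g0 assms(1))
  also have "\<dots> \<le> (\<integral>u. (t - s) * indicator {u \<in> space M. g u < t} u \<partial>M)"
    using False by (intro integral_mono Bochner_Integration.integrable_diff integrable_hinge g0 assms(1)
      integrable_mult_right integrable_event_indicator) (auto split: split_indicator)
  also have "\<dots> = (t - s) * prob {u \<in> space M. g u < t}" by simp
  also have "\<dots> \<le> (t - s) * h"
    using t False by (intro mult_left_mono) (auto simp: is_trim_level_def)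
  finally show ?thesis by (simp add: trim_dual_def algebra_simps)
qed

text \<open>Weak duality, by maximizing \<open>w * (s - g u)\<close> pointwise over weights w in
  [0, 1].\<close>

lemma trim_dual_le_weight:
  assumes [measurable]: "g \<in> borel_measurable M" and g0: "\<And>u. 0 \<le> (g u :: real)"
    and w: "integrable M w" "\<And>u. u \<in> space M \<Longrightarrow> 0 \<le> w u \<and> w u \<le> 1" "(\<integral>u. w u \<partial>M) = h"
    and wg: "integrable M (\<lambda>u. w u * g u)"
  shows "trim_dual M h g s \<le> (\<integral>u. w u * g u \<partial>M)"
proof -
  have pt: "s * w u - max 0 (s - g u) \<le> w u * g u" if "u \<in> space M" for u
  proof (cases "g u \<le> s")
    case True
    then have "w u * (s - g u) \<le> 1 * (s - g u)" using w(2)[OF that] by (intro mult_right_mono) auto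
    with True show ?thesis by (simp add: algebra_simps)
  next
    case False
    then have "w u * s \<le> w u * g u" using w(2)[OF that] by (intro mult_left_mono) auto
    with False show ?thesis by (simp add: algebra_simps)
  qed
  have "trim_dual M h g s = (\<integral>u. s * w u - max 0 (s - g u) \<partial>M)"
    using w by (subst Bochner_Integration.integral_diff) (auto intro!: integrable_hinge g0 simp: trim_dual_def)
  also have "\<dots> \<le> (\<integral>u. w u * g u \<partial>M)"
    using w wg pt by (intro integral_mono Bochner_Integration.integrable_diff integrable_hinge g0) auto
  finally show ?thesis .
qed

text \<open>Complementary slackness dictates the weight off the set where g = t; the fraction placed
  there is fixed by the total mass h.\<close>

lemma trim_weight_exists:
  assumes [measurable]: "g \<in> borel_measurable M" and g0: "\<And>u. 0 \<le> (g u :: real)"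
    and t: "is_trim_level M h g t"
  obtains w where "w \<in> borel_measurable M" "\<And>u. 0 \<le> w u" "\<And>u. w u \<le> 1" "(\<integral>u. w u \<partial>M) = h"
    "\<And>u. g u < t \<Longrightarrow> w u = 1" "\<And>u. t < g u \<Longrightarrow> w u = 0"
    "integrable M (\<lambda>u. w u * g u)" "(\<integral>u. w u * g u \<partial>M) = trim_dual M h g t"
proof -
  define m1 m2 where "m1 = prob {u \<in> space M. g u < t}" and "m2 = prob {u \<in> space M. g u = t}"
  have "prob {u \<in> space M. g u \<le> t} = prob ({u \<in> space M. g u < t} \<union> {u \<in> space M. g u = t})"
    by (rule arg_cong[of _ _ prob]) auto
  also have "\<dots> = m1 + m2" unfolding m1_def m2_def by (intro finite_measure_Union) auto
  finally have m: "m1 \<le> h" "h \<le> m1 + m2" "0 \<le> m2"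
    using t by (auto simp: is_trim_level_def m1_def m2_def)
  \<comment> \<open>If the atom is null, the two bounds on h already give m1 = h, so the default 0
    is correct.\<close>
  define l where "l = (if m2 = 0 then 0 else (h - m1) / m2)"
  have l: "0 \<le> l" "l \<le> 1" "m1 + l * m2 = h"
    using m by (auto simp: l_def divide_le_eq)
  define w where "w u = (if g u < t then 1 else if g u = t then l else 0)" for u
  have [measurable]: "w \<in> borel_measurable M" unfolding w_def by measurable
  have w: "0 \<le> w u" "w u \<le> 1" for u using l by (auto simp: w_def)
  have wi: "integrable M w" by (rule integrable_const_bound[of _ 1]) (use w in auto)
  have "(\<integral>u. w u \<partial>M) = (\<integral>u. indicator {u \<in> space M. g u < t} u + l * indicator {u \<in> space M. g u = t} u \<partial>M)"
    by (intro Bochner_Integration.integral_cong) (auto simp: w_def split: split_indicator)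
  also have "\<dots> = m1 + l * m2"
    by (subst Bochner_Integration.integral_add)
      (auto intro!: integrable_mult_right integrable_event_indicator simp: m1_def m2_def simp del: integrable_mult_right_iff)
  finally have wh: "(\<integral>u. w u \<partial>M) = h" using l by simp
  have eq: "w u * g u = t * w u - max 0 (t - g u)" for u by (auto simp: w_def)
  show thesis
  proof (rule that)
    show "integrable M (\<lambda>u. w u * g u)" unfolding eq
      by (intro Bochner_Integration.integrable_diff integrable_hinge g0) (use wi in auto)
    show "(\<integral>u. w u * g u \<partial>M) = trim_dual M h g t" unfolding eq
      by (subst Bochner_Integration.integral_diff) (use wi wh in \<open>auto intro!: integrable_hinge g0 simp: trim_dual_def\<close>)
  qed (use w wh in \<open>auto simp: w_def\<close>)
qed

text \<open>The level is the infimum of the s at which the distribution function of g is at least h: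
  right continuity gives the bound for g \<le> t, the left limit the one for g < t. Minimality is
  recorded because \<open>trim_radius\<close> is a \<open>LEAST\<close>.\<close>

lemma trim_level_exists:
  assumes [measurable]: "g \<in> borel_measurable M" and g0: "\<And>u. 0 \<le> (g u :: real)" and h: "0 < h" "h < 1"
  obtains t where "is_trim_level M h g t"
    "\<And>s. h \<le> measure M {u \<in> space M. g u \<le> s} \<Longrightarrow> t \<le> s"
proof -
  interpret D: real_distribution "distr M borel g" by simp
  have cdf: "cdf (distr M borel g) s = prob {u \<in> space M. g u \<le> s}" for s
    unfolding cdf_def by (subst measure_distr) (auto intro!: arg_cong[of _ _ prob])
  define S where "S = {s. h \<le> cdf (distr M borel g) s}"
  have neg: "s \<ge> 0" if "s \<in> S" for s
  proof (rule ccontr)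
    assume "\<not> s \<ge> 0"
    then have "\<not> g u \<le> s" for u using g0[of u] by linarith
    then have "cdf (distr M borel g) s = 0" unfolding cdf by simp
    with that h show False by (simp add: S_def)
  qed
  have bdd: "bdd_below S" using neg by (auto simp: bdd_below_def)
  have "\<forall>\<^sub>F s in at_top. h < cdf (distr M borel g) s"
    using D.cdf_lim_at_top_prob h by (auto simp: order_tendsto_iff)
  then obtain s0 where "s0 \<in> S" unfolding S_def
    by (auto simp: eventually_at_top_linorder intro: less_imp_le)
  then have ne: "S \<noteq> {}" by auto
  define t where "t = Inf S"
  have above: "h \<le> cdf (distr M borel g) s" if "t < s" for s
  proof -
    have "Inf S < s" using that by (simp add: t_def)
    from cInf_lessD[OF ne this] obtain s' where "s' \<in> S" "s' < s" by blast
    then show ?thesis using D.cdf_nondecreasing[of s' s] by (auto simp: S_def)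
  qed
  have below: "cdf (distr M borel g) s \<le> h" if "s < t" for s
    using that cInf_lower[OF _ bdd, of s] unfolding t_def S_def by fastforce
  show thesis
  proof (rule that[of t])
    show "is_trim_level M h g t" unfolding is_trim_level_def
    proof (intro conjI)
      show "0 \<le> t" unfolding t_def by (intro cInf_greatest ne neg)
      have "(cdf (distr M borel g) \<longlongrightarrow> cdf (distr M borel g) t) (at_right t)"
        using D.cdf_is_right_cont by (simp add: continuous_within)
      then have "h \<le> cdf (distr M borel g) t"
        by (rule tendsto_lowerbound) (simp_all add: eventually_at_filter above)
      then show "h \<le> prob {u \<in> space M. g u \<le> t}" by (simp add: cdf)
      have "measure (distr M borel g) {..<t} \<le> h"
        by (rule tendsto_upperbound[OF D.cdf_at_left]) (simp_all add: eventually_at_filter below)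
      also have "measure (distr M borel g) {..<t} = prob {u \<in> space M. g u < t}"
        by (subst measure_distr) (auto intro!: arg_cong[of _ _ prob])
      finally show "prob {u \<in> space M. g u < t} \<le> h" .
    qed
    fix s assume "h \<le> measure M {u \<in> space M. g u \<le> s}"
    then have "s \<in> S" by (simp add: S_def cdf)
    then show "t \<le> s" unfolding t_def by (intro cInf_lower bdd)
  qed
qed

end

section \<open>Completion, support, and minima of continuous functions\<close>

lemma (in complete_measure) measurable_AE_eq:
  assumes "g \<in> measurable M N" "AE x in M. f x = g x" "\<And>x. x \<in> space M \<Longrightarrow> f x \<in> space N"
  shows "f \<in> measurable M N"
proof (rule measurableI)
  fix A assume A: "A \<in> sets N"
  show "f -` A \<inter> space M \<in> sets M"
  proof (rule in_sets_AE)
    show "AE x in M. (x \<in> g -` A \<inter> space M) = (x \<in> f -` A \<inter> space M)"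
      using assms(2) by eventually_elim auto
  qed (use assms(1) A in auto)
qed (use assms in auto)

text \<open>The complement of the support is a union of null open sets; the Lindelof property
  reduces it to a countable one.\<close>

lemma AE_in_msupport:
  fixes M :: "'a::second_countable_topology measure"
  assumes "sets M = sets borel"
  shows "AE x in M. x \<in> msupport M"
proof -
  let ?F = "{U. open U \<and> emeasure M U = 0}"
  obtain F' where F': "F' \<subseteq> ?F" "countable F'" "\<Union>F' = \<Union>?F"
    by (rule Lindelof[of ?F]) auto
  have "(\<Union>U\<in>F'. U) \<in> null_sets M"
    by (rule null_sets_UN') (use F' assms in \<open>auto simp: null_sets_def\<close>)
  moreover have "{x \<in> space M. x \<notin> msupport M} \<subseteq> (\<Union>U\<in>F'. U)"
    using F'(3) by (auto simp: msupport_def zero_less_iff_neq_zero)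
  ultimately show ?thesis by (rule AE_I'[rotated, rotated, OF _ ]) 
qed

lemma continuous_on_Min_image:
  fixes f :: "'i \<Rightarrow> 'b::topological_space \<Rightarrow> real"
  assumes "finite S" "S \<noteq> {}" "\<And>i. i \<in> S \<Longrightarrow> continuous_on A (f i)"
  shows "continuous_on A (\<lambda>x. Min ((\<lambda>i. f i x) ` S))"
  using assms
proof (induction rule: finite_ne_induct)
  case (insert i S)
  have "continuous_on A (\<lambda>x. min (f i x) (Min ((\<lambda>i. f i x) ` S)))"
    using insert by (intro continuous_intros) auto
  then show ?case using insert by simp
qed simp

section \<open>The trimmed distortion as a trimmed mean\<close>

text \<open>F stands for the closed convex hull of the support of P: weighted means of its points
  stay in it, hence in the interior of \<Omega>.\<close>

locale bregman_support = bregman_domain \<Omega> \<phi> for \<Omega> :: "'a::euclidean_space set" and \<phi> +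
  fixes F :: "'a set"
  assumes closed_F: "closed F" and convex_F: "convex F" and F_sub: "F \<subseteq> interior \<Omega>"
begin

text \<open>The cutoff makes the function Borel and nonnegative on the whole space, while changing
  it only on a null set of every \<open>F_measure\<close>.\<close>

definition gd :: "'a list \<Rightarrow> 'a \<Rightarrow> real" where
  "gd c u = (if u \<in> F then bregman_cb \<Omega> \<phi> u c else 0)"

text \<open>Covers P and, almost surely, the empirical measures, so that both are treated by the
  same lemmas.\<close>

definition F_measure :: "'a measure \<Rightarrow> bool" where
  "F_measure \<mu> \<longleftrightarrow> prob_space \<mu> \<and> sets \<mu> = sets borel \<and> (AE u in \<mu>. u \<in> F)"

lemma F_dom: "u \<in> F \<Longrightarrow> u \<in> \<Omega>"
  using F_sub interior_subset by blast

lemma borel_F [measurable]: "F \<in> sets borel"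
  using closed_F by simp

lemma continuous_cb:
  assumes "set c \<subseteq> \<Omega>" "c \<noteq> []"
  shows "continuous_on \<Omega> (\<lambda>u. bregman_cb \<Omega> \<phi> u c)"
  unfolding bregman_cb_def using assms by (intro continuous_on_Min_image continuous_d) auto

lemma cb_le: "x \<in> set c \<Longrightarrow> bregman_cb \<Omega> \<phi> u c \<le> d u x"
  unfolding bregman_cb_def by (intro Min_le) auto

lemma cb_attained:
  assumes "c \<noteq> []"
  obtains x where "x \<in> set c" "bregman_cb \<Omega> \<phi> u c = d u x"
proof -
  have "bregman_cb \<Omega> \<phi> u c \<in> d u ` set c"
    unfolding bregman_cb_def using assms by (intro Min_in) auto
  with that show thesis by blast
qed

lemma cb_nonneg:
  assumes "set c \<subseteq> \<Omega>" "c \<noteq> []" "u \<in> \<Omega>"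
  shows "0 \<le> bregman_cb \<Omega> \<phi> u c"
  using cb_attained[OF assms(2), of u] assms d_nonneg by (metis subsetD)

lemma gd_nonneg:
  assumes "set c \<subseteq> \<Omega>" "c \<noteq> []"
  shows "0 \<le> gd c u"
  using cb_nonneg[OF assms] F_dom by (auto simp: gd_def)

lemma gd_measurable:
  assumes "set c \<subseteq> \<Omega>" "c \<noteq> []"
  shows "gd c \<in> borel_measurable borel"
proof -
  have "continuous_on F (\<lambda>u. bregman_cb \<Omega> \<phi> u c)"
    using continuous_cb[OF assms] by (rule continuous_on_subset) (auto intro: F_dom)
  then have "(\<lambda>u. indicator F u *\<^sub>R bregman_cb \<Omega> \<phi> u c) \<in> borel_measurable borel"
    by (intro borel_measurable_continuous_on_indicator) auto
  also have "(\<lambda>u. indicator F u *\<^sub>R bregman_cb \<Omega> \<phi> u c) = gd c"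
    by (auto simp: gd_def indicator_def)
  finally show ?thesis .
qed

lemma F_measureD:
  assumes "F_measure \<mu>"
  shows "prob_space \<mu>" "sets \<mu> = sets borel" "AE u in \<mu>. u \<in> F" "space \<mu> = UNIV"
  using assms sets_eq_imp_space_eq[of \<mu> borel] by (auto simp: F_measure_def)

text \<open>Balls and sublevel sets of \<open>gd c\<close> differ only off F, a null set, so the
  balls are measurable in the completion. The square root in the definition of balls turns the
  radius r into the level \<open>r\<^sup>2\<close>.\<close>

lemma measure_completion_ball:
  assumes \<mu>: "F_measure \<mu>" and c: "set c \<subseteq> \<Omega>" "c \<noteq> []" and r: "0 \<le> r"
  shows "measure (completion \<mu>) (bball \<Omega> \<phi> c r) = measure \<mu> {u \<in> space \<mu>. gd c u < r\<^sup>2}"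
    "measure (completion \<mu>) (bcball \<Omega> \<phi> c r) = measure \<mu> {u \<in> space \<mu>. gd c u \<le> r\<^sup>2}"
proof -
  note \<mu>' = F_measureD[OF \<mu>]
  have [measurable]: "gd c \<in> borel_measurable \<mu>"
    using gd_measurable[OF c] by (simp add: measurable_cong_sets[OF \<mu>'(2) refl])
  have AE: "AE u in completion \<mu>. u \<in> F" using \<mu>'(3) by (rule AE_completion)
  have eq: "measure (completion \<mu>) B = measure \<mu> A"
    if "AE u in completion \<mu>. u \<in> A \<longleftrightarrow> u \<in> B" "A \<in> sets \<mu>" for A B
  proof -
    have A: "A \<in> sets (completion \<mu>)" using that by simp
    have B: "B \<in> sets (completion \<mu>)"
      by (rule completion.in_sets_AE[OF that(1) A]) (simp add: \<mu>')
    have "measure (completion \<mu>) A = measure (completion \<mu>) B"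
      by (rule measure_eq_AE[OF that(1) A B])
    with that(2) show ?thesis by simp
  qed
  have sq: "sqrt x < r \<longleftrightarrow> x < r\<^sup>2" "sqrt x \<le> r \<longleftrightarrow> x \<le> r\<^sup>2" for x
    using r real_sqrt_less_iff[of x "r\<^sup>2"] real_sqrt_le_iff[of x "r\<^sup>2"] by simp_all
  show "measure (completion \<mu>) (bball \<Omega> \<phi> c r) = measure \<mu> {u \<in> space \<mu>. gd c u < r\<^sup>2}"
  proof (rule eq)
    show "AE u in completion \<mu>. u \<in> {u \<in> space \<mu>. gd c u < r\<^sup>2} \<longleftrightarrow> u \<in> bball \<Omega> \<phi> c r"
      using AE by eventually_elim (auto simp: bball_def gd_def sq \<mu>' F_dom)
  qed simp
  show "measure (completion \<mu>) (bcball \<Omega> \<phi> c r) = measure \<mu> {u \<in> space \<mu>. gd c u \<le> r\<^sup>2}"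
  proof (rule eq)
    show "AE u in completion \<mu>. u \<in> {u \<in> space \<mu>. gd c u \<le> r\<^sup>2} \<longleftrightarrow> u \<in> bcball \<Omega> \<phi> c r"
      using AE by eventually_elim (auto simp: bcball_def gd_def sq \<mu>' F_dom)
  qed simp
qed

lemma trim_radius_level:
  assumes \<mu>: "F_measure \<mu>" and c: "set c \<subseteq> \<Omega>" "c \<noteq> []" and h: "0 < h" "h < 1"
  shows "0 \<le> trim_radius \<Omega> \<phi> \<mu> h c" "is_trim_level \<mu> h (gd c) ((trim_radius \<Omega> \<phi> \<mu> h c)\<^sup>2)"
proof -
  note \<mu>' = F_measureD[OF \<mu>]
  interpret prob_space \<mu> by (rule \<mu>')
  have m: "gd c \<in> borel_measurable \<mu>"
    using gd_measurable[OF c] by (simp add: measurable_cong_sets[OF \<mu>'(2) refl])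
  obtain t where t: "is_trim_level \<mu> h (gd c) t" "\<And>s. h \<le> prob {u \<in> space \<mu>. gd c u \<le> s} \<Longrightarrow> t \<le> s"
    using trim_level_exists[OF m gd_nonneg[OF c] h] by blast
  have t0: "0 \<le> t" using t by (simp add: is_trim_level_def)
  have "trim_radius \<Omega> \<phi> \<mu> h c = sqrt t"
    unfolding trim_radius_def
  proof (rule Least_equality)
    show "0 \<le> sqrt t \<and> measure (completion \<mu>) (bball \<Omega> \<phi> c (sqrt t)) \<le> h \<and>
      h \<le> measure (completion \<mu>) (bcball \<Omega> \<phi> c (sqrt t))"
      using t(1) t0 by (simp add: measure_completion_ball[OF \<mu> c] is_trim_level_def)
  next
    fix r assume r: "0 \<le> r \<and> measure (completion \<mu>) (bball \<Omega> \<phi> c r) \<le> h \<and>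
      h \<le> measure (completion \<mu>) (bcball \<Omega> \<phi> c r)"
    then have "h \<le> prob {u \<in> space \<mu>. gd c u \<le> r\<^sup>2}"
      using measure_completion_ball(2)[OF \<mu> c, of r] by simp
    then have "t \<le> r\<^sup>2" by (rule t(2))
    then show "sqrt t \<le> r" using r by (simp add: real_le_lsqrt)
  qed
  with t t0 show "0 \<le> trim_radius \<Omega> \<phi> \<mu> h c" "is_trim_level \<mu> h (gd c) ((trim_radius \<Omega> \<phi> \<mu> h c)\<^sup>2)"
    by auto
qed

text \<open>Justifies the \<open>SOME\<close> in \<open>trimmed_distortion\<close>: the optimal
  weight, taken as a density with respect to \<mu> and rescaled, is a trimmed measure.\<close>

lemma trimmed_measure_exists:
  assumes \<mu>: "F_measure \<mu>" and c: "set c \<subseteq> \<Omega>" "c \<noteq> []" and h: "0 < h" "h < 1"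
  shows "\<exists>P'. P' \<in> trimmed_measures_at \<Omega> \<phi> \<mu> h c"
proof -
  note \<mu>' = F_measureD[OF \<mu>]
  interpret prob_space \<mu> by (rule \<mu>')
  have m: "gd c \<in> borel_measurable \<mu>"
    using gd_measurable[OF c] by (simp add: measurable_cong_sets[OF \<mu>'(2) refl])
  define r where "r = trim_radius \<Omega> \<phi> \<mu> h c"
  note r = trim_radius_level[OF assms, folded r_def]
  have sq: "sqrt x < r \<longleftrightarrow> x < r\<^sup>2" "sqrt x \<le> r \<longleftrightarrow> x \<le> r\<^sup>2" for x
    using r(1) real_sqrt_less_iff[of x "r\<^sup>2"] real_sqrt_le_iff[of x "r\<^sup>2"] by simp_all
  obtain w where w: "w \<in> borel_measurable \<mu>" "\<And>u. 0 \<le> w u" "\<And>u. w u \<le> 1" "(\<integral>u. w u \<partial>\<mu>) = h"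
    "\<And>u. gd c u < r\<^sup>2 \<Longrightarrow> w u = 1" "\<And>u. r\<^sup>2 < gd c u \<Longrightarrow> w u = 0"
    "integrable \<mu> (\<lambda>u. w u * gd c u)" "(\<integral>u. w u * gd c u \<partial>\<mu>) = trim_dual \<mu> h (gd c) (r\<^sup>2)"
    by (rule trim_weight_exists[OF m gd_nonneg[OF c] r(2)]) (rule that)
  define Q where "Q = density \<mu> (\<lambda>u. ennreal (w u))"
  have wm [measurable]: "(\<lambda>u. ennreal (w u)) \<in> borel_measurable \<mu>" using w(1) by measurable
  have sQ: "sets Q = sets borel" by (simp add: Q_def \<mu>')
  have emQ: "emeasure Q A = (\<integral>\<^sup>+ u. ennreal (w u) * indicator A u \<partial>\<mu>)" if "A \<in> sets borel" for A
    unfolding Q_def using that \<mu>' by (intro emeasure_density) auto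
  have Q_le: "emeasure Q A \<le> emeasure \<mu> A" if "A \<in> sets borel" for A
  proof -
    have "emeasure Q A \<le> (\<integral>\<^sup>+ u. indicator A u \<partial>\<mu>)" unfolding emQ[OF that]
      using w by (intro nn_integral_mono) (auto split: split_indicator simp: ennreal_le_1)
    also have "\<dots> = emeasure \<mu> A" using that \<mu>' by (intro nn_integral_indicator) auto
    finally show ?thesis .
  qed
  have wi: "integrable \<mu> w" by (rule integrable_const_bound[of _ 1]) (use w in auto)
  have Q_UNIV: "emeasure Q UNIV = ennreal h"
    using w wi by (simp add: emQ nn_integral_eq_integral)
  have eq: "measure (scale_measure (ennreal (1 / h)) Q) A = measure \<mu> A / h"
    if A: "A \<in> sets borel" "A \<subseteq> bball \<Omega> \<phi> c r" for A
  proof -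
    have "emeasure Q A = (\<integral>\<^sup>+ u. indicator A u \<partial>\<mu>)" unfolding emQ[OF A(1)]
    proof (rule nn_integral_cong_AE)
      show "AE u in \<mu>. ennreal (w u) * indicator A u = indicator A u"
        using \<mu>'(3)
      proof eventually_elim
        case (elim u)
        show ?case
        proof (cases "u \<in> A")
          case True
          with A(2) elim have "gd c u < r\<^sup>2" by (auto simp: bball_def gd_def sq)
          with w show ?thesis by simp
        qed simp
      qed
    qed
    also have "\<dots> = emeasure \<mu> A" using A \<mu>' by (intro nn_integral_indicator) auto
    finally have "measure Q A = measure \<mu> A" by (simp add: measure_def)
    then show ?thesis using h by simp
  qed
  \<comment> \<open>Closedness of F puts the support inside F. At a point of F outside the closed
    ball, the divergence exceeds the level on a whole neighbourhood inside the interior of \<Omega>,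
    where the weight vanishes almost everywhere.\<close>
  have supp: "msupport (scale_measure (ennreal (1 / h)) Q) \<subseteq> bcball \<Omega> \<phi> c r"
  proof
    fix x assume x: "x \<in> msupport (scale_measure (ennreal (1 / h)) Q)"
    have xF: "x \<in> F"
    proof (rule ccontr)
      assume "x \<notin> F"
      with x closed_F have "0 < ennreal (1/h) * emeasure Q (-F)"
        by (auto simp: msupport_def closed_def)
      moreover have "emeasure \<mu> (-F) = 0"
        using \<mu>' by (subst (asm) AE_iff_measurable[of "-F" \<mu>]) auto
      ultimately show False using Q_le[of "-F"] by auto
    qed
    show "x \<in> bcball \<Omega> \<phi> c r"
    proof (rule ccontr)
      assume nx: "x \<notin> bcball \<Omega> \<phi> c r"
      let ?V = "{u \<in> interior \<Omega>. r\<^sup>2 < bregman_cb \<Omega> \<phi> u c}"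
      have "continuous_on (interior \<Omega>) (\<lambda>u. bregman_cb \<Omega> \<phi> u c)"
        using continuous_cb[OF c] interior_subset by (rule continuous_on_subset)
      then have "open (interior \<Omega> \<inter> (\<lambda>u. bregman_cb \<Omega> \<phi> u c) -` {r\<^sup>2<..})"
        by (intro continuous_open_preimage) auto
      also have "interior \<Omega> \<inter> (\<lambda>u. bregman_cb \<Omega> \<phi> u c) -` {r\<^sup>2<..} = ?V" by auto
      finally have V: "open ?V" .
      have "x \<in> ?V" using nx xF F_sub F_dom by (auto simp: bcball_def sq)
      with x V have "0 < ennreal (1/h) * emeasure Q ?V"
        by (auto simp: msupport_def)
      moreover have "emeasure Q ?V = 0"
      proof -
        have "emeasure Q ?V = (\<integral>\<^sup>+ u. 0 \<partial>\<mu>)" unfolding emQ[OF borel_open[OF V]]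
        proof (rule nn_integral_cong_AE)
          show "AE u in \<mu>. ennreal (w u) * indicator ?V u = 0"
            using \<mu>'(3) by eventually_elim (use w(6) in \<open>auto simp: gd_def split: split_indicator\<close>)
        qed
        then show ?thesis by simp
      qed
      ultimately show False by simp
    qed
  qed
  show ?thesis
    unfolding trimmed_measures_at_def trimmed_measures_def r_def[symmetric]
    using sQ Q_le Q_UNIV eq supp by blast
qed

text \<open>The measure picked by \<open>SOME\<close> is unknown on the boundary sphere of the ball,
  but there \<open>gd c\<close> minus the level vanishes. Integrating this difference sees only the
  open ball, where the measure is forced to be \<mu> / h; hence the value is the same for every
  choice.\<close>

lemma trimmed_distortion_eq:
  assumes \<mu>: "F_measure \<mu>" and c: "set c \<subseteq> \<Omega>" "c \<noteq> []" and h: "0 < h" "h < 1"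
  obtains t where "is_trim_level \<mu> h (gd c) t"
    "trimmed_distortion \<Omega> \<phi> \<mu> h c = trim_dual \<mu> h (gd c) t"
proof -
  note \<mu>' = F_measureD[OF \<mu>]
  interpret \<mu>: prob_space \<mu> by (rule \<mu>')
  have m [measurable]: "gd c \<in> borel_measurable \<mu>"
    using gd_measurable[OF c] by (simp add: measurable_cong_sets[OF \<mu>'(2) refl])
  define r where "r = trim_radius \<Omega> \<phi> \<mu> h c"
  note r = trim_radius_level[OF assms, folded r_def]
  have sq: "sqrt x < r \<longleftrightarrow> x < r\<^sup>2" "sqrt x \<le> r \<longleftrightarrow> x \<le> r\<^sup>2" for x
    using r(1) real_sqrt_less_iff[of x "r\<^sup>2"] real_sqrt_le_iff[of x "r\<^sup>2"] by simp_all
  define P' where "P' = (SOME P'. P' \<in> trimmed_measures_at \<Omega> \<phi> \<mu> h c)"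
  have "P' \<in> trimmed_measures_at \<Omega> \<phi> \<mu> h c"
    unfolding P'_def using trimmed_measure_exists[OF assms] by (rule someI_ex)
  then obtain Q where Q: "P' = scale_measure (ennreal (1 / h)) Q" "sets Q = sets borel"
      "\<And>A. A \<in> sets borel \<Longrightarrow> emeasure Q A \<le> emeasure \<mu> A" "emeasure Q UNIV = ennreal h"
    and agree: "\<And>A. A \<in> sets borel \<Longrightarrow> A \<subseteq> bball \<Omega> \<phi> c r \<Longrightarrow> measure P' A = measure \<mu> A / h"
    and supp: "msupport P' \<subseteq> bcball \<Omega> \<phi> c r"
    unfolding trimmed_measures_at_def trimmed_measures_def r_def by blast
  have sP: "sets P' = sets borel" by (simp add: Q)
  have spP: "space P' = UNIV" using sets_eq_imp_space_eq[OF sP] by simp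
  have "emeasure P' UNIV = 1"
    unfolding Q(1) using h by (simp add: Q(4) ennreal_mult[symmetric])
  then have "emeasure P' (space P') = 1" by (simp add: spP)
  then interpret P: prob_space P' by standard
  have mP [measurable]: "gd c \<in> borel_measurable P'"
    using gd_measurable[OF c] by (simp add: measurable_cong_sets[OF sP refl])
  have FP: "AE u in P'. u \<in> F"
  proof (rule AE_I)
    have "emeasure \<mu> (-F) = 0"
      using \<mu>' by (subst (asm) AE_iff_measurable[of "-F" \<mu>]) auto
    then show "emeasure P' (-F) = 0" using Q(3)[of "-F"] by (simp add: Q(1))
  qed (auto simp: sP)
  have le: "AE u in P'. gd c u \<le> r\<^sup>2"
    using AE_in_msupport[OF sP]
    by eventually_elim (use supp in \<open>auto simp: bcball_def gd_def sq\<close>)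
  define U where "U = {u \<in> F. gd c u < r\<^sup>2}"
  have U [measurable]: "U \<in> sets borel"
    unfolding U_def using gd_measurable[OF c] by measurable
  have dens: "density P' (\<lambda>u. ennreal (indicator U u)) = density \<mu> (\<lambda>u. ennreal (indicator U u / h))"
  proof (rule measure_eqI)
    fix A assume "A \<in> sets (density P' (\<lambda>u. ennreal (indicator U u)))"
    then have A: "A \<in> sets borel" by (simp add: sP)
    have "emeasure (density P' (\<lambda>u. ennreal (indicator U u))) A
        = (\<integral>\<^sup>+ u. ennreal (indicator U u) * indicator A u \<partial>P')"
      using A by (intro emeasure_density) (auto simp: sP measurable_cong_sets[OF sP refl])
    also have "\<dots> = (\<integral>\<^sup>+ u. indicator (U \<inter> A) u \<partial>P')"
      by (intro nn_integral_cong) (auto split: split_indicator)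
    also have "\<dots> = emeasure P' (U \<inter> A)" using A by (intro nn_integral_indicator) (auto simp: sP)
    also have "\<dots> = ennreal (measure \<mu> (U \<inter> A) / h)"
    proof -
      have "U \<inter> A \<subseteq> bball \<Omega> \<phi> c r"
        by (auto simp: U_def bball_def gd_def sq F_dom)
      then show ?thesis using A agree[of "U \<inter> A"] by (simp add: P.emeasure_eq_measure)
    qed
    also have "\<dots> = ennreal (1 / h) * emeasure \<mu> (U \<inter> A)"
      using h by (simp add: \<mu>.emeasure_eq_measure ennreal_mult[symmetric])
    also have "\<dots> = ennreal (1 / h) * (\<integral>\<^sup>+ u. indicator (U \<inter> A) u \<partial>\<mu>)"
      using A by (subst nn_integral_indicator) (auto simp: \<mu>')
    also have "\<dots> = (\<integral>\<^sup>+ u. ennreal (1 / h) * indicator (U \<inter> A) u \<partial>\<mu>)"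
      using A by (intro nn_integral_cmult[symmetric]) (auto simp: measurable_cong_sets[OF \<mu>'(2) refl])
    also have "\<dots> = (\<integral>\<^sup>+ u. ennreal (indicator U u / h) * indicator A u \<partial>\<mu>)"
      by (intro nn_integral_cong) (auto split: split_indicator)
    also have "\<dots> = emeasure (density \<mu> (\<lambda>u. ennreal (indicator U u / h))) A"
      using A by (intro emeasure_density[symmetric]) (auto simp: \<mu>' measurable_cong_sets[OF \<mu>'(2) refl])
    finally show "emeasure (density P' (\<lambda>u. ennreal (indicator U u))) A
      = emeasure (density \<mu> (\<lambda>u. ennreal (indicator U u / h))) A" .
  qed (simp add: sP \<mu>')
  have bor: "f \<in> borel_measurable borel \<Longrightarrow> f \<in> borel_measurable P'"
     "f \<in> borel_measurable borel \<Longrightarrow> f \<in> borel_measurable \<mu>" for f :: "'a \<Rightarrow> real"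
    by (simp_all add: measurable_cong_sets[OF sP refl] measurable_cong_sets[OF \<mu>'(2) refl])
  have g: "gd c \<in> borel_measurable borel" by (rule gd_measurable[OF c])
  have "(\<integral>u. gd c u - r\<^sup>2 \<partial>P') = (\<integral>u. indicator U u * (gd c u - r\<^sup>2) \<partial>P')"
  proof (rule integral_cong_AE)
    show "AE u in P'. gd c u - r\<^sup>2 = indicator U u * (gd c u - r\<^sup>2)"
      using FP le by eventually_elim (auto simp: U_def split: split_indicator)
  qed (use g in \<open>auto intro!: bor\<close>)
  also have "\<dots> = (\<integral>u. gd c u - r\<^sup>2 \<partial>density P' (\<lambda>u. ennreal (indicator U u)))"
    using g by (subst integral_density) (auto intro!: bor)
  also have "\<dots> = (\<integral>u. indicator U u / h * (gd c u - r\<^sup>2) \<partial>\<mu>)"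
    unfolding dens using g h by (subst integral_density) (auto intro!: bor)
  also have "\<dots> = (\<integral>u. - (1 / h) * max 0 (r\<^sup>2 - gd c u) \<partial>\<mu>)"
  proof (rule integral_cong_AE)
    show "AE u in \<mu>. indicator U u / h * (gd c u - r\<^sup>2) = - (1 / h) * max 0 (r\<^sup>2 - gd c u)"
      using \<mu>'(3)
    proof eventually_elim
      case (elim u)
      show ?case
      proof (cases "gd c u < r\<^sup>2")
        case True
        then have "max 0 (r\<^sup>2 - gd c u) = r\<^sup>2 - gd c u" "u \<in> U" using elim by (auto simp: U_def)
        then show ?thesis by (simp add: algebra_simps diff_divide_distrib)
      qed (auto simp: U_def)
    qed
  qed (use g in \<open>auto intro!: bor\<close>)
  finally have 1: "h * (\<integral>u. gd c u - r\<^sup>2 \<partial>P') = - (\<integral>u. max 0 (r\<^sup>2 - gd c u) \<partial>\<mu>)"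
    using h by simp
  have "integrable P' (gd c)"
    by (rule P.integrable_const_bound[of _ "r\<^sup>2"]) (use le gd_nonneg[OF c] in auto)
  then have 2: "(\<integral>u. gd c u - r\<^sup>2 \<partial>P') = (\<integral>u. gd c u \<partial>P') - r\<^sup>2"
    by (simp add: P.prob_space)
  have gC: "gd c \<in> borel_measurable (completion P')" using mP by (rule measurable_completion)
  have AEC: "AE u in completion P'. bregman_cb \<Omega> \<phi> u c = gd c u"
    using AE_completion[OF FP] by eventually_elim (simp add: gd_def)
  have "(\<integral>u. bregman_cb \<Omega> \<phi> u c \<partial>completion P') = (\<integral>u. gd c u \<partial>completion P')"
    \<comment> \<open>Nothing is known about the divergence off F, so its measurability comes from
      completeness.\<close>
    by (rule integral_cong_AE[OF completion.measurable_AE_eq[OF gC AEC] gC AEC]) simp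
  also have "\<dots> = (\<integral>u. gd c u \<partial>P')" using mP by (rule integral_completion)
  finally have "trimmed_distortion \<Omega> \<phi> \<mu> h c = h * (\<integral>u. gd c u \<partial>P')"
    by (simp add: trimmed_distortion_def P'_def)
  with 1 2 have "trimmed_distortion \<Omega> \<phi> \<mu> h c = trim_dual \<mu> h (gd c) (r\<^sup>2)"
    by (simp add: trim_dual_def algebra_simps)
  with r(2) that show thesis by blast
qed

end

section \<open>Cells and weighted means\<close>

text \<open>A hyperplane strictly separating the mean from F would contradict the integrated
  inequality for the points of F.\<close>

lemma (in prob_space) mean_in_closed_convex:
  fixes X :: "'a \<Rightarrow> 'b::euclidean_space"
  assumes F: "closed F" "convex F" and v: "integrable M v" "\<And>u. 0 \<le> v u"
    and X: "integrable M (\<lambda>u. v u *\<^sub>R X u)" "\<And>u. v u \<noteq> 0 \<Longrightarrow> X u \<in> F"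
    and a: "0 < (\<integral>u. v u \<partial>M)"
  shows "(1 / (\<integral>u. v u \<partial>M)) *\<^sub>R (\<integral>u. v u *\<^sub>R X u \<partial>M) \<in> F" (is "?m \<in> F")
proof (rule ccontr)
  assume "?m \<notin> F"
  from separating_hyperplane_closed_point[OF F(2,1) this]
  obtain n b where n: "n \<bullet> ?m < b" "\<And>x. x \<in> F \<Longrightarrow> b < n \<bullet> x" by blast
  have "b * (\<integral>u. v u \<partial>M) = (\<integral>u. b * v u \<partial>M)" by simp
  also have "\<dots> \<le> (\<integral>u. n \<bullet> (v u *\<^sub>R X u) \<partial>M)"
  proof (rule integral_mono)
    show "integrable M (\<lambda>u. n \<bullet> (v u *\<^sub>R X u))" by (rule integrable_inner_right) (rule X)
    fix u
    show "b * v u \<le> n \<bullet> (v u *\<^sub>R X u)"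
    proof (cases "v u = 0")
      case False
      then have "b \<le> n \<bullet> X u" using X(2) n(2) by (simp add: less_imp_le)
      then have "v u * b \<le> v u * (n \<bullet> X u)" using v(2) by (intro mult_left_mono)
      then show ?thesis by (simp add: mult.commute)
    qed simp
  qed (use v in auto)
  also have "\<dots> = n \<bullet> (\<integral>u. v u *\<^sub>R X u \<partial>M)" using X(1) by (intro integral_inner_right) auto
  also have "\<dots> = (\<integral>u. v u \<partial>M) * (n \<bullet> ?m)" using a by simp
  also have "\<dots> < (\<integral>u. v u \<partial>M) * b" using a n(1) by (intro mult_strict_left_mono)
  finally show False by (simp add: mult.commute)
qed

context bregman_support begin

lemma gd_le: "x \<in> set c \<Longrightarrow> u \<in> F \<Longrightarrow> gd c u \<le> d u x"
  using cb_le by (simp add: gd_def)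

lemma gd_borel: "F_measure \<mu> \<Longrightarrow> set c \<subseteq> \<Omega> \<Longrightarrow> c \<noteq> [] \<Longrightarrow> gd c \<in> borel_measurable \<mu>"
  using gd_measurable[of c] by (simp add: measurable_cong_sets[OF F_measureD(2) refl])

lemma trim_dual_le_distortion:
  assumes \<mu>: "F_measure \<mu>" and c: "set c \<subseteq> \<Omega>" "c \<noteq> []" and h: "0 < h" "h < 1"
  shows "trim_dual \<mu> h (gd c) s \<le> trimmed_distortion \<Omega> \<phi> \<mu> h c"
proof -
  obtain t where "is_trim_level \<mu> h (gd c) t" "trimmed_distortion \<Omega> \<phi> \<mu> h c = trim_dual \<mu> h (gd c) t"
    by (rule trimmed_distortion_eq[OF assms])
  then show ?thesis
    using prob_space.trim_dual_le[OF F_measureD(1)[OF \<mu>] gd_borel[OF \<mu> c] gd_nonneg[OF c]] by simp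
qed

lemma distortion_nonneg:
  assumes \<mu>: "F_measure \<mu>" and c: "set c \<subseteq> \<Omega>" "c \<noteq> []" and h: "0 < h" "h < 1"
  shows "0 \<le> trimmed_distortion \<Omega> \<phi> \<mu> h c"
proof -
  have "max 0 (0 - gd c u) = 0" for u using gd_nonneg[OF c, of u] by simp
  then show ?thesis using trim_dual_le_distortion[OF assms, of 0] by (simp only: trim_dual_def) simp
qed

text \<open>Lets a codebook of length k with a repeated entry be compared with one of length k -
  1.\<close>

lemma distortion_cong_set:
  assumes \<mu>: "F_measure \<mu>" and c: "set c \<subseteq> \<Omega>" "c \<noteq> []" and h: "0 < h" "h < 1" and eq: "set c' = set c"
  shows "trimmed_distortion \<Omega> \<phi> \<mu> h c' = trimmed_distortion \<Omega> \<phi> \<mu> h c"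
proof -
  have c': "set c' \<subseteq> \<Omega>" "c' \<noteq> []" using c eq by auto
  have g: "gd c' = gd c" by (auto simp: gd_def bregman_cb_def eq)
  obtain t where t: "trimmed_distortion \<Omega> \<phi> \<mu> h c = trim_dual \<mu> h (gd c) t"
    by (rule trimmed_distortion_eq[OF \<mu> c h])
  obtain t' where t': "trimmed_distortion \<Omega> \<phi> \<mu> h c' = trim_dual \<mu> h (gd c') t'"
    by (rule trimmed_distortion_eq[OF \<mu> c' h])
  show ?thesis
    using t t' trim_dual_le_distortion[OF \<mu> c h, of t'] trim_dual_le_distortion[OF \<mu> c' h, of t]
    unfolding g by linarith
qed

lemma integrable_weight_d:
  assumes \<mu>: "F_measure \<mu>" and v: "v \<in> borel_measurable \<mu>" "\<And>u. 0 \<le> v u" "\<And>u. v u \<le> 1"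
    and B: "compact B" "B \<subseteq> \<Omega>" "\<And>u. v u \<noteq> 0 \<Longrightarrow> u \<in> B" and x: "x \<in> \<Omega>"
  shows "integrable \<mu> (\<lambda>u. v u * d u x)"
proof -
  note \<mu>' = F_measureD[OF \<mu>]
  interpret prob_space \<mu> by (rule \<mu>')
  note [measurable_cong] = \<mu>'(2)
  note [measurable] = v(1)
  have c: "continuous_on B (\<lambda>u. d u x)" using continuous_d[OF x] B(2) by (rule continuous_on_subset)
  have [measurable]: "(\<lambda>u. indicator B u *\<^sub>R d u x) \<in> borel_measurable borel"
    using B(1) c by (intro borel_measurable_continuous_on_indicator) (auto simp: compact_imp_closed)
  have "compact {x}" "{x} \<subseteq> \<Omega>" using x by auto
  from d_bounded[OF B(1,2) this] obtain T where T: "\<And>u c. u \<in> B \<Longrightarrow> c \<in> {x} \<Longrightarrow> d u c \<le> T"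
    by blast
  have eq: "v u * d u x = v u * (indicator B u *\<^sub>R d u x)" for u
    using B(3)[of u] by (auto split: split_indicator)
  show ?thesis
  proof (rule integrable_const_bound)
    show "AE u in \<mu>. norm (v u * d u x) \<le> \<bar>T\<bar>"
    proof (rule AE_I2)
      fix u
      show "norm (v u * d u x) \<le> \<bar>T\<bar>"
      proof (cases "v u = 0")
        case False
        then have "0 \<le> d u x" "d u x \<le> \<bar>T\<bar>" using B T[of u x] d_nonneg[OF _ x, of u] by auto
        then have "v u * d u x \<le> d u x" "0 \<le> v u * d u x"
          using v(2,3)[of u] mult_right_mono[of "v u" 1 "d u x"] by simp_all
        with \<open>d u x \<le> \<bar>T\<bar>\<close> show ?thesis unfolding real_norm_def by linarith
      qed simp
    qed
  qed (subst eq, measurable)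
qed

text \<open>The Bregman form of the bias-variance identity: \<open>\<phi> u\<close> cancels in
  \<open>d u c - d u m\<close>, the rest is affine in u and integrates to the mass times its value
  at the mean m, which is \<open>d m c\<close>.\<close>

lemma weighted_mean_distortion:
  assumes \<mu>: "F_measure \<mu>" and v: "v \<in> borel_measurable \<mu>" "\<And>u. 0 \<le> v u" "\<And>u. v u \<le> 1"
    and B: "compact B" "B \<subseteq> F" "\<And>u. v u \<noteq> 0 \<Longrightarrow> u \<in> B" and c: "c \<in> \<Omega>"
    and a: "0 < (\<integral>u. v u \<partial>\<mu>)"
  defines "m \<equiv> (1 / (\<integral>u. v u \<partial>\<mu>)) *\<^sub>R (\<integral>u. v u *\<^sub>R u \<partial>\<mu>)"
  shows "m \<in> F" "(\<integral>u. v u * d u m \<partial>\<mu>) = (\<integral>u. v u * d u c \<partial>\<mu>) - (\<integral>u. v u \<partial>\<mu>) * d m c"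
    "norm m \<le> (\<integral>u. indicator B u * norm u \<partial>\<mu>) / (\<integral>u. v u \<partial>\<mu>)"
proof -
  note \<mu>' = F_measureD[OF \<mu>]
  interpret prob_space \<mu> by (rule \<mu>')
  note [measurable_cong] = \<mu>'(2)
  note [measurable] = v(1)
  have B\<Omega>: "B \<subseteq> \<Omega>" using B F_dom by auto
  have [measurable]: "B \<in> sets borel" using B by (simp add: compact_imp_closed)
  obtain b where b: "\<And>u. u \<in> B \<Longrightarrow> norm u \<le> b" using compact_imp_bounded[OF B(1)] by (auto simp: bounded_iff)
  define a where "a = (\<integral>u. v u \<partial>\<mu>)"
  have vi: "integrable \<mu> v" by (rule integrable_const_bound[of _ 1]) (use v in auto)
  have vn: "norm (v u *\<^sub>R u) \<le> indicator B u * norm u" for u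
    using v(2,3)[of u] B(3)[of u] by (cases "v u = 0") (auto intro: mult_left_le_one_le)
  have bi: "integrable \<mu> (\<lambda>u. indicator B u * norm u)"
    by (rule integrable_const_bound[of _ "\<bar>b\<bar>"]) (use b in \<open>force split: split_indicator\<close>)+
  have vu: "integrable \<mu> (\<lambda>u. v u *\<^sub>R u)"
    by (rule Bochner_Integration.integrable_bound[OF bi]) (use vn in \<open>auto intro: AE_I2\<close>)
  have am: "(\<integral>u. v u *\<^sub>R u \<partial>\<mu>) = a *\<^sub>R m" using \<open>0 < (\<integral>u. v u \<partial>\<mu>)\<close> by (simp add: m_def a_def)
  show mF: "m \<in> F" unfolding m_def
    by (rule mean_in_closed_convex[OF closed_F convex_F vi v(2) vu _ a]) (use B in auto)
  have "norm (\<integral>u. v u *\<^sub>R u \<partial>\<mu>) \<le> (\<integral>u. indicator B u * norm u \<partial>\<mu>)"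
    by (rule Bochner_Integration.integral_norm_bound_integral[OF vu bi]) (rule vn)
  then show "norm m \<le> (\<integral>u. indicator B u * norm u \<partial>\<mu>) / (\<integral>u. v u \<partial>\<mu>)"
    using a by (simp add: m_def divide_right_mono)
  have m: "m \<in> \<Omega>" using mF by (rule F_dom)
  have vd: "integrable \<mu> (\<lambda>u. v u * d u x)" if "x \<in> \<Omega>" for x
    by (rule integrable_weight_d[OF \<mu> v B(1) B\<Omega> B(3) that])
  define K where "K = \<phi> m - \<phi> c + grad c \<bullet> c - grad m \<bullet> m"
  have eq: "v u * d u c - v u * d u m = K * v u + (grad m - grad c) \<bullet> (v u *\<^sub>R u)" for u
    by (simp add: bregman_def K_def algebra_simps inner_diff_left inner_diff_right)
  have "(\<integral>u. v u * d u c \<partial>\<mu>) - (\<integral>u. v u * d u m \<partial>\<mu>) = (\<integral>u. v u * d u c - v u * d u m \<partial>\<mu>)"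
    using vd m c by simp
  also have "\<dots> = (\<integral>u. K * v u \<partial>\<mu>) + (\<integral>u. (grad m - grad c) \<bullet> (v u *\<^sub>R u) \<partial>\<mu>)"
    unfolding eq by (intro Bochner_Integration.integral_add integrable_mult_right vi integrable_inner_right vu)
  also have "(\<integral>u. (grad m - grad c) \<bullet> (v u *\<^sub>R u) \<partial>\<mu>) = (grad m - grad c) \<bullet> (a *\<^sub>R m)"
    unfolding am[symmetric] by (intro integral_inner_right vu)
  also have "(\<integral>u. K * v u \<partial>\<mu>) = K * a" by (simp add: a_def)
  also have "K * a + (grad m - grad c) \<bullet> (a *\<^sub>R m) = a * d m c"
    by (simp add: bregman_def K_def algebra_simps inner_diff_left inner_diff_right)
  finally show "(\<integral>u. v u * d u m \<partial>\<mu>) = (\<integral>u. v u * d u c \<partial>\<mu>) - (\<integral>u. v u \<partial>\<mu>) * d m c"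
    by (simp add: a_def)
qed

text \<open>Ties are broken towards the smallest index, so that the cells partition the support.\<close>
definition cell :: "'a list \<Rightarrow> nat \<Rightarrow> 'a set" where
  "cell c i = {u \<in> F. (\<forall>j<length c. d u (c!i) \<le> d u (c!j)) \<and> (\<forall>j<i. d u (c!i) < d u (c!j))}"

lemma cell_measurable:
  assumes "set c \<subseteq> \<Omega>" "i < length c"
  shows "cell c i \<in> sets borel"
proof -
  have m: "(\<lambda>u. indicator F u *\<^sub>R d u (c!j)) \<in> borel_measurable borel" if "j < length c" for j
  proof -
    have "c ! j \<in> \<Omega>" using assms(1) that by (auto simp: subset_iff)
    then have "continuous_on F (\<lambda>u. d u (c!j))"
      using continuous_on_subset[OF continuous_d] F_dom by blast
    then show ?thesis by (intro borel_measurable_continuous_on_indicator) auto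
  qed
  have "cell c i = {u \<in> space borel. u \<in> F} \<inter>
     ({u \<in> space borel. (\<forall>j\<in>{..<length c}. indicator F u *\<^sub>R d u (c!i) \<le> indicator F u *\<^sub>R d u (c!j))} \<inter>
      {u \<in> space borel. (\<forall>j\<in>{..<i}. indicator F u *\<^sub>R d u (c!i) < indicator F u *\<^sub>R d u (c!j))})"
    by (auto simp: cell_def)
  also have "\<dots> \<in> sets borel"
    using assms(2)
    by (intro sets.Int sets.sets_Collect_finite_All borel_measurable_le borel_measurable_less m) auto
  finally show ?thesis .
qed

lemma cell_partition:
  assumes "c \<noteq> []" "u \<in> F"
  shows "(\<Sum>i<length c. indicator (cell c i) u) = (1::real)"
proof -
  \<comment> \<open>The least index attaining the minimum, in accordance with the tie-breaking in
    \<open>cell\<close>.\<close>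
  define j where "j = (LEAST i. i < length c \<and> bregman_cb \<Omega> \<phi> u c = d u (c!i))"
  obtain x where "x \<in> set c" "bregman_cb \<Omega> \<phi> u c = d u x" using cb_attained[OF assms(1), of u] by blast
  then obtain i where "i < length c \<and> bregman_cb \<Omega> \<phi> u c = d u (c!i)" by (metis in_set_conv_nth)
  then have j: "j < length c \<and> bregman_cb \<Omega> \<phi> u c = d u (c!j)" unfolding j_def by (rule LeastI)
  have least: "i < length c \<Longrightarrow> bregman_cb \<Omega> \<phi> u c = d u (c!i) \<Longrightarrow> j \<le> i" for i
    unfolding j_def by (rule Least_le) blast
  have le: "d u (c!j) \<le> d u (c!i)" if "i < length c" for i
    using cb_le[of "c!i" c u] j that by simp
  have jc: "u \<in> cell c j"
  proof -
    have "d u (c!j) < d u (c!i)" if "i < j" for i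
    proof -
      have i: "i < length c" using that j by simp
      then have "d u (c!j) \<noteq> d u (c!i)" using least[OF i] j that by auto
      with le[OF i] show ?thesis by simp
    qed
    with assms(2) le show ?thesis by (simp add: cell_def)
  qed
  have "u \<in> cell c i \<longleftrightarrow> i = j" if i: "i < length c" for i
  proof
    assume ui: "u \<in> cell c i"
    show "i = j"
    proof (rule linorder_cases[of i j])
      assume "i < j"
      then have "d u (c!j) < d u (c!i)" using jc by (simp add: cell_def)
      moreover have "d u (c!i) \<le> d u (c!j)" using ui j by (simp add: cell_def)
      ultimately show ?thesis by simp
    next
      assume "j < i"
      then have "d u (c!i) < d u (c!j)" using ui by (simp add: cell_def)
      with le[OF i] show ?thesis by simp
    qed
  qed (use jc in simp)
  then have "(\<Sum>i<length c. indicator (cell c i) u) = (\<Sum>i<length c. if i = j then 1 else (0::real))"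
    by (intro sum.cong) (auto simp: indicator_def)
  also have "\<dots> = 1" using j by simp
  finally show ?thesis .
qed

lemma gd_cell:
  assumes "u \<in> cell c i" "i < length c"
  shows "gd c u = d u (c!i)"
proof -
  have "bregman_cb \<Omega> \<phi> u c \<le> d u (c!i)" using assms by (intro cb_le) auto
  moreover
  have "c \<noteq> []" using assms(2) by auto
  from cb_attained[OF this, of u] obtain x where "x \<in> set c" "bregman_cb \<Omega> \<phi> u c = d u x" by blast
  then have "d u (c!i) \<le> bregman_cb \<Omega> \<phi> u c"
    using assms(1) by (auto simp: cell_def in_set_conv_nth)
  ultimately show ?thesis using assms(1) by (simp add: gd_def cell_def)
qed

end

section \<open>Replacing codepoints by means of heavy cells\<close>

context bregman_support begin

text \<open>The optimal weight for c is cut down to the heavy cells inside B', and the lost mass is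
  refilled inside B and charged to the center \<open>m i0\<close>. Passing to the means saves at
  least \<open>\<alpha> * d (m i) (c ! i)\<close> per heavy cell; the refilling costs at most its
  mass times M1. The bound M1 concerns means of norm at most \<open>E / (h / (2 * k))\<close>, a
  radius free of \<alpha> and \<epsilon>, so that both can be chosen small relative to M1. Discarded
  slots of c' repeat the entry at i0, which keeps the length k.\<close>

lemma compactify:
  assumes \<mu>: "F_measure \<mu>" and h: "0 < h" "h < 1" and c: "set c \<subseteq> \<Omega>" "length c = k" "0 < k"
    and B: "compact B" "B \<subseteq> F" "(1 + h) / 2 \<le> measure \<mu> B"
    and B': "compact B'" "B' \<subseteq> F" "1 - \<epsilon> \<le> measure \<mu> B'" "(\<integral>u. indicator B' u * norm u \<partial>\<mu>) \<le> E"
    and \<alpha>: "0 < \<alpha>" "\<alpha> \<le> h / (2 * k)" "\<epsilon> \<le> h / 2" "\<epsilon> + k * \<alpha> \<le> (1 - h) / 2"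
    and M1: "0 \<le> M1" "\<And>u m. u \<in> B \<Longrightarrow> m \<in> F \<Longrightarrow> norm m \<le> E / (h / (2 * k)) \<Longrightarrow> d u m \<le> M1"
  obtains S c' i0 where "S \<subseteq> {..<k}" "length c' = k" "i0 \<in> S"
    "\<And>i. i < k \<Longrightarrow> i \<notin> S \<Longrightarrow> c' ! i = c' ! i0"
    "\<And>x. x \<in> set c' \<Longrightarrow> x \<in> F \<and> norm x \<le> E / \<alpha>"
    "trimmed_distortion \<Omega> \<phi> \<mu> h c' + \<alpha> * (\<Sum>i\<in>S. d (c'!i) (c!i))
      \<le> trimmed_distortion \<Omega> \<phi> \<mu> h c + (\<epsilon> + (if S = {..<k} then 0 else k * \<alpha>)) * M1"
proof -
  note \<mu>' = F_measureD[OF \<mu>]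
  interpret prob_space \<mu> by (rule \<mu>')
  note [measurable_cong] = \<mu>'(2)
  have c0: "c \<noteq> []" using c by auto
  note [measurable] = gd_borel[OF \<mu> c(1) c0]
  have bB [measurable]: "B \<in> sets borel" "B' \<in> sets borel" using B B' by (auto simp: compact_imp_closed)
  have B\<Omega>: "B \<subseteq> \<Omega>" "B' \<subseteq> \<Omega>" using B B' F_dom by auto
  have c\<Omega>: "c ! i \<in> \<Omega>" if "i < k" for i using c that by auto
  have [measurable]: "cell c i \<in> sets borel" if "i < k" for i using cell_measurable c that by auto
  obtain t where t: "is_trim_level \<mu> h (gd c) t" and Rt: "trimmed_distortion \<Omega> \<phi> \<mu> h c = trim_dual \<mu> h (gd c) t"
    by (rule trimmed_distortion_eq[OF \<mu> c(1) c0 h])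
  obtain w where w: "w \<in> borel_measurable \<mu>" "\<And>u. 0 \<le> w u" "\<And>u. w u \<le> 1" "(\<integral>u. w u \<partial>\<mu>) = h"
    "\<And>u. gd c u < t \<Longrightarrow> w u = 1" "\<And>u. t < gd c u \<Longrightarrow> w u = 0"
    "integrable \<mu> (\<lambda>u. w u * gd c u)" "(\<integral>u. w u * gd c u \<partial>\<mu>) = trim_dual \<mu> h (gd c) t"
    by (rule trim_weight_exists[OF gd_borel[OF \<mu> c(1) c0] gd_nonneg[OF c(1) c0] t]) (rule that)
  note [measurable] = w(1)
  have wi: "integrable \<mu> w" by (rule integrable_const_bound[of _ 1]) (use w in auto)
  \<comment> \<open>The share of cell i in the optimal weight, cut off outside B' so that its first
    moment is at most E.\<close>
  define v where "v i u = w u * indicator (cell c i) u * indicator B' u" for i u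
  have vm [measurable]: "v i \<in> borel_measurable \<mu>" if "i < k" for i
    unfolding v_def using that by measurable
  have v01: "0 \<le> v i u" "v i u \<le> 1" for i u using w(2,3)[of u] by (auto simp: v_def split: split_indicator)
  have vB: "v i u \<noteq> 0 \<Longrightarrow> u \<in> B'" for i u by (auto simp: v_def indicator_def split: if_splits)
  have vi: "integrable \<mu> (v i)" if "i < k" for i
    by (rule integrable_const_bound[of _ 1]) (use v01 vm[OF that] in auto)
  have v_sum: "(\<Sum>i<k. v i u) = w u * indicator B' u" for u
  proof (cases "u \<in> B'")
    case True
    then have "(\<Sum>i<k. v i u) = w u * (\<Sum>i<k. indicator (cell c i) u)"
      by (simp add: v_def sum_distrib_left)
    also have "(\<Sum>i<k. indicator (cell c i) u) = (1::real)"
      using cell_partition[OF c0, of u] True B'(2) c(2) by auto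
    finally show ?thesis using True by simp
  qed (simp add: v_def)
  have v_part: "(\<Sum>i\<in>S. v i u) \<le> w u" if "S \<subseteq> {..<k}" for S u
  proof -
    have "(\<Sum>i\<in>S. v i u) \<le> (\<Sum>i<k. v i u)" using that v01 by (intro sum_mono2) auto
    also have "\<dots> \<le> w u" using w(2)[of u] by (simp add: v_sum split: split_indicator)
    finally show ?thesis .
  qed
  define a where "a i = (\<integral>u. v i u \<partial>\<mu>)" for i
  have a_sum: "h - \<epsilon> \<le> (\<Sum>i<k. a i)"
  proof -
    have Bi: "integrable \<mu> (indicat_real B')" by (intro integrable_event_indicator) simp
    \<comment> \<open>Since w \<le> 1, the function w - 1 plus the indicator of B' is at most w
      times that indicator; the cutoff therefore loses mass at most \<epsilon>.\<close>
    have "h - 1 + measure \<mu> B' = (\<integral>u. (w u - 1) + indicator B' u \<partial>\<mu>)"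
      using w(4) wi Bi prob_space by (simp add: \<mu>')
    also have "\<dots> \<le> (\<integral>u. (\<Sum>i<k. v i u) \<partial>\<mu>)"
      unfolding v_sum
    proof (rule integral_mono)
      show "integrable \<mu> (\<lambda>u. w u * indicator B' u)"
        by (rule integrable_const_bound[of _ 1]) (use w in \<open>auto split: split_indicator\<close>)
    qed (use w wi Bi in \<open>auto split: split_indicator\<close>)
    also have "\<dots> = (\<Sum>i<k. a i)" unfolding a_def using vi by (intro Bochner_Integration.integral_sum) auto
    finally show ?thesis using B'(3) by linarith
  qed
  define S where "S = {i. i < k \<and> \<alpha> \<le> a i}"
  have S: "S \<subseteq> {..<k}" "finite S" by (auto simp: S_def)
  \<comment> \<open>Pigeonhole: as \<epsilon> \<le> h / 2, the k cells together keep at least h / 2.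
    The norm of the mean of this cell is bounded independently of \<alpha>, so it can receive the
    refilled mass.\<close>
  obtain i0 where i0: "i0 < k" "h / (2 * k) \<le> a i0"
  proof -
    have "\<exists>i<k. h / (2 * k) \<le> a i"
    proof (rule ccontr)
      assume "\<not> (\<exists>i<k. h / (2 * k) \<le> a i)"
      then have "(\<Sum>i<k. a i) < (\<Sum>i<k. h / (2 * k))" using c(3) by (intro sum_strict_mono) (auto simp: not_le)
      also have "\<dots> = h / 2" using c(3) by simp
      finally show False using a_sum \<alpha>(3) by linarith
    qed
    with that show thesis by blast
  qed
  then have i0S: "i0 \<in> S" using \<alpha> by (auto simp: S_def)
  define m where "m i = (1 / a i) *\<^sub>R (\<integral>u. v i u *\<^sub>R u \<partial>\<mu>)" for i
  have a_pos: "0 < a i" if "i \<in> S" for i using that \<alpha>(1) by (auto simp: S_def)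
  have mm: "m i \<in> F" "(\<integral>u. v i u * d u (m i) \<partial>\<mu>) = (\<integral>u. v i u * d u (c!i) \<partial>\<mu>) - a i * d (m i) (c!i)"
    "norm (m i) \<le> E / a i" if i: "i \<in> S" for i
  proof -
    have ik: "i < k" using i S by auto
    note wm = weighted_mean_distortion[OF \<mu> vm[OF ik] v01(1)[of i] v01(2)[of i] B'(1,2) vB[of i] c\<Omega>[OF ik] a_pos[OF i, unfolded a_def], folded a_def, folded m_def]
    show "m i \<in> F" "(\<integral>u. v i u * d u (m i) \<partial>\<mu>) = (\<integral>u. v i u * d u (c!i) \<partial>\<mu>) - a i * d (m i) (c!i)"
      using wm(1,2) by auto
    show "norm (m i) \<le> E / a i" using wm(3) divide_right_mono[OF B'(4), of "a i"] a_pos[OF i] by linarith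
  qed
  have E0: "0 \<le> E" using B'(4) order_trans[OF Bochner_Integration.integral_nonneg] by (metis (no_types, lifting) indicator_pos_le mult_nonneg_nonneg norm_ge_zero)
  define c' where "c' = map (\<lambda>i. if i \<in> S then m i else m i0) [0..<k]"
  have c'l: "length c' = k" by (simp add: c'_def)
  have c'i: "c' ! i = m i" if "i \<in> S" for i using that S by (auto simp: c'_def)
  have c'n: "c' ! i = m i0" if "i < k" "i \<notin> S" for i using that by (simp add: c'_def)
  have c'F: "x \<in> F \<and> norm x \<le> E / \<alpha>" if x: "x \<in> set c'" for x
  proof -
    obtain i where i: "i \<in> S" "x = m i" using x i0S by (auto simp: c'_def split: if_splits)
    have "E / a i \<le> E / \<alpha>" using i(1) \<alpha>(1) E0 by (intro divide_left_mono) (auto simp: S_def)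
    with mm[OF i(1)] i(2) show ?thesis by auto
  qed
  have c'\<Omega>: "set c' \<subseteq> \<Omega>" "c' \<noteq> []" using c'F F_dom c(3) c'l by auto
  note [measurable] = gd_borel[OF \<mu> c'\<Omega>]
  have c'mem: "m i \<in> set c'" if "i \<in> S" for i using c'i[OF that] c'l S that by (metis lessThan_iff nth_mem subsetD)
  define w1 where "w1 u = (\<Sum>i\<in>S. v i u)" for u
  have w1m [measurable]: "w1 \<in> borel_measurable \<mu>" unfolding w1_def using S vm by (intro borel_measurable_sum) auto
  have w101: "0 \<le> w1 u" "w1 u \<le> w u" for u unfolding w1_def using v01 v_part[OF S(1)] by (auto intro: sum_nonneg)
  have w1i: "integrable \<mu> w1" unfolding w1_def using S vi by (intro Bochner_Integration.integrable_sum) auto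
  have w1I: "(\<integral>u. w1 u \<partial>\<mu>) = (\<Sum>i\<in>S. a i)"
    unfolding w1_def a_def using S vi by (intro Bochner_Integration.integral_sum) auto
  define \<tau> where "\<tau> = h - (\<integral>u. w1 u \<partial>\<mu>)"
  have \<tau>0: "0 \<le> \<tau>" unfolding \<tau>_def w(4)[symmetric] using integral_mono[OF w1i wi] w101 by simp
  have \<tau>1: "\<tau> \<le> \<epsilon> + (if S = {..<k} then 0 else k * \<alpha>)"
  proof -
    have "(\<Sum>i<k. a i) = (\<Sum>i\<in>S. a i) + (\<Sum>i\<in>{..<k} - S. a i)"
      using S by (simp add: sum.subset_diff add.commute)
    moreover have "(\<Sum>i\<in>{..<k} - S. a i) \<le> (if S = {..<k} then 0 else k * \<alpha>)"
    proof (cases "S = {..<k}")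
      case False
      have "(\<Sum>i\<in>{..<k} - S. a i) \<le> (\<Sum>i\<in>{..<k} - S. \<alpha>)" by (intro sum_mono) (auto simp: S_def)
      also have "\<dots> = card ({..<k} - S) * \<alpha>" by simp
      also have "\<dots> \<le> k * \<alpha>" using \<alpha>(1) card_mono[of "{..<k}" "{..<k} - S"] by (intro mult_right_mono) auto
      finally show ?thesis using False by simp
    qed simp
    ultimately show ?thesis using a_sum by (simp add: \<tau>_def w1I)
  qed
  have \<epsilon>0: "0 \<le> \<epsilon>" using B'(3) prob_le_1[of B'] by linarith
  have \<tau>2: "\<tau> \<le> (1 - h) / 2"
  proof -
    have "0 \<le> k * \<alpha>" using \<alpha>(1) by simp
    then show ?thesis using \<tau>1 \<alpha>(4) by (cases "S = {..<k}") auto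
  qed
  have w1le: "w1 u \<le> 1" for u using w101(2)[of u] w(3)[of u] by linarith
  \<comment> \<open>The room that w1 leaves in B. It is at least (1 + h) / 2 - h, because w1 \<le> w
    and w has mass h.\<close>
  define q where "q = (\<integral>u. (1 - w1 u) * indicator B u \<partial>\<mu>)"
  have qi: "integrable \<mu> (\<lambda>u. (1 - w1 u) * indicator B u)"
  proof (rule integrable_const_bound[of _ 1])
    show "AE u in \<mu>. norm ((1 - w1 u) * indicator B u) \<le> 1"
    proof (rule AE_I2)
      fix u show "norm ((1 - w1 u) * indicator B u) \<le> 1"
        using w101(1)[of u] w1le[of u] by (auto split: split_indicator)
    qed
  qed simp
  have q: "(1 - h) / 2 \<le> q"
  proof -
    have Bi: "integrable \<mu> (indicat_real B)" by (intro integrable_event_indicator) simp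
    have "(1 + h) / 2 - h \<le> measure \<mu> B - (\<integral>u. w u \<partial>\<mu>)" using B(3) w(4) by simp
    also have "\<dots> = (\<integral>u. indicator B u - w u \<partial>\<mu>)"
      using wi Bi by (simp add: \<mu>')
    also have "\<dots> \<le> q" unfolding q_def
      by (rule integral_mono) (use wi w(2) w101 qi Bi in \<open>auto split: split_indicator\<close>)
    finally show ?thesis by (simp add: field_simps)
  qed
  have q0: "0 < q" using less_le_trans[OF _ q, of 0] h by simp
  \<comment> \<open>The same fraction of the free room is filled everywhere in B; the bound of
    \<tau> by (1 - h) / 2 makes it at most 1.\<close>
  define l where "l = \<tau> / q"
  have l: "0 \<le> l" "l \<le> 1" using \<tau>0 \<tau>2 q q0 by (auto simp: l_def divide_le_eq)
  define z where "z u = l * ((1 - w1 u) * indicator B u)" for u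
  have [measurable]: "z \<in> borel_measurable \<mu>" unfolding z_def by measurable
  have z01: "0 \<le> z u" "z u \<le> 1 - w1 u" for u
    using l w1le[of u] mult_left_le_one_le[of "1 - w1 u" l] by (auto simp: z_def split: split_indicator)
  have zB: "z u \<noteq> 0 \<Longrightarrow> u \<in> B" for u by (auto simp: z_def indicator_def split: if_splits)
  have zi: "integrable \<mu> z" unfolding z_def using qi by (rule integrable_mult_right)
  have zI: "(\<integral>u. z u \<partial>\<mu>) = \<tau>" unfolding z_def using q0 by (simp add: q_def[symmetric] l_def)
  define G where "G u = (\<Sum>i\<in>S. v i u * d u (m i)) + z u * d u (m i0)" for u
  have vdi: "integrable \<mu> (\<lambda>u. v i u * d u x)" if "i < k" "x \<in> \<Omega>" for i x
    using vm[OF that(1)] v01 B'(1) B\<Omega>(2) vB that(2) by (rule integrable_weight_d[OF \<mu>])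
  have zdi: "integrable \<mu> (\<lambda>u. z u * d u x)" if "x \<in> \<Omega>" for x
  proof (rule integrable_weight_d[OF \<mu> _ z01(1) _ B(1) B\<Omega>(1) zB that])
    show "z u \<le> 1" for u using z01(2)[of u] w101(1)[of u] by linarith
  qed simp
  have Gi: "integrable \<mu> G" unfolding G_def
    using S mm F_dom i0S by (intro Bochner_Integration.integrable_add Bochner_Integration.integrable_sum vdi zdi) auto
  have GG: "(w1 u + z u) * gd c' u \<le> G u" if "u \<in> F" for u
  proof -
    have "v i u * gd c' u \<le> v i u * d u (m i)" if "i \<in> S" for i
      using gd_le[OF c'mem[OF that] \<open>u \<in> F\<close>] v01 by (intro mult_left_mono)
    then have "w1 u * gd c' u \<le> (\<Sum>i\<in>S. v i u * d u (m i))"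
      unfolding w1_def sum_distrib_right by (intro sum_mono)
    moreover have "z u * gd c' u \<le> z u * d u (m i0)"
      using gd_le[OF c'mem[OF i0S] that] z01 by (intro mult_left_mono)
    ultimately show ?thesis by (simp add: G_def algebra_simps)
  qed
  have gi: "integrable \<mu> (\<lambda>u. (w1 u + z u) * gd c' u)"
  proof (rule Bochner_Integration.integrable_bound[OF Gi])
    show "AE u in \<mu>. norm ((w1 u + z u) * gd c' u) \<le> norm (G u)"
      using \<mu>'(3)
    proof eventually_elim
      case (elim u)
      have "0 \<le> (w1 u + z u) * gd c' u"
        using w101(1)[of u] z01(1)[of u] gd_nonneg[OF c'\<Omega>, of u] by simp
      with GG[OF elim] show ?case by simp
    qed
  qed simp
  obtain t' where t': "trimmed_distortion \<Omega> \<phi> \<mu> h c' = trim_dual \<mu> h (gd c') t'"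
    by (rule trimmed_distortion_eq[OF \<mu> c'\<Omega> h])
  \<comment> \<open>The refilled weight w1 + z is feasible of mass h, so weak duality bounds the
    distortion of c' from above without knowing its own optimal weight.\<close>
  have "trim_dual \<mu> h (gd c') t' \<le> (\<integral>u. (w1 u + z u) * gd c' u \<partial>\<mu>)"
  proof (rule trim_dual_le_weight[OF gd_borel[OF \<mu> c'\<Omega>] gd_nonneg[OF c'\<Omega>] _ _ _ gi])
    show "integrable \<mu> (\<lambda>u. w1 u + z u)" using w1i zi by simp
    show "(\<integral>u. w1 u + z u \<partial>\<mu>) = h" using w1i zi zI by (simp add: \<tau>_def)
    show "0 \<le> w1 u + z u \<and> w1 u + z u \<le> 1" for u
      using w101(1)[of u] z01[of u] by linarith
  qed
  also have "\<dots> \<le> (\<integral>u. G u \<partial>\<mu>)"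
    by (rule integral_mono_AE[OF gi Gi]) (use \<mu>'(3) GG in \<open>auto elim: eventually_mono\<close>)
  also have "\<dots> = (\<integral>u. (\<Sum>i\<in>S. v i u * d u (m i)) \<partial>\<mu>) + (\<integral>u. z u * d u (m i0) \<partial>\<mu>)"
    unfolding G_def using S mm(1) F_dom i0S
    by (intro Bochner_Integration.integral_add Bochner_Integration.integrable_sum vdi zdi) auto
  also have "(\<integral>u. (\<Sum>i\<in>S. v i u * d u (m i)) \<partial>\<mu>) = (\<Sum>i\<in>S. (\<integral>u. v i u * d u (m i) \<partial>\<mu>))"
    using S mm(1) F_dom by (intro Bochner_Integration.integral_sum vdi) auto
  also have "(\<Sum>i\<in>S. (\<integral>u. v i u * d u (m i) \<partial>\<mu>)) + (\<integral>u. z u * d u (m i0) \<partial>\<mu>)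
      \<le> ((\<integral>u. w u * gd c u \<partial>\<mu>) - \<alpha> * (\<Sum>i\<in>S. d (c'!i) (c!i))) + \<tau> * M1"
  proof (rule add_mono)
    have "(\<Sum>i\<in>S. (\<integral>u. v i u * d u (m i) \<partial>\<mu>)) = (\<Sum>i\<in>S. (\<integral>u. v i u * d u (c!i) \<partial>\<mu>)) - (\<Sum>i\<in>S. a i * d (m i) (c!i))"
      unfolding sum_subtractf[symmetric] by (intro sum.cong refl mm)
    moreover have "\<alpha> * (\<Sum>i\<in>S. d (c'!i) (c!i)) \<le> (\<Sum>i\<in>S. a i * d (m i) (c!i))"
      unfolding sum_distrib_left
    proof (rule sum_mono)
      fix i assume i: "i \<in> S"
      then have "0 \<le> d (m i) (c!i)" using mm F_dom c\<Omega> S by (intro d_nonneg) auto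
      then show "\<alpha> * d (c'!i) (c!i) \<le> a i * d (m i) (c!i)"
        using i by (auto simp: c'i S_def intro!: mult_right_mono)
    qed
    moreover have "(\<Sum>i\<in>S. (\<integral>u. v i u * d u (c!i) \<partial>\<mu>)) = (\<integral>u. (\<Sum>i\<in>S. v i u * d u (c!i)) \<partial>\<mu>)"
      using S c\<Omega> by (intro Bochner_Integration.integral_sum[symmetric] vdi) auto
    moreover have "(\<integral>u. (\<Sum>i\<in>S. v i u * d u (c!i)) \<partial>\<mu>) \<le> (\<integral>u. w u * gd c u \<partial>\<mu>)"
    proof (rule integral_mono[OF _ w(7)])
      show "integrable \<mu> (\<lambda>u. \<Sum>i\<in>S. v i u * d u (c!i))"
        using S c\<Omega> by (intro Bochner_Integration.integrable_sum vdi) auto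
      fix u
      have "v i u * d u (c!i) = v i u * gd c u" if "i \<in> S" for i
        using gd_cell[of u c i] that S c(2) by (cases "u \<in> cell c i") (auto simp: v_def)
      then have "(\<Sum>i\<in>S. v i u * d u (c!i)) = (\<Sum>i\<in>S. v i u) * gd c u"
        unfolding sum_distrib_right by (intro sum.cong refl)
      also have "\<dots> \<le> w u * gd c u" using v_part[OF S(1)] gd_nonneg[OF c(1) c0] by (intro mult_right_mono)
      finally show "(\<Sum>i\<in>S. v i u * d u (c!i)) \<le> w u * gd c u" .
    qed
    ultimately show "(\<Sum>i\<in>S. (\<integral>u. v i u * d u (m i) \<partial>\<mu>)) \<le> (\<integral>u. w u * gd c u \<partial>\<mu>) - \<alpha> * (\<Sum>i\<in>S. d (c'!i) (c!i))"
      by linarith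
    have "norm (m i0) \<le> E / (h / (2 * k))"
    proof -
      have "E / a i0 \<le> E / (h / (2 * k))" using i0 h c(3) E0 a_pos[OF i0S] by (intro divide_left_mono) auto
      with mm(3)[OF i0S] show ?thesis by linarith
    qed
    then have "z u * d u (m i0) \<le> z u * M1" for u
      using M1(2)[of u "m i0"] zB[of u] mm(1)[OF i0S] z01(1)[of u] by (cases "z u = 0") (auto intro!: mult_left_mono)
    then have "(\<integral>u. z u * d u (m i0) \<partial>\<mu>) \<le> (\<integral>u. z u * M1 \<partial>\<mu>)"
      using zdi mm(1)[OF i0S] F_dom zi by (intro integral_mono) auto
    then show "(\<integral>u. z u * d u (m i0) \<partial>\<mu>) \<le> \<tau> * M1" by (simp add: zI)
  qed
  also have "\<tau> * M1 \<le> (\<epsilon> + (if S = {..<k} then 0 else k * \<alpha>)) * M1"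
    using \<tau>1 M1(1) by (rule mult_right_mono)
  finally have fin: "trimmed_distortion \<Omega> \<phi> \<mu> h c' + \<alpha> * (\<Sum>i\<in>S. d (c'!i) (c!i))
      \<le> trimmed_distortion \<Omega> \<phi> \<mu> h c + (\<epsilon> + (if S = {..<k} then 0 else k * \<alpha>)) * M1"
    using t' Rt w(8) by simp
  show thesis
    by (rule that[OF S(1) c'l i0S _ c'F fin]) (simp add: c'n c'i[OF i0S])
qed

end

section \<open>Chaining\<close>

definition emp_dev :: "nat \<Rightarrow> (nat \<Rightarrow> 'a) \<Rightarrow> 'a measure \<Rightarrow> ('a \<Rightarrow> real) \<Rightarrow> real" where
  "emp_dev n x P f = (\<Sum>i<n. f (x i)) / real n - (\<integral>u. f u \<partial>P)"

lemma iid_sampleD: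
  assumes "prob_space M" "iid_sample M P n X" "i < n"
  shows "X i \<in> borel_measurable M" "distr M borel (X i) = P" "space P = UNIV" "sets P = sets borel" "prob_space P"
proof -
  interpret prob_space M by fact
  show X: "X i \<in> borel_measurable M" "distr M borel (X i) = P"
    using assms(2,3) by (auto simp: iid_sample_def indep_vars_def)
  show "space P = UNIV" "sets P = sets borel" using X(2) by (metis space_distr space_borel, metis sets_distr)
  show "prob_space P" using prob_space_distr[OF X(1)] X(2) by simp
qed

text \<open>For values in [- b, b] the exponent at deviation e is - 2 n e^2 / (2 b)^2, which equals
  - y for e = b sqrt (2 y / n).\<close>

lemma iid_hoeffding:
  fixes f :: "'a::topological_space \<Rightarrow> real"
  assumes M: "prob_space M" and iid: "iid_sample M P n X" and n: "0 < n"
    and f [measurable]: "f \<in> borel_measurable borel" and b: "\<And>u. \<bar>f u\<bar> \<le> b" "0 < b" and y: "0 \<le> y"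
  shows "{\<omega> \<in> space M. b * sqrt (2 * y / n) \<le> \<bar>emp_dev n (\<lambda>i. X i \<omega>) P f\<bar>} \<in> sets M"
    "measure M {\<omega> \<in> space M. b * sqrt (2 * y / n) \<le> \<bar>emp_dev n (\<lambda>i. X i \<omega>) P f\<bar>} \<le> 2 * exp (- y)"
proof -
  interpret prob_space M by fact
  note X = iid_sampleD[OF M iid]
  have [measurable]: "X i \<in> borel_measurable M" if "i \<in> {..<n}" for i using X(1) that by simp
  have dist: "distr M borel (\<lambda>\<omega>. f (X i \<omega>)) = distr P borel f" if "i < n" for i
    using distr_distr[OF f X(1)[OF that]] X(2)[OF that] by (simp add: comp_def)
  have ex: "expectation (\<lambda>\<omega>. f (X 0 \<omega>)) = (\<integral>u. f u \<partial>P)"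
    using integral_distr[OF X(1)[OF n] f] X(2)[OF n] by simp
  interpret H: Hoeffding_ineq_iid M "{..<n}" "\<lambda>i \<omega>. f (X i \<omega>)" "\<lambda>\<omega>. f (X 0 \<omega>)" "- b" b "expectation (\<lambda>\<omega>. f (X 0 \<omega>))"
  proof unfold_locales
    show "indep_vars (\<lambda>_. borel) (\<lambda>i \<omega>. f (X i \<omega>)) {..<n}"
      by (rule indep_vars_compose2[where Y = "\<lambda>_. f"]) (use iid in \<open>auto simp: iid_sample_def\<close>)
    show "distr M borel (\<lambda>\<omega>. f (X i \<omega>)) = distr M borel (\<lambda>\<omega>. f (X 0 \<omega>))" if "i \<in> {..<n}" for i
      using dist[of i] dist[of 0] that n by simp
    show "(\<lambda>\<omega>. f (X 0 \<omega>)) \<in> borel_measurable M" using X(1)[OF n] by measurable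
    show "AE x in M. f (X 0 x) \<in> {- b..b}" using b by (auto simp: abs_le_iff minus_le_iff)
  qed auto
  let ?A = "{\<omega> \<in> space M. b * sqrt (2 * y / n) \<le> \<bar>(\<Sum>i<n. f (X i \<omega>)) / real n - expectation (\<lambda>\<omega>. f (X 0 \<omega>))\<bar>}"
  show "{\<omega> \<in> space M. b * sqrt (2 * y / n) \<le> \<bar>emp_dev n (\<lambda>i. X i \<omega>) P f\<bar>} \<in> sets M"
    unfolding emp_dev_def by measurable
  define e where "e = b * sqrt (2 * y / n)"
  have e: "0 \<le> e" "- b < b" "{..<n} \<noteq> {}" using b y n by (auto simp: e_def)
  have "prob ?A \<le> 2 * exp (- 2 * real n * e\<^sup>2 / (b - (- b))\<^sup>2)"
    using H.Hoeffding_ineq_abs_ge'[OF e] unfolding e_def[symmetric] by simp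
  also have "- 2 * real n * e\<^sup>2 / (b - (- b))\<^sup>2 = - y"
    using n b(2) y by (simp add: e_def power_mult_distrib field_simps)
  finally show "measure M {\<omega> \<in> space M. b * sqrt (2 * y / n) \<le> \<bar>emp_dev n (\<lambda>i. X i \<omega>) P f\<bar>} \<le> 2 * exp (- y)"
    by (simp add: emp_dev_def ex)
qed

text \<open>A union bound over all levels. The extra (j + 1) ln (2 A) in the exponent at level j
  pays for its A^(j+1) functions and leaves a factor 2^-(j+1), so the total is 2 exp (- x).\<close>

lemma iid_hoeffding_family:
  fixes H :: "nat \<Rightarrow> ('a::topological_space \<Rightarrow> real) set" and b :: "nat \<Rightarrow> real" and A :: nat
  assumes M: "prob_space M" and iid: "iid_sample M P n X" and n: "0 < n"
    and H: "\<And>j f. f \<in> H j \<Longrightarrow> f \<in> borel_measurable borel" "\<And>j f u. f \<in> H j \<Longrightarrow> \<bar>f u\<bar> \<le> b j"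
    and card: "\<And>j. finite (H j)" "\<And>j. card (H j) \<le> A ^ (j + 1)" "0 < A"
    and b: "\<And>j. 0 < b j" and x: "0 < x"
  obtains E where "E \<in> sets M" "measure M E \<le> 2 * exp (- x)"
    "\<And>\<omega> j f. \<omega> \<in> space M - E \<Longrightarrow> f \<in> H j \<Longrightarrow>
      \<bar>emp_dev n (\<lambda>i. X i \<omega>) P f\<bar> \<le> b j * sqrt (2 * (x + real (j + 1) * ln (2 * A)) / n)"
proof -
  interpret prob_space M by fact
  define y where "y j = x + real (j + 1) * ln (2 * A)" for j
  have y: "0 \<le> y j" for j using x card(3) by (simp add: y_def)
  define D where "D j f = {\<omega> \<in> space M. b j * sqrt (2 * y j / n) \<le> \<bar>emp_dev n (\<lambda>i. X i \<omega>) P f\<bar>}" for j f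
  have D: "D j f \<in> events" "prob (D j f) \<le> 2 * exp (- y j)" if "f \<in> H j" for j f
    unfolding D_def using iid_hoeffding[OF M iid n H(1)[OF that] H(2)[OF that] b y] by auto
  define U where "U j = (\<Union>f\<in>H j. D j f)" for j
  have U: "U j \<in> events" for j unfolding U_def using D card by auto
  have "prob (U j) \<le> 2 * exp (- x) * (1/2) ^ Suc j" for j
  proof -
    have "prob (U j) \<le> (\<Sum>f\<in>H j. prob (D j f))"
      unfolding U_def using D card by (intro finite_measure_subadditive_finite) auto
    also have "\<dots> \<le> (\<Sum>f\<in>H j. 2 * exp (- y j))" using D by (intro sum_mono) auto
    also have "\<dots> = real (card (H j)) * (2 * exp (- y j))" by simp
    also have "\<dots> \<le> real (A ^ (j + 1)) * (2 * exp (- y j))"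
      using card(2)[of j] by (intro mult_right_mono) (auto simp del: of_nat_power power_Suc)
    also have "exp (- y j) = exp (- x) * (1 / (2 * real A)) ^ (j + 1)"
    proof -
      have "- y j = - x + real (j + 1) * ln (1 / (2 * real A))"
        using card(3) by (simp add: y_def ln_div)
      then have "exp (- y j) = exp (- x) * exp (real (j + 1) * ln (1 / (2 * real A)))"
        by (simp only: exp_add)
      also have "exp (real (j + 1) * ln (1 / (2 * real A))) = (1 / (2 * real A)) ^ (j + 1)"
        using card(3) by (subst exp_of_nat_mult) simp
      finally show ?thesis .
    qed
    also have "real (A ^ (j + 1)) * (2 * (exp (- x) * (1 / (2 * real A)) ^ (j + 1)))
       = 2 * exp (- x) * (real A * (1 / (2 * real A))) ^ (j + 1)"
      by (simp only: power_mult_distrib of_nat_power mult_ac)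
    also have "real A * (1 / (2 * real A)) = 1 / 2" using card(3) by simp
    finally show ?thesis by simp
  qed
  note Uj = this
  have sm: "(\<lambda>j. 2 * exp (- x) * (1/2) ^ Suc j) sums (2 * exp (- x) * 1)"
    using power_half_series by (rule sums_mult)
  have sU: "summable (\<lambda>j. prob (U j))"
    by (rule summable_comparison_test[OF _ sums_summable[OF sm]]) (use Uj in auto)
  have "prob (\<Union>j. U j) \<le> (\<Sum>j. prob (U j))"
    using U sU by (intro finite_measure_subadditive_countably) auto
  also have "\<dots> \<le> (\<Sum>j. 2 * exp (- x) * (1/2) ^ Suc j)"
    by (rule suminf_le[OF Uj sU sums_summable[OF sm]])
  also have "\<dots> = 2 * exp (- x)" by (subst sums_unique[OF sm, symmetric]) simp
  finally have 1: "prob (\<Union>j. U j) \<le> 2 * exp (- x)" .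
  have 2: "(\<Union>j. U j) \<in> events" using U by auto
  show thesis
  proof (rule that[OF 2 1])
    fix \<omega> j f assume "\<omega> \<in> space M - (\<Union>j. U j)" "f \<in> H j"
    then have "\<omega> \<in> space M" "\<omega> \<notin> D j f" by (auto simp: U_def)
    then show "\<bar>emp_dev n (\<lambda>i. X i \<omega>) P f\<bar> \<le> b j * sqrt (2 * (x + real (j + 1) * ln (2 * A)) / n)"
      by (simp add: D_def y_def)
  qed
qed

lemma emp_dev_diff:
  assumes "integrable P f" "integrable P g"
  shows "emp_dev n x P (\<lambda>u. f u - g u) = emp_dev n x P f - emp_dev n x P g"
  using assms by (simp add: emp_dev_def sum_subtractf diff_divide_distrib)

lemma abs_emp_dev_le:
  assumes "prob_space P" "integrable P f" "\<And>u. \<bar>f u\<bar> \<le> b" "0 < n"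
  shows "\<bar>emp_dev n x P f\<bar> \<le> 2 * b"
proof -
  interpret prob_space P by fact
  have "\<bar>\<Sum>i<n. f (x i)\<bar> \<le> (\<Sum>i<n. b)" by (intro order_trans[OF sum_abs] sum_mono assms)
  then have 1: "\<bar>(\<Sum>i<n. f (x i)) / n\<bar> \<le> b" using assms(4) by (simp add: abs_divide divide_le_eq mult.commute)
  have "\<bar>\<integral>u. f u \<partial>P\<bar> \<le> (\<integral>u. \<bar>f u\<bar> \<partial>P)" using integral_norm_bound[of P f] by simp
  also have "\<dots> \<le> (\<integral>u. b \<partial>P)" using assms by (intro integral_mono) auto
  also have "\<dots> = b" using prob_space by simp
  finally show ?thesis using 1 unfolding emp_dev_def by linarith
qed

text \<open>Nets are encoded by keys: parameters with equal \<open>key j\<close> are interchangeable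
  up to \<open>L / 2 ^ j\<close>. The number of keys grows at most geometrically, so level j
  contributes a deviation of order (j + 1) / 2^j and the series converges without a logarithm of n.
  The exceptional event arises from countably many functions, which avoids any measurability
  question for the supremum over \<Theta>.\<close>

lemma chaining:
  fixes f :: "'t \<Rightarrow> 'a::topological_space \<Rightarrow> real" and key :: "nat \<Rightarrow> 't \<Rightarrow> 'k" and A :: nat
  assumes f: "\<And>\<theta>. \<theta> \<in> \<Theta> \<Longrightarrow> f \<theta> \<in> borel_measurable borel" "\<And>\<theta> u. \<theta> \<in> \<Theta> \<Longrightarrow> \<bar>f \<theta> u\<bar> \<le> L" "0 < L"
    and key: "\<And>j. finite (key j ` \<Theta>)" "\<And>j. card (key j ` \<Theta>) \<le> A ^ (j + 1)" "0 < A"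
    and near: "\<And>j \<theta> \<theta>' u. \<theta> \<in> \<Theta> \<Longrightarrow> \<theta>' \<in> \<Theta> \<Longrightarrow> key j \<theta> = key j \<theta>' \<Longrightarrow> \<bar>f \<theta> u - f \<theta>' u\<bar> \<le> L / 2 ^ j"
  shows "\<exists>C>0. \<forall>n>0. \<forall>x>0. \<forall>(M::'w measure) P X. prob_space M \<longrightarrow> iid_sample M P n X \<longrightarrow>
    (\<exists>E\<in>sets M. measure M E \<le> 2 * exp (- x) \<and>
      (\<forall>\<omega>\<in>space M - E. \<forall>\<theta>\<in>\<Theta>. \<bar>emp_dev n (\<lambda>i. X i \<omega>) P (f \<theta>)\<bar> \<le> C * (1 + sqrt x) / sqrt n))"
proof -
  define \<pi> where "\<pi> j \<theta> = (SOME \<theta>'. \<theta>' \<in> \<Theta> \<and> key j \<theta>' = key j \<theta>)" for j \<theta>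
  have \<pi>: "\<pi> j \<theta> \<in> \<Theta>" "key j (\<pi> j \<theta>) = key j \<theta>" if "\<theta> \<in> \<Theta>" for j \<theta>
    using someI[of "\<lambda>\<theta>'. \<theta>' \<in> \<Theta> \<and> key j \<theta>' = key j \<theta>" \<theta>] that by (auto simp: \<pi>_def)
  define rep where "rep j \<kappa> = (SOME \<theta>'. \<theta>' \<in> \<Theta> \<and> key j \<theta>' = \<kappa>)" for j \<kappa>
  have \<pi>rep: "\<pi> j \<theta> = rep j (key j \<theta>)" for j \<theta> by (simp add: \<pi>_def rep_def)
  \<comment> \<open>The links of the chain; summed up to level m they telescope to
    \<open>f (\<pi> m \<theta>)\<close>.\<close>
  define hh where "hh j \<theta> = (case j of 0 \<Rightarrow> f (\<pi> 0 \<theta>) | Suc i \<Rightarrow> (\<lambda>u. f (\<pi> (Suc i) \<theta>) u - f (\<pi> i \<theta>) u))" for j \<theta>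
  define H where "H j = hh j ` \<Theta>" for j
  \<comment> \<open>A link at level j > 0 is at most \<open>L / 2 ^ j + L / 2 ^ (j - 1)\<close>; at
    level 0 the bound L on the functions suffices.\<close>
  define b where "b j = 3 * L / 2 ^ j" for j :: nat
  have b: "0 < b j" for j using f(3) by (simp add: b_def)
  have Hm: "g \<in> borel_measurable borel" if "g \<in> H j" for g j
    using that f(1) \<pi> by (cases j) (auto simp: H_def hh_def intro!: borel_measurable_diff)
  have near\<pi>: "\<bar>f \<theta> u - f (\<pi> j \<theta>) u\<bar> \<le> L / 2 ^ j" if "\<theta> \<in> \<Theta>" for \<theta> u j
    using near[OF that \<pi>(1)[OF that]] \<pi>(2)[OF that] by simp
  have Hb: "\<bar>g u\<bar> \<le> b j" if g: "g \<in> H j" for g j u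
  proof -
    obtain \<theta> where \<theta>: "\<theta> \<in> \<Theta>" "g = hh j \<theta>" using g by (auto simp: H_def)
    show ?thesis
    proof (cases j)
      case 0
      then show ?thesis using f(2)[OF \<pi>(1)[OF \<theta>(1)], of 0 u] f(3) \<theta>(2) by (simp add: hh_def b_def)
    next
      case (Suc i)
      have "\<bar>f (\<pi> (Suc i) \<theta>) u - f (\<pi> i \<theta>) u\<bar> \<le> L / 2 ^ Suc i + L / 2 ^ i"
        using near\<pi>[OF \<theta>(1), of u i] near\<pi>[OF \<theta>(1), of u "Suc i"] by linarith
      also have "\<dots> = b j" by (simp add: b_def Suc field_simps)
      finally show ?thesis using \<theta>(2) by (simp add: hh_def Suc)
    qed
  qed
  \<comment> \<open>A link depends on two consecutive keys, hence on at most A^(j+1) A^j choices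
    when j > 0; the cube leaves room for this.\<close>
  have Hc: "finite (H j) \<and> card (H j) \<le> (A ^ 3) ^ (j + 1)" for j
  proof (cases j)
    case 0
    have sub: "H j = (\<lambda>\<kappa>. f (rep 0 \<kappa>)) ` (key 0 ` \<Theta>)" by (auto simp: H_def hh_def 0 \<pi>rep)
    have "card (H j) \<le> card (key 0 ` \<Theta>)" unfolding sub by (rule card_image_le) (rule key)
    also have "\<dots> \<le> A ^ 1" using key(2)[of 0] by simp
    also have "\<dots> \<le> (A ^ 3) ^ (j + 1)" using key(3) by (simp add: 0 power_increasing[of 1 3 A, simplified])
    finally show ?thesis using key(1)[of 0] by (simp add: sub)
  next
    case (Suc i)
    let ?g = "\<lambda>(\<kappa>, \<kappa>'). (\<lambda>u. f (rep (Suc i) \<kappa>) u - f (rep i \<kappa>') u)"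
    have sub: "H j \<subseteq> ?g ` (key (Suc i) ` \<Theta> \<times> key i ` \<Theta>)"
      by (auto simp: H_def hh_def Suc \<pi>rep)
    have fin: "finite (key (Suc i) ` \<Theta> \<times> key i ` \<Theta>)" using key(1) by blast
    have "card (H j) \<le> card (?g ` (key (Suc i) ` \<Theta> \<times> key i ` \<Theta>))"
      using fin sub by (intro card_mono) auto
    also have "\<dots> \<le> card (key (Suc i) ` \<Theta> \<times> key i ` \<Theta>)" by (rule card_image_le[OF fin])
    also have "\<dots> = card (key (Suc i) ` \<Theta>) * card (key i ` \<Theta>)" by (rule card_cartesian_product)
    also have "\<dots> \<le> A ^ (Suc i + 1) * A ^ (i + 1)" by (intro mult_mono key) auto
    also have "\<dots> = A ^ ((Suc i + 1) + (i + 1))" by (rule power_add[symmetric])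
    also have "\<dots> \<le> A ^ (3 * (j + 1))" using key(3) Suc by (intro power_increasing) auto
    also have "\<dots> = (A ^ 3) ^ (j + 1)" by (rule power_mult)
    finally show ?thesis using finite_subset[OF sub] fin by blast
  qed
  define l where "l = ln (real (2 * A ^ 3))"
  have l0: "0 \<le> l"
  proof -
    have "1 \<le> 2 * A ^ 3" using key(3) by (simp add: Suc_leI)
    from of_nat_mono[OF this, where 'a = real] have "1 \<le> real (2 * A ^ 3)" by (simp only: of_nat_1)
    then show ?thesis unfolding l_def by (rule ln_ge_zero)
  qed
  define K where "K = 3 * L * (sqrt 2 * (2 + l))"
  define C where "C = 4 * K"
  have K0: "0 < K" using f(3) l0 by (simp add: K_def)
  \<comment> \<open>Crude separation of x from j: the square root is bounded by (1 + sqrt x) times a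
    factor linear in j, which the geometric decay of \<open>b j\<close> absorbs.\<close>
  have level: "b j * sqrt (2 * (x + real (j + 1) * l) / n) \<le> K * (real (Suc j) * (1/2) ^ j) * ((1 + sqrt x) / sqrt n)"
    if "0 < x" "0 < n" for j n :: nat and x :: real
  proof -
    have "sqrt (x + real (j + 1) * l) \<le> sqrt x + sqrt (real (j + 1) * l)"
      using l0 that by (intro sqrt_add_le_add_sqrt) auto
    also have "sqrt (real (j + 1) * l) \<le> real (j + 1) * (1 + l)"
    proof (rule real_le_lsqrt)
      have "real (j + 1) * l \<le> (real (j + 1) * (1 + l)) * 1" using l0 by (simp add: algebra_simps)
      also have "\<dots> \<le> (real (j + 1) * (1 + l)) * (real (j + 1) * (1 + l))"
      proof (rule mult_left_mono)
        have "1 * 1 \<le> real (j + 1) * (1 + l)" using l0 by (intro mult_mono) auto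
        then show "1 \<le> real (j + 1) * (1 + l)" by simp
      qed (use l0 in auto)
      finally show "real (j + 1) * l \<le> (real (j + 1) * (1 + l))\<^sup>2" by (simp add: power2_eq_square)
    qed (use l0 in auto)
    also have "sqrt x + real (j + 1) * (1 + l) \<le> (1 + sqrt x) * (real (j + 1) * (2 + l))"
    proof -
      have 1: "1 \<le> real (j + 1)" by simp
      have "(1 + sqrt x) * (real (j + 1) * (2 + l)) = real (j + 1) * (1 + l) + real (j + 1) + sqrt x * (real (j + 1) * (2 + l))"
        by (simp add: algebra_simps)
      moreover have "1 * 1 \<le> real (j + 1) * (2 + l)" using l0 by (intro mult_mono) auto
      then have "sqrt x * 1 \<le> sqrt x * (real (j + 1) * (2 + l))" using that by (intro mult_left_mono) auto
      ultimately show ?thesis using 1 by linarith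
    qed
    finally have s: "sqrt (x + real (j + 1) * l) \<le> (1 + sqrt x) * (real (j + 1) * (2 + l))" by simp
    have "b j * sqrt (2 * (x + real (j + 1) * l) / n) = b j * sqrt 2 / sqrt n * sqrt (x + real (j + 1) * l)"
      by (simp only: real_sqrt_mult real_sqrt_divide) simp
    also have "\<dots> \<le> b j * sqrt 2 / sqrt n * ((1 + sqrt x) * (real (j + 1) * (2 + l)))"
      using b[of j] by (intro mult_left_mono s) (auto intro!: divide_nonneg_nonneg simp: less_imp_le)
    also have "\<dots> = K * (real (Suc j) * (1/2) ^ j) * ((1 + sqrt x) / sqrt n)"
      by (simp add: b_def K_def power_one_over field_simps)
    finally show ?thesis .
  qed
  \<comment> \<open>The value of this series is the factor 4 in C.\<close>
  have gs: "(\<lambda>j. real (Suc j) * (1/2) ^ j) sums 4"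
    using geometric_deriv_sums[of "1/2 :: real"] by (simp add: power2_eq_square)
  show ?thesis
  proof (intro exI[of _ C] conjI allI impI)
    show "0 < C" using K0 by (simp add: C_def)
    fix n :: nat and x :: real and M :: "'w measure" and P :: "'a measure" and X
    assume n: "0 < n" and x: "0 < x" and M: "prob_space M" and iid: "iid_sample M P n X"
    note P = iid_sampleD[OF M iid n]
    interpret P: prob_space P by (rule P)
    have meas: "g \<in> borel_measurable P" if "g \<in> borel_measurable borel" for g :: "'a \<Rightarrow> real"
      using that by (simp add: measurable_cong_sets[OF P(4) refl])
    have fi: "integrable P (f \<theta>)" if "\<theta> \<in> \<Theta>" for \<theta>
      by (rule P.integrable_const_bound[of _ L]) (use f(2)[OF that] meas[OF f(1)[OF that]] in auto)
    have A3: "0 < A ^ 3" using key(3) by simp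
    obtain E where E: "E \<in> sets M" "measure M E \<le> 2 * exp (- x)"
      "\<And>\<omega> j g. \<omega> \<in> space M - E \<Longrightarrow> g \<in> H j \<Longrightarrow>
        \<bar>emp_dev n (\<lambda>i. X i \<omega>) P g\<bar> \<le> b j * sqrt (2 * (x + real (j + 1) * ln (real (2 * A ^ 3))) / n)"
      by (rule iid_hoeffding_family[where H = H and b = b and A = "A ^ 3", OF M iid n _ _ _ _ A3 b x])
        (erule Hm, erule Hb, rule conjunct1[OF Hc], rule conjunct2[OF Hc], rule that)
    have "\<bar>emp_dev n (\<lambda>i. X i \<omega>) P (f \<theta>)\<bar> \<le> C * (1 + sqrt x) / sqrt n" if \<omega>: "\<omega> \<in> space M - E" and \<theta>: "\<theta> \<in> \<Theta>" for \<omega> \<theta>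
    proof -
      let ?D = "emp_dev n (\<lambda>i. X i \<omega>) P"
      have hb: "\<bar>?D (hh j \<theta>)\<bar> \<le> K * (real (Suc j) * (1/2) ^ j) * ((1 + sqrt x) / sqrt n)" for j
        using E(3)[OF \<omega>, of "hh j \<theta>" j] level[OF x n, of j] \<theta> unfolding l_def[symmetric] H_def
        by (meson imageI order_trans)
      have tele: "?D (f (\<pi> m \<theta>)) = (\<Sum>j\<le>m. ?D (hh j \<theta>))" for m
      proof (induction m)
        case (Suc m)
        have "?D (hh (Suc m) \<theta>) = ?D (f (\<pi> (Suc m) \<theta>)) - ?D (f (\<pi> m \<theta>))"
          using emp_dev_diff[OF fi fi] \<pi>(1)[OF \<theta>] by (simp add: hh_def)
        with Suc show ?case by simp
      qed (simp add: hh_def)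
      \<comment> \<open>The remainder after m links is uniformly small in u, so the trivial bound
        \<open>abs_emp_dev_le\<close> suffices for it. All levels are controlled on the same event,
        hence m may tend to infinity there.\<close>
      have bound: "\<bar>?D (f \<theta>)\<bar> \<le> C * (1 + sqrt x) / sqrt n + 2 * L * (1/2) ^ m" for m
      proof -
        have "?D (\<lambda>u. f \<theta> u - f (\<pi> m \<theta>) u) = ?D (f \<theta>) - ?D (f (\<pi> m \<theta>))"
          by (rule emp_dev_diff[OF fi[OF \<theta>] fi[OF \<pi>(1)[OF \<theta>]]])
        moreover have "\<bar>?D (\<lambda>u. f \<theta> u - f (\<pi> m \<theta>) u)\<bar> \<le> 2 * (L / 2 ^ m)"
          using P n near\<pi>[OF \<theta>] fi[OF \<theta>] fi[OF \<pi>(1)[OF \<theta>]] by (intro abs_emp_dev_le) auto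
        moreover have "\<bar>?D (f (\<pi> m \<theta>))\<bar> \<le> (\<Sum>j\<le>m. K * (real (Suc j) * (1/2) ^ j) * ((1 + sqrt x) / sqrt n))"
          unfolding tele by (intro order_trans[OF sum_abs] sum_mono hb)
        moreover have "(\<Sum>j\<le>m. K * (real (Suc j) * (1/2) ^ j) * ((1 + sqrt x) / sqrt n))
            = (\<Sum>j\<le>m. real (Suc j) * (1/2) ^ j) * (K * ((1 + sqrt x) / sqrt n))"
          unfolding sum_distrib_right by (intro sum.cong refl) (simp only: mult_ac)
        moreover have "(\<Sum>j\<le>m. real (Suc j) * (1/2) ^ j) \<le> 4"
          using sum_le_suminf[OF sums_summable[OF gs], of "{..m}"] sums_unique[OF gs] by simp
        then have "(\<Sum>j\<le>m. real (Suc j) * (1/2) ^ j) * (K * ((1 + sqrt x) / sqrt n)) \<le> 4 * (K * ((1 + sqrt x) / sqrt n))"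
          using K0 x by (intro mult_right_mono) auto
        moreover have "4 * (K * ((1 + sqrt x) / sqrt n)) = C * (1 + sqrt x) / sqrt n" by (simp add: C_def)
        moreover have "2 * (L / 2 ^ m) = 2 * L * (1/2) ^ m" by (simp add: power_one_over field_simps)
        ultimately show ?thesis by linarith
      qed
      have "(\<lambda>m. C * (1 + sqrt x) / sqrt n + 2 * L * (1/2) ^ m) \<longlonglongrightarrow> C * (1 + sqrt x) / sqrt n + 2 * L * 0"
        by (intro tendsto_intros LIMSEQ_power_zero) simp
      then have "\<bar>?D (f \<theta>)\<bar> \<le> C * (1 + sqrt x) / sqrt n + 2 * L * 0"
        by (rule LIMSEQ_le_const) (use bound in auto)
      then show ?thesis by simp
    qed
    with E(1,2) show "\<exists>E\<in>sets M. measure M E \<le> 2 * exp (- x) \<and>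
      (\<forall>\<omega>\<in>space M - E. \<forall>\<theta>\<in>\<Theta>. \<bar>emp_dev n (\<lambda>i. X i \<omega>) P (f \<theta>)\<bar> \<le> C * (1 + sqrt x) / sqrt n)" by blast
  qed
qed

section \<open>Uniform deviations over compact sets of codebooks\<close>

text \<open>Rounding to the dyadic grid of mesh 2^-j. The restriction to \<open>Basis\<close> puts
  the keys of a bounded set into a finite space of extensional functions.\<close>

definition grid_key :: "nat \<Rightarrow> 'a::euclidean_space \<Rightarrow> 'a \<Rightarrow> int" where
  "grid_key j x = (\<lambda>b\<in>Basis. \<lfloor>2 ^ j * (x \<bullet> b)\<rfloor>)"

lemma floor_eq_imp_close:
  assumes "\<lfloor>2 ^ j * s\<rfloor> = \<lfloor>2 ^ j * (t::real)\<rfloor>"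
  shows "\<bar>s - t\<bar> \<le> 1 / 2 ^ j"
proof -
  have "\<bar>2 ^ j * s - 2 ^ j * t\<bar> \<le> 1" using assms by linarith
  also have "\<bar>2 ^ j * s - 2 ^ j * t\<bar> = 2 ^ j * \<bar>s - t\<bar>"
    by (simp add: abs_mult right_diff_distrib[symmetric])
  finally show ?thesis by (simp add: field_simps)
qed

lemma grid_key_close:
  fixes x y :: "'a::euclidean_space"
  assumes "grid_key j x = grid_key j y"
  shows "norm (x - y) \<le> DIM('a) / 2 ^ j"
proof -
  have "\<bar>(x - y) \<bullet> b\<bar> \<le> 1 / 2 ^ j" if "b \<in> Basis" for b
  proof -
    have "\<lfloor>2 ^ j * (x \<bullet> b)\<rfloor> = \<lfloor>2 ^ j * (y \<bullet> b)\<rfloor>"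
      using fun_cong[OF assms, of b] that by (simp add: grid_key_def)
    from floor_eq_imp_close[OF this] show ?thesis by (simp add: inner_diff_left)
  qed
  then have "(\<Sum>b\<in>Basis. \<bar>(x - y) \<bullet> b\<bar>) \<le> (\<Sum>b\<in>(Basis::'a set). 1 / 2 ^ j)" by (intro sum_mono)
  with norm_le_l1[of "x - y"] show ?thesis by simp
qed

lemma floor_range:
  assumes "\<bar>s\<bar> \<le> real R"
  shows "\<lfloor>2 ^ j * s\<rfloor> \<in> {- int (2 ^ j * R)..int (2 ^ j * R)}"
proof -
  have "\<bar>2 ^ j * s\<bar> \<le> 2 ^ j * real R" using assms by (simp add: abs_mult)
  then have "- (2 ^ j * real R) \<le> 2 ^ j * s" "2 ^ j * s \<le> 2 ^ j * real R" by linarith+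
  then have "real_of_int (- int (2 ^ j * R)) \<le> 2 ^ j * s" "2 ^ j * s \<le> real_of_int (int (2 ^ j * R))" by simp_all
  then have "- int (2 ^ j * R) \<le> \<lfloor>2 ^ j * s\<rfloor>" "\<lfloor>2 ^ j * s\<rfloor> \<le> int (2 ^ j * R)"
    using floor_mono[of "2 ^ j * s" "real_of_int (int (2 ^ j * R))"] by (simp_all only: le_floor_iff floor_of_int)
  then show ?thesis by (simp only: atLeastAtMost_iff)
qed

text \<open>The count 2 (2^j R) + 1 is weakened to the form A^(j+1) that \<open>chaining\<close>
  asks for.\<close>

lemma card_floor_range: "1 \<le> R \<Longrightarrow> card {- int (2 ^ j * R)..int (2 ^ j * R)} \<le> (6 * R) ^ (j + 1)"
proof -
  assume R: "1 \<le> R"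
  have "card {- int (2 ^ j * R)..int (2 ^ j * R)} = 2 * (2 ^ j * R) + 1" by (simp add: nat_add_distrib nat_mult_distrib)
  also have "\<dots> \<le> 3 * (2 ^ j * R)" using R by simp
  also have "\<dots> \<le> 6 * (6 ^ j * R ^ (j + 1))"
  proof -
    have "(2::nat) ^ j \<le> 6 ^ j" by (intro power_mono) auto
    moreover have "R ^ 1 \<le> R ^ (j + 1)" using R by (intro power_increasing) auto
    ultimately have "2 ^ j * R \<le> 6 ^ j * R ^ (j + 1)" by (intro mult_le_mono) auto
    from mult_le_mono[OF _ this, of 3 6] show ?thesis by (simp only: numeral_le_iff semiring_norm)
  qed
  also have "\<dots> = (6 * R) ^ (j + 1)" by (simp add: power_mult_distrib)
  finally show ?thesis .
qed

lemma grid_key_card: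
  fixes K :: "'a::euclidean_space set"
  assumes "1 \<le> R" "\<And>x. x \<in> K \<Longrightarrow> norm x \<le> real R"
  shows "finite (grid_key j ` K)" "card (grid_key j ` K) \<le> ((6 * R) ^ DIM('a)) ^ (j + 1)"
proof -
  let ?I = "{- int (2 ^ j * R)..int (2 ^ j * R)}"
  let ?S = "Basis \<rightarrow>\<^sub>E ?I :: ('a \<Rightarrow> int) set"
  have sub: "grid_key j ` K \<subseteq> ?S"
  proof
    fix g assume "g \<in> grid_key j ` K"
    then obtain x where x: "x \<in> K" "g = grid_key j x" by blast
    have "\<bar>x \<bullet> b\<bar> \<le> real R" if "b \<in> Basis" for b
      using Basis_le_norm[OF that, of x] assms(2)[OF x(1)] by linarith
    then show "g \<in> ?S" unfolding x(2) grid_key_def by (intro restrict_PiE_iff[THEN iffD2] ballI floor_range)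
  qed
  have fin: "finite ?S" by (intro finite_PiE) auto
  show "finite (grid_key j ` K)" using sub fin by (rule finite_subset)
  have "card (grid_key j ` K) \<le> card ?S" using fin sub by (rule card_mono)
  also have "\<dots> = card ?I ^ DIM('a)" by (subst card_PiE) auto
  also have "\<dots> \<le> ((6 * R) ^ (j + 1)) ^ DIM('a)"
    by (rule power_mono[OF card_floor_range[OF assms(1)]]) simp
  also have "\<dots> = ((6 * R) ^ DIM('a)) ^ (j + 1)" by (simp only: power_mult[symmetric] mult.commute)
  finally show "card (grid_key j ` K) \<le> ((6 * R) ^ DIM('a)) ^ (j + 1)" .
qed

context bregman_support begin

lemma gd_close:
  assumes len: "length c = length c'" "c \<noteq> []" and u: "u \<in> F"
    and close: "\<And>i. i < length c \<Longrightarrow> \<bar>d u (c!i) - d u (c'!i)\<bar> \<le> e"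
  shows "\<bar>gd c u - gd c' u\<bar> \<le> e"
proof -
  have half: "gd a u \<le> gd b u + e"
    if "length a = length b" "b \<noteq> []" "\<And>i. i < length b \<Longrightarrow> d u (a!i) \<le> d u (b!i) + e" for a b :: "'a list"
  proof -
    from cb_attained[OF that(2), of u] obtain x where "x \<in> set b" "bregman_cb \<Omega> \<phi> u b = d u x" by blast
    then obtain i where i: "i < length b" "bregman_cb \<Omega> \<phi> u b = d u (b!i)" by (auto simp: in_set_conv_nth)
    have "gd a u \<le> d u (a!i)" using i that(1) u by (intro gd_le) auto
    with that(3)[OF i(1)] i(2) u show ?thesis by (simp add: gd_def)
  qed
  have "gd c u \<le> gd c' u + e" using len close by (intro half) (auto simp: abs_le_iff algebra_simps)
  moreover have "gd c' u \<le> gd c u + e" using len close by (intro half) (auto simp: abs_le_iff algebra_simps)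
  ultimately show ?thesis by linarith
qed

text \<open>Boundedness of the hinges by T and Lipschitz dependence on codebook and level are
  uniform over the whole sample space, so chaining applies with no moment of P. T is a natural
  number so that levels can be counted on the same dyadic grids.\<close>

lemma uniform_deviation:
  fixes T :: nat
  assumes K: "compact K" "convex K" "K \<subseteq> interior \<Omega>" and k: "0 < k" and T: "1 \<le> T"
  shows "\<exists>C>0. \<forall>n>0. \<forall>x>0. \<forall>(M::'w measure) P X. prob_space M \<longrightarrow> iid_sample M P n X \<longrightarrow>
    (\<exists>E\<in>sets M. measure M E \<le> 2 * exp (- x) \<and>
      (\<forall>\<omega>\<in>space M - E. \<forall>c (s::real). set c \<subseteq> K \<longrightarrow> length c = k \<longrightarrow> 0 \<le> s \<longrightarrow> s \<le> real T \<longrightarrow>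
        \<bar>emp_dev n (\<lambda>i. X i \<omega>) P (\<lambda>u. max 0 (s - gd c u))\<bar> \<le> C * (1 + sqrt x) / sqrt n))"
proof -
  have K\<Omega>: "K \<subseteq> \<Omega>" using K(3) interior_subset by blast
  obtain R2 where R2: "\<And>u c. u \<in> \<Omega> \<Longrightarrow> c \<in> K \<Longrightarrow> d u c \<le> T \<Longrightarrow> norm u \<le> R2"
    using sublevel_bounded[OF K(1,3)] by blast
  obtain L where L: "L \<ge> 0" "\<And>u x y. norm u \<le> R2 \<Longrightarrow> x \<in> K \<Longrightarrow> y \<in> K \<Longrightarrow> \<bar>d u x - d u y\<bar> \<le> L * norm (x - y)"
    using d_lipschitz_center[OF K(1,2) K\<Omega>] by blast
  obtain R0 where R0: "\<And>x. x \<in> K \<Longrightarrow> norm x \<le> R0" using compact_imp_bounded[OF K(1)] by (auto simp: bounded_iff)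
  obtain R :: nat where R: "1 \<le> R" "R0 \<le> R"
    using real_arch_simple[of "max 1 R0"] by auto
  define f where "f = (\<lambda>(c, s) u. max 0 (s - gd c u))"
  define \<Theta> where "\<Theta> = {(c, s). set c \<subseteq> K \<and> length c = k \<and> 0 \<le> s \<and> s \<le> real T}"
  define key where "key = (\<lambda>j (p :: 'a list \<times> real). (map (grid_key j) (fst p), \<lfloor>2 ^ j * snd p\<rfloor>))"
  \<comment> \<open>T bounds the hinge functions; 1 and \<open>L * DIM('a)\<close> are the errors,
    in units of 2^-j, from rounding the level and a codepoint.\<close>
  define LL where "LL = real T + 1 + L * DIM('a)"
  \<comment> \<open>One grid for each of the k codepoints and one for the level.\<close>
  define A where "A = ((6 * R) ^ DIM('a)) ^ k * (6 * T)"
  have kcard: "finite (key j ` \<Theta>) \<and> card (key j ` \<Theta>) \<le> A ^ (j + 1)" for j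
  proof -
    let ?G = "grid_key j ` K" and ?I = "{- int (2 ^ j * T)..int (2 ^ j * T)}"
    note g = grid_key_card[OF R(1), of K j]
    have gR: "norm x \<le> real R" if "x \<in> K" for x using R0[OF that] R(2) by linarith
    have sub: "key j ` \<Theta> \<subseteq> {l. set l \<subseteq> ?G \<and> length l = k} \<times> ?I"
    proof
      fix z assume "z \<in> key j ` \<Theta>"
      then obtain c s where cs: "set c \<subseteq> K" "length c = k" "0 \<le> s" "s \<le> real T" "z = (map (grid_key j) c, \<lfloor>2 ^ j * s\<rfloor>)"
        by (auto simp: key_def \<Theta>_def)
      have "\<lfloor>2 ^ j * s\<rfloor> \<in> ?I" using cs by (intro floor_range) auto
      with cs show "z \<in> {l. set l \<subseteq> ?G \<and> length l = k} \<times> ?I" by auto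
    qed
    have fin: "finite ({l. set l \<subseteq> ?G \<and> length l = k} \<times> ?I)"
      using g gR by (intro finite_cartesian_product finite_lists_length_eq) auto
    have "card (key j ` \<Theta>) \<le> card ({l. set l \<subseteq> ?G \<and> length l = k} \<times> ?I)" using fin sub by (rule card_mono)
    also have "\<dots> = card ?G ^ k * card ?I" using g(1) gR by (simp only: card_cartesian_product card_lists_length_eq)
    also have "\<dots> \<le> (((6 * R) ^ DIM('a)) ^ (j + 1)) ^ k * (6 * T) ^ (j + 1)"
      by (intro mult_le_mono power_mono card_floor_range T g gR) auto
    also have "\<dots> = A ^ (j + 1)"
      unfolding A_def power_mult_distrib by (simp only: power_mult[symmetric] mult.commute mult.left_commute)
    finally show ?thesis using finite_subset[OF sub fin] by blast
  qed
  have A0: "0 < A" using R(1) T by (simp add: A_def)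
  have LL0: "0 < LL" using L(1) T by (simp add: LL_def add_pos_nonneg)
  have ne: "c \<noteq> []" "set c \<subseteq> \<Omega>" if "(c, s) \<in> \<Theta>" for c s using that k K\<Omega> by (auto simp: \<Theta>_def)
  have fm: "f \<theta> \<in> borel_measurable borel" if "\<theta> \<in> \<Theta>" for \<theta>
  proof -
    obtain c s where \<theta>: "\<theta> = (c, s)" by (cases \<theta>)
    note [measurable] = gd_measurable[OF ne(2,1)[OF that[unfolded \<theta>]]]
    show ?thesis unfolding \<theta> f_def by simp
  qed
  have fb: "\<bar>f \<theta> u\<bar> \<le> LL" if "\<theta> \<in> \<Theta>" for \<theta> u
  proof -
    obtain c s where \<theta>: "\<theta> = (c, s)" by (cases \<theta>)
    have "\<bar>f \<theta> u\<bar> \<le> real T"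
      using gd_nonneg[OF ne(2,1)[OF that[unfolded \<theta>]], of u] that by (auto simp: \<theta> f_def \<Theta>_def)
    also have "\<dots> \<le> LL" using L(1) by (simp add: LL_def)
    finally show ?thesis .
  qed
  have near: "\<bar>f \<theta> u - f \<theta>' u\<bar> \<le> LL / 2 ^ j" if \<theta>: "\<theta> \<in> \<Theta>" "\<theta>' \<in> \<Theta>" and eq: "key j \<theta> = key j \<theta>'" for j \<theta> \<theta>' u
  proof -
    obtain c s c' s' where cs: "\<theta> = (c, s)" "\<theta>' = (c', s')" by (metis surj_pair)
    have c: "set c \<subseteq> K" "length c = k" "s \<le> T" and c': "set c' \<subseteq> K" "length c' = k" "s' \<le> T"
      using \<theta> by (auto simp: cs \<Theta>_def)
    have m: "map (grid_key j) c = map (grid_key j) c'" and s: "\<bar>s - s'\<bar> \<le> 1 / 2 ^ j"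
      using eq floor_eq_imp_close by (auto simp: cs key_def)
    have gi: "norm (c!i - c'!i) \<le> DIM('a) / 2 ^ j" if "i < k" for i
      using grid_key_close[of j "c!i" "c'!i"] arg_cong[OF m, of "\<lambda>l. l ! i"] that c c' by simp
    have LLge: "1 / 2 ^ j + L * (DIM('a) / 2 ^ j) \<le> LL / 2 ^ j"
      by (simp add: LL_def add_divide_distrib)
    \<comment> \<open>Off F only the levels differ; on bounded data the divergence is Lipschitz in
      its center; beyond R2 the divergences exceed T and both hinges vanish.\<close>
    consider "u \<notin> F" | "u \<in> F" "norm u \<le> R2" | "u \<in> F" "R2 < norm u" by linarith
    then show ?thesis
    proof cases
      case 1
      then have "\<bar>f \<theta> u - f \<theta>' u\<bar> \<le> \<bar>s - s'\<bar>" by (simp add: f_def cs gd_def)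
      moreover have "0 \<le> L * (DIM('a) / 2 ^ j)" using L(1) by simp
      ultimately show ?thesis using s LLge by linarith
    next
      case 2
      have "\<bar>gd c u - gd c' u\<bar> \<le> L * (DIM('a) / 2 ^ j)"
      proof (rule gd_close[OF _ ne(1) 2(1)])
        fix i assume "i < length c"
        then have i: "i < k" using c by simp
        have "\<bar>d u (c!i) - d u (c'!i)\<bar> \<le> L * norm (c!i - c'!i)"
          using i c c' by (intro L(2) 2) auto
        also have "\<dots> \<le> L * (DIM('a) / 2 ^ j)" using gi[OF i] L(1) by (rule mult_left_mono)
        finally show "\<bar>d u (c!i) - d u (c'!i)\<bar> \<le> L * (DIM('a) / 2 ^ j)" .
      qed (use c c' \<theta>(1) cs in auto)
      moreover have "\<bar>f \<theta> u - f \<theta>' u\<bar> \<le> \<bar>s - s'\<bar> + \<bar>gd c u - gd c' u\<bar>" by (simp add: f_def cs)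
      ultimately show ?thesis using s LLge by linarith
    next
      case 3
      have "T < gd b u" if b: "set b \<subseteq> K" "b \<noteq> []" for b
      proof -
        from cb_attained[OF b(2), of u] obtain x where "x \<in> set b" "bregman_cb \<Omega> \<phi> u b = d u x" by blast
        moreover have "T < d u x" if "x \<in> K" using R2[of u x] that 3 F_dom by fastforce
        ultimately show ?thesis using b 3 by (auto simp: gd_def)
      qed
      moreover have "c \<noteq> []" "c' \<noteq> []" using c(2) c'(2) k by auto
      ultimately have "T < gd c u" "T < gd c' u" using c(1) c'(1) by simp_all
      then have "f \<theta> u = 0" "f \<theta>' u = 0" using c(3) c'(3) by (auto simp: f_def cs)
      then show ?thesis using LL0 by simp
    qed
  qed
  have "\<exists>C>0. \<forall>n>0. \<forall>x>0. \<forall>(M::'w measure) P X. prob_space M \<longrightarrow> iid_sample M P n X \<longrightarrow>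
    (\<exists>E\<in>sets M. measure M E \<le> 2 * exp (- x) \<and>
      (\<forall>\<omega>\<in>space M - E. \<forall>\<theta>\<in>\<Theta>. \<bar>emp_dev n (\<lambda>i. X i \<omega>) P (f \<theta>)\<bar> \<le> C * (1 + sqrt x) / sqrt n))"
    by (rule chaining[where key = key and A = A and L = LL])
       (erule fm, erule fb, rule LL0, rule conjunct1[OF kcard], rule conjunct2[OF kcard], rule A0, erule (2) near)
  then obtain C where C0: "0 < C" and C: "\<forall>n>0. \<forall>x>0. \<forall>(M::'w measure) P X. prob_space M \<longrightarrow> iid_sample M P n X \<longrightarrow>
    (\<exists>E\<in>sets M. measure M E \<le> 2 * exp (- x) \<and>
      (\<forall>\<omega>\<in>space M - E. \<forall>\<theta>\<in>\<Theta>. \<bar>emp_dev n (\<lambda>i. X i \<omega>) P (f \<theta>)\<bar> \<le> C * (1 + sqrt x) / sqrt n))"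
    by (elim exE conjE) (rule that)
  show ?thesis
  proof (intro exI[of _ C] conjI allI impI C0)
    fix n :: nat and x :: real and M :: "'w measure" and P :: "'a measure" and X
    assume "0 < n" "0 < x" "prob_space M" "iid_sample M P n X"
    from C[rule_format, OF this] obtain E where E: "E \<in> sets M" "measure M E \<le> 2 * exp (- x)"
      "\<forall>\<omega>\<in>space M - E. \<forall>\<theta>\<in>\<Theta>. \<bar>emp_dev n (\<lambda>i. X i \<omega>) P (f \<theta>)\<bar> \<le> C * (1 + sqrt x) / sqrt n" by blast
    have "\<bar>emp_dev n (\<lambda>i. X i \<omega>) P (\<lambda>u. max 0 (s - gd c u))\<bar> \<le> C * (1 + sqrt x) / sqrt n"
      if "\<omega> \<in> space M - E" "set c \<subseteq> K" "length c = k" "0 \<le> s" "s \<le> real T" for \<omega> c s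
    proof -
      have "(c, s) \<in> \<Theta>" using that by (simp add: \<Theta>_def)
      from bspec[OF bspec[OF E(3) that(1)] this] show ?thesis by (simp add: f_def)
    qed
    with E(1,2) show "\<exists>E\<in>sets M. measure M E \<le> 2 * exp (- x) \<and>
      (\<forall>\<omega>\<in>space M - E. \<forall>c (s::real). set c \<subseteq> K \<longrightarrow> length c = k \<longrightarrow> 0 \<le> s \<longrightarrow> s \<le> real T \<longrightarrow>
        \<bar>emp_dev n (\<lambda>i. X i \<omega>) P (\<lambda>u. max 0 (s - gd c u))\<bar> \<le> C * (1 + sqrt x) / sqrt n)" by blast
  qed
qed

end

section \<open>Bounded trimming levels and empirical measures\<close>

lemma is_trim_level_le:
  assumes "prob_space M" "is_trim_level M h g t" "g \<in> borel_measurable M" "h < measure M B"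
    "B \<in> sets M" "\<And>u. u \<in> B \<Longrightarrow> g u \<le> T"
  shows "t \<le> T"
proof (rule ccontr)
  interpret prob_space M by fact
  assume "\<not> t \<le> T"
  then have "measure M B \<le> measure M {u \<in> space M. g u < t}"
    using assms sets.sets_into_space[OF assms(5)] by (intro finite_measure_mono) (force, measurable)
  with assms(2,4) show False by (simp add: is_trim_level_def)
qed

lemma empirical_measure_props:
  fixes x :: "nat \<Rightarrow> 'a::topological_space"
  assumes "0 < n"
  shows "prob_space (empirical_measure n x)" "sets (empirical_measure n x) = sets borel"
    "f \<in> borel_measurable borel \<Longrightarrow> (\<integral>u. f u \<partial>empirical_measure n x) = (\<Sum>i<n. f (x i :: 'a) :: real) / n"
    "S \<in> sets borel \<Longrightarrow> (\<And>i. i < n \<Longrightarrow> x i \<in> S) \<Longrightarrow> AE u in empirical_measure n x. u \<in> S"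
proof -
  interpret U: prob_space "uniform_count_measure {..<n}" using assms by (intro prob_space_uniform_count_measure) auto
  have x: "x \<in> measurable (uniform_count_measure {..<n}) borel"
    by (rule measurableI) (auto simp: space_uniform_count_measure sets_uniform_count_measure)
  show "prob_space (empirical_measure n x)" unfolding empirical_measure_def using x by (rule U.prob_space_distr)
  show "sets (empirical_measure n x) = sets borel" by (simp add: empirical_measure_def)
  show "(\<integral>u. f u \<partial>empirical_measure n x) = (\<Sum>i<n. f (x i) :: real) / n" if "f \<in> borel_measurable borel"
    unfolding empirical_measure_def by (subst integral_distr[OF x that]) (simp add: integral_uniform_count_measure)
  show "AE u in empirical_measure n x. u \<in> S" if "S \<in> sets borel" "\<And>i. i < n \<Longrightarrow> x i \<in> S"
    unfolding empirical_measure_def using that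
    by (subst AE_distr_iff[OF x]) (auto intro!: AE_I2 simp: space_uniform_count_measure)
qed

section \<open>Localization of optimal codebooks\<close>

context bregman_support begin

text \<open>The optimal level for \<mu> serves as a test level for P, where it still gives a lower
  bound. It lies in [0, T] because B carries more than mass h at divergence at most T.\<close>

lemma distortion_le_of_deviation:
  assumes \<mu>: "F_measure \<mu>" and P: "F_measure P" and c: "set c \<subseteq> \<Omega>" "c \<noteq> []" and h: "0 < h" "h < 1"
    and B: "B \<in> sets borel" "B \<subseteq> F" "h < measure \<mu> B" "\<And>u x. u \<in> B \<Longrightarrow> x \<in> set c \<Longrightarrow> d u x \<le> T"
    and e: "\<And>s. 0 \<le> s \<Longrightarrow> s \<le> T \<Longrightarrow> \<bar>(\<integral>u. max 0 (s - gd c u) \<partial>\<mu>) - (\<integral>u. max 0 (s - gd c u) \<partial>P)\<bar> \<le> e"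
  shows "trimmed_distortion \<Omega> \<phi> \<mu> h c \<le> trimmed_distortion \<Omega> \<phi> P h c + e"
proof -
  obtain t where t: "is_trim_level \<mu> h (gd c) t" "trimmed_distortion \<Omega> \<phi> \<mu> h c = trim_dual \<mu> h (gd c) t"
    by (rule trimmed_distortion_eq[OF \<mu> c h])
  have "t \<le> T"
  proof (rule is_trim_level_le[OF F_measureD(1)[OF \<mu>] t(1) gd_borel[OF \<mu> c] B(3)])
    show "B \<in> sets \<mu>" using B(1) F_measureD(2)[OF \<mu>] by simp
    fix u assume "u \<in> B"
    obtain x where "x \<in> set c" using c(2) by (cases c) auto
    with gd_le[of x c u] B(2,4) \<open>u \<in> B\<close> show "gd c u \<le> T" by (meson order_trans subsetD)
  qed
  moreover have "0 \<le> t" using t(1) by (simp add: is_trim_level_def)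
  ultimately have "\<bar>(\<integral>u. max 0 (t - gd c u) \<partial>\<mu>) - (\<integral>u. max 0 (t - gd c u) \<partial>P)\<bar> \<le> e" by (intro e)
  then have "trim_dual \<mu> h (gd c) t \<le> trim_dual P h (gd c) t + e" by (simp add: trim_dual_def)
  with trim_dual_le_distortion[OF P c h, of t] t(2) show ?thesis by linarith
qed

lemma compact_exhaustion:
  assumes P: "F_measure P" and q: "q < 1"
  obtains n :: nat where "q < measure P (F \<inter> cball 0 (real n))"
proof -
  note P' = F_measureD[OF P]
  interpret prob_space P by (rule P')
  have "(\<lambda>n. measure P (F \<inter> cball 0 (real n))) \<longlonglongrightarrow> measure P (\<Union>n. F \<inter> cball 0 (real n))"
  proof (rule finite_Lim_measure_incseq)
    show "range (\<lambda>n. F \<inter> cball 0 (real n)) \<subseteq> events"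
    proof
      fix S assume "S \<in> range (\<lambda>n. F \<inter> cball 0 (real n))"
      then have "closed S" using closed_F by (auto intro!: closed_Int)
      then show "S \<in> events" by (simp add: P'(2))
    qed
    show "incseq (\<lambda>n. F \<inter> cball 0 (real n))" by (auto simp: incseq_def)
  qed
  also have "(\<Union>n. F \<inter> cball 0 (real n)) = F"
  proof -
    have "\<exists>n::nat. norm u \<le> real n" for u :: 'a by (rule real_arch_simple)
    then show ?thesis by auto
  qed
  also have "measure P F = 1" using P' by (subst prob_eq_1) auto
  finally have "\<forall>\<^sub>F n in sequentially. q < measure P (F \<inter> cball 0 (real n))"
    using q by (rule order_tendstoD(1))
  from eventually_happens'[OF sequentially_bot this] that show thesis by blast
qed

lemma compact_F_cball: "compact (F \<inter> cball 0 r)" "F \<inter> cball 0 r \<subseteq> \<Omega>"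
  using closed_F F_dom by (auto intro: closed_Int_compact)

text \<open>Stated for an arbitrary measure, so that it applies both to \<open>P\<close> and to the empirical measure.\<close>
definition localizes ::
  "'a measure \<Rightarrow> real \<Rightarrow> nat \<Rightarrow> real \<Rightarrow> real \<Rightarrow> 'a set \<Rightarrow> 'a set \<Rightarrow> 'a set \<Rightarrow> real \<Rightarrow> real \<Rightarrow> bool" where
  "localizes P h k r0 r1 K B B' \<epsilon> E \<longleftrightarrow>
    (\<forall>\<mu> c. F_measure \<mu> \<longrightarrow> (1 + h) / 2 \<le> measure \<mu> B \<longrightarrow> 1 - \<epsilon> \<le> measure \<mu> B' \<longrightarrow>
      (\<integral>u. indicator B' u * norm u \<partial>\<mu>) \<le> E \<longrightarrow>
      (\<forall>c'. set c' \<subseteq> K \<longrightarrow> length c' = k \<longrightarrow>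
        trimmed_distortion \<Omega> \<phi> P h c' \<le> trimmed_distortion \<Omega> \<phi> \<mu> h c' + (r1 - r0) / 4) \<longrightarrow>
      set c \<subseteq> \<Omega> \<longrightarrow> length c = k \<longrightarrow>
      (\<forall>c'. set c' \<subseteq> \<Omega> \<longrightarrow> length c' = k \<longrightarrow> trimmed_distortion \<Omega> \<phi> \<mu> h c \<le> trimmed_distortion \<Omega> \<phi> \<mu> h c') \<longrightarrow>
      trimmed_distortion \<Omega> \<phi> \<mu> h c \<le> r0 + (r1 - r0) / 4 \<longrightarrow> set c \<subseteq> K)"

text \<open>The order of choice avoids circularity: B and E determine M1, then \<alpha> is small
  relative to M1, then K1 and its tube give \<delta>, then \<epsilon> is small relative to
  \<open>\<alpha> * \<delta>\<close>, and B' comes last. The strict inequalities for P leave room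
  for their empirical versions.\<close>

lemma localization:
  assumes P: "F_measure P" and h: "0 < h" "h < 1" and k: "2 \<le> k" and gap: "r0 < r1"
    and r1: "\<And>c. set c \<subseteq> \<Omega> \<Longrightarrow> length c = k - 1 \<Longrightarrow> r1 \<le> trimmed_distortion \<Omega> \<phi> P h c"
    and int: "integrable P norm"
  obtains K B B' \<epsilon> E where "compact K" "convex K" "K \<subseteq> interior \<Omega>" "compact B" "B \<subseteq> F" "compact B'" "B' \<subseteq> F"
    "(1 + h) / 2 < measure P B" "1 - \<epsilon> < measure P B'" "(\<integral>u. indicator B' u * norm u \<partial>P) < E"
    "localizes P h k r0 r1 K B B' \<epsilon> E"
proof -
  note P' = F_measureD[OF P]
  interpret P: prob_space P by (rule P')
  note [measurable_cong] = P'(2)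
  \<comment> \<open>The extra 1 makes E exceed the truncated first moment for every possible B',
    which is fixed only later.\<close>
  define E where "E = (\<integral>u. norm u \<partial>P) + 1"
  have E0: "0 < E" unfolding E_def by (intro add_nonneg_pos Bochner_Integration.integral_nonneg) auto
  define h2 where "h2 = h / (2 * real k)"
  have h2: "0 < h2" using h k by (simp add: h2_def)
  obtain nB where nB: "(1 + h) / 2 < measure P (F \<inter> cball 0 (real nB))"
    using compact_exhaustion[OF P, of "(1 + h) / 2"] h by auto
  define B where "B = F \<inter> cball 0 (real nB)"
  have B: "compact B" "B \<subseteq> F" "B \<subseteq> \<Omega>" using compact_F_cball[of "real nB"] by (auto simp: B_def)
  obtain M1 where M1: "0 \<le> M1" "\<And>u c. u \<in> B \<Longrightarrow> c \<in> F \<inter> cball 0 (E / h2) \<Longrightarrow> d u c \<le> M1"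
    using d_bounded[OF B(1,3) compact_F_cball] by blast
  \<comment> \<open>In turn: the distinguished cell stays heavy, the refilled mass fits into B, and
    dropping k cells costs at most an eighth of the gap. Adding 1 to M1 guards against division by
    zero.\<close>
  define \<alpha> where "\<alpha> = min h2 (min ((1 - h) / (4 * k)) ((r1 - r0) / (8 * k * (M1 + 1))))"
  have \<alpha>: "0 < \<alpha>" "\<alpha> \<le> h2" using h2 h k gap M1(1) by (auto simp: \<alpha>_def)
  have k\<alpha>: "k * \<alpha> \<le> (1 - h) / 4"
  proof -
    have "\<alpha> \<le> (1 - h) / (4 * k)" by (simp add: \<alpha>_def)
    then show ?thesis using k by (simp add: field_simps)
  qed
  have k\<alpha>M: "k * \<alpha> * M1 \<le> (r1 - r0) / 8"
  proof -
    have "\<alpha> \<le> (r1 - r0) / (8 * k * (M1 + 1))" by (simp add: \<alpha>_def)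
    then have "\<alpha> * (8 * k * (M1 + 1)) \<le> r1 - r0"
      using M1(1) k by (subst (asm) pos_le_divide_eq) (auto intro!: mult_pos_pos)
    moreover have "0 \<le> \<alpha> * k" using \<alpha> by simp
    ultimately show ?thesis by (simp add: algebra_simps)
  qed
  \<comment> \<open>Contains the mean of every cell of mass at least \<alpha>, since such a mean has
    norm at most E / \<alpha>.\<close>
  define K1 where "K1 = F \<inter> cball 0 (E / \<alpha>)"
  have K1: "compact K1" "K1 \<subseteq> \<Omega>" "convex K1" "K1 \<subseteq> interior \<Omega>"
    using compact_F_cball[of "E / \<alpha>"] convex_F F_sub by (auto simp: K1_def intro: convex_Int)
  obtain \<rho> where \<rho>: "\<rho> > 0" "\<And>x y. x \<in> K1 \<Longrightarrow> norm (y - x) \<le> \<rho> \<Longrightarrow> y \<in> interior \<Omega>"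
    using compact_tube[OF K1(1,4)] by blast
  have \<rho>': "y \<in> \<Omega>" if "x \<in> K1" "norm (y - x) \<le> \<rho>" for x y
    using subsetD[OF interior_subset \<rho>(2)[OF that]] .
  obtain \<delta> where \<delta>: "\<delta> > 0" "\<And>x y. x \<in> K1 \<Longrightarrow> norm (y - x) = \<rho> \<Longrightarrow> \<delta> \<le> d x y"
  proof (cases "K1 = {}")
    case True then show thesis using that[of 1] by simp
  next
    case False
    show thesis
    proof (rule d_lower_tube[OF K1(1) False \<rho>(1) \<rho>'])
      fix e assume e: "e > 0" "\<And>x y. x \<in> K1 \<Longrightarrow> norm (y - x) = \<rho> \<Longrightarrow> e \<le> d x y \<and> e \<le> d y x"
      show thesis by (rule that[OF e(1) conjunct1[OF e(2)]])
    qed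
  qed
  \<comment> \<open>The closed \<rho>-neighbourhood of K1, written as a Minkowski sum: it inherits
    compactness and the convexity needed for Lipschitz bounds in the center.\<close>
  define K where "K = (\<Union>x\<in>K1. \<Union>y\<in>cball 0 \<rho>. {x + y})"
  have K: "compact K" "convex K" unfolding K_def
    using K1 by (auto intro!: compact_sums' convex_sums)
  have Kint: "K \<subseteq> interior \<Omega>" unfolding K_def using \<rho>(2) by auto
  have Kmem: "y \<in> K" if "x \<in> K1" "norm (y - x) \<le> \<rho>" for x y
    unfolding K_def using that by (intro UN_I[of x] UN_I[of "y - x"]) auto
  \<comment> \<open>The first two entries serve the mass conditions of \<open>compactify\<close>,
    the third keeps \<open>\<epsilon> * M1\<close> within an eighth of the gap, the fourth puts it
    below \<open>\<alpha> * \<delta>\<close>.\<close>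
  define \<epsilon> where "\<epsilon> = min (h / 2) (min ((1 - h) / 4) (min ((r1 - r0) / (8 * (M1 + 1))) (\<alpha> * \<delta> / (2 * (M1 + 1)))))"
  have "0 < \<epsilon>" using h gap M1(1) \<alpha> \<delta>(1) by (auto simp: \<epsilon>_def)
  moreover have "\<epsilon> \<le> h / 2" "\<epsilon> \<le> (1 - h) / 4" unfolding \<epsilon>_def by (rule min.cobounded1, metis min.cobounded1 min.coboundedI2)
  ultimately have \<epsilon>: "0 < \<epsilon>" "\<epsilon> \<le> h / 2" "\<epsilon> \<le> (1 - h) / 4" by blast+
  have \<epsilon>M: "\<epsilon> * M1 \<le> (r1 - r0) / 8"
  proof -
    have "\<epsilon> \<le> (r1 - r0) / (8 * (M1 + 1))" by (simp add: \<epsilon>_def)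
    then have "\<epsilon> * (8 * (M1 + 1)) \<le> r1 - r0" using M1(1) by (subst (asm) pos_le_divide_eq) auto
    then show ?thesis using \<epsilon>(1) by (simp add: algebra_simps)
  qed
  have \<epsilon>M2: "\<epsilon> * M1 < \<alpha> * \<delta>"
  proof -
    have "\<epsilon> \<le> \<alpha> * \<delta> / (2 * (M1 + 1))" by (simp add: \<epsilon>_def)
    then have "\<epsilon> * (2 * (M1 + 1)) \<le> \<alpha> * \<delta>" using M1(1) by (subst (asm) pos_le_divide_eq) auto
    moreover have "0 \<le> \<epsilon> * M1" using \<epsilon>(1) M1(1) by simp
    ultimately show ?thesis using \<epsilon>(1) by (simp add: algebra_simps)
  qed
  obtain nB' where nB': "1 - \<epsilon> < measure P (F \<inter> cball 0 (real nB'))"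
    using compact_exhaustion[OF P, of "1 - \<epsilon>"] \<epsilon>(1) by auto
  define B' where "B' = F \<inter> cball 0 (real nB')"
  have B': "compact B'" "B' \<subseteq> F" using compact_F_cball[of "real nB'"] by (auto simp: B'_def)
  have [measurable]: "B' \<in> sets borel" using B' by (simp add: compact_imp_closed)
  show thesis
  proof (rule that[of K B B' \<epsilon> E])
    show "(\<integral>u. indicator B' u * norm u \<partial>P) < E"
    proof -
      have "(\<integral>u. indicator B' u * norm u \<partial>P) \<le> (\<integral>u. norm u \<partial>P)"
      proof (rule integral_mono[OF _ int])
        show "integrable P (\<lambda>u. indicator B' u * norm u)"
          by (rule Bochner_Integration.integrable_bound[OF int]) (auto intro!: AE_I2 split: split_indicator)
      qed (auto split: split_indicator)
      then show ?thesis by (simp add: E_def)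
    qed
    show "localizes P h k r0 r1 K B B' \<epsilon> E"
      unfolding localizes_def
    proof (intro allI impI)
      fix \<mu> c
      assume \<mu>: "F_measure \<mu>" "(1 + h) / 2 \<le> measure \<mu> B" "1 - \<epsilon> \<le> measure \<mu> B'"
        "(\<integral>u. indicator B' u * norm u \<partial>\<mu>) \<le> E"
        and near: "\<forall>c'. set c' \<subseteq> K \<longrightarrow> length c' = k \<longrightarrow>
          trimmed_distortion \<Omega> \<phi> P h c' \<le> trimmed_distortion \<Omega> \<phi> \<mu> h c' + (r1 - r0) / 4"
        and c: "set c \<subseteq> \<Omega>" "length c = k"
        and opt: "\<forall>c'. set c' \<subseteq> \<Omega> \<longrightarrow> length c' = k \<longrightarrow>
          trimmed_distortion \<Omega> \<phi> \<mu> h c \<le> trimmed_distortion \<Omega> \<phi> \<mu> h c'"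
        and small: "trimmed_distortion \<Omega> \<phi> \<mu> h c \<le> r0 + (r1 - r0) / 4"
      have k0: "0 < k" using k by simp
      have \<epsilon>\<alpha>: "\<epsilon> + k * \<alpha> \<le> (1 - h) / 2" using \<epsilon>(3) k\<alpha> by simp
      have M1': "d u m \<le> M1" if "u \<in> B" "m \<in> F" "norm m \<le> E / (h / (2 * real k))" for u m
        using M1(2)[OF that(1), of m] that(2,3) by (simp add: h2_def)
      have \<alpha>2: "\<alpha> \<le> h / real (2 * k)" using \<alpha>(2) by (simp add: h2_def)
      obtain S c' i0 where S: "S \<subseteq> {..<k}" "length c' = k" "i0 \<in> S"
        "\<And>i. i < k \<Longrightarrow> i \<notin> S \<Longrightarrow> c' ! i = c' ! i0"
        "\<And>x. x \<in> set c' \<Longrightarrow> x \<in> F \<and> norm x \<le> E / \<alpha>"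
        "trimmed_distortion \<Omega> \<phi> \<mu> h c' + \<alpha> * (\<Sum>i\<in>S. d (c'!i) (c!i))
          \<le> trimmed_distortion \<Omega> \<phi> \<mu> h c + (\<epsilon> + (if S = {..<k} then 0 else k * \<alpha>)) * M1"
        by (rule compactify[OF \<mu>(1) h c k0 B(1,2) \<mu>(2) B' \<mu>(3,4) \<alpha>(1) \<alpha>2 \<epsilon>(2) \<epsilon>\<alpha> M1(1) M1'])
           (assumption, assumption, assumption, rule that)
      have c'1: "set c' \<subseteq> K1" using S(5) by (auto simp: K1_def)
      have c'K: "set c' \<subseteq> K" using c'1 Kmem[of _ ] \<rho>(1) by (metis diff_self less_imp_le norm_zero subset_iff)
      have c'\<Omega>: "set c' \<subseteq> \<Omega>" "c' \<noteq> []" using c'1 K1(2) S(2) k0 by auto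
      have term0: "0 \<le> d (c'!i) (c!i)" if "i \<in> S" for i
      proof (rule d_nonneg)
        have "i < k" using that S(1) by auto
        then show "c' ! i \<in> \<Omega>" "c ! i \<in> \<Omega>" using S(2) c c'\<Omega>(1) by (metis nth_mem subsetD)+
      qed
      show "set c \<subseteq> K"
      proof (cases "S = {..<k}")
        case True
        \<comment> \<open>With no cell dropped, refilling costs at most
          \<open>\<epsilon> * M1\<close>; optimality of c therefore leaves each divergence from mean
          to codepoint below \<delta>.\<close>
        have "trimmed_distortion \<Omega> \<phi> \<mu> h c \<le> trimmed_distortion \<Omega> \<phi> \<mu> h c'" by (rule opt[rule_format, OF c'\<Omega>(1) S(2)])
        with S(6) True have le: "\<alpha> * (\<Sum>i<k. d (c'!i) (c!i)) \<le> \<epsilon> * M1" by simp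
        have "c ! i \<in> K" if i: "i < k" for i
        proof -
          have ci: "c'!i \<in> K1" "c!i \<in> \<Omega>" using i c'1 S(2) c by auto
          have "d (c'!i) (c!i) \<le> (\<Sum>i<k. d (c'!i) (c!i))"
            using i term0 True by (intro member_le_sum) auto
          then have "\<alpha> * d (c'!i) (c!i) \<le> \<epsilon> * M1"
            using le \<alpha>(1) by (meson mult_le_cancel_left_pos order_trans)
          with \<epsilon>M2 have "\<alpha> * d (c'!i) (c!i) < \<alpha> * \<delta>" by linarith
          then have lt: "d (c'!i) (c!i) < \<delta>" using \<alpha>(1) by simp
          have "norm (c!i - c'!i) \<le> \<rho>"
          proof (rule ccontr)
            assume "\<not> norm (c!i - c'!i) \<le> \<rho>"
            then have "\<delta> \<le> d (c'!i) (c!i)"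
              using ci K1(2) by (intro d_lower_far[OF \<delta>(2) \<rho>(1)]) auto
            with lt show False by simp
          qed
          with Kmem ci show ?thesis by blast
        qed
        then show ?thesis using c(2) by (auto simp: in_set_conv_nth)
      next
        case False
        then obtain i where i: "i < k" "i \<notin> S" using S(1) by auto
        \<comment> \<open>Slot i repeats the entry at i0, so deleting it keeps the set of codepoints
          and leaves k - 1 of them, to which r1 applies.\<close>
        define c2 where "c2 = take i c' @ drop (Suc i) c'"
        have split: "c' = take i c' @ c' ! i # drop (Suc i) c'" using i S(2) by (simp add: id_take_nth_drop)
        have len2: "length c2 = k - 1" using i S(2) by (simp add: c2_def)
        have "c' ! i0 \<in> set c2"
        proof (cases "i0 < i")
          case True
          then have "take i c' ! i0 = c' ! i0" "i0 < length (take i c')" using i S(2) by auto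
          then show ?thesis unfolding c2_def by (metis Un_iff nth_mem set_append)
        next
          case False
          then have *: "Suc i \<le> i0" using i S(3) by (cases "i0 = i") auto
          moreover have "i0 < k" using S(1,3) by auto
          ultimately have "drop (Suc i) c' ! (i0 - Suc i) = c' ! i0" "i0 - Suc i < length (drop (Suc i) c')"
            using S(2) by auto
          then show ?thesis unfolding c2_def by (metis Un_iff nth_mem set_append)
        qed
        then have "c' ! i \<in> set c2" using S(4)[OF i] by simp
        moreover have "set c' = insert (c' ! i) (set c2)" by (subst split) (auto simp: c2_def)
        ultimately have set2: "set c2 = set c'" by auto
        have "r1 \<le> trimmed_distortion \<Omega> \<phi> P h c2" using r1 len2 set2 c'\<Omega>(1) by simp
        also have "\<dots> = trimmed_distortion \<Omega> \<phi> P h c'" by (rule distortion_cong_set[OF P c'\<Omega> h set2])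
        also have "\<dots> \<le> trimmed_distortion \<Omega> \<phi> \<mu> h c' + (r1 - r0) / 4" by (rule near[rule_format, OF c'K S(2)])
        finally have 1: "r1 \<le> trimmed_distortion \<Omega> \<phi> \<mu> h c' + (r1 - r0) / 4" .
        have "0 \<le> \<alpha> * (\<Sum>i\<in>S. d (c'!i) (c!i))" using \<alpha>(1) term0 by (intro mult_nonneg_nonneg sum_nonneg) auto
        moreover have "trimmed_distortion \<Omega> \<phi> \<mu> h c' + \<alpha> * (\<Sum>i\<in>S. d (c'!i) (c!i))
          \<le> trimmed_distortion \<Omega> \<phi> \<mu> h c + (\<epsilon> * M1 + k * \<alpha> * M1)" using S(6) False by (simp add: algebra_simps)
        \<comment> \<open>The losses amount to 1/4 + 1/4 + 1/8 + 1/8 of the gap, so r1 would be at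
          most r0 plus three quarters of the gap.\<close>
        ultimately have "r1 < r1" using 1 small \<epsilon>M k\<alpha>M gap by argo
        then show ?thesis by simp
      qed
    qed
  qed (use K Kint B B' nB nB' B_def B'_def in auto)
qed

end

section \<open>The excess distortion\<close>

lemma iid_hoeffding_fixed:
  fixes f :: "'a::topological_space \<Rightarrow> real"
  assumes M: "prob_space M" and iid: "iid_sample M P n X" and n: "0 < n"
    and f: "f \<in> borel_measurable borel" and b: "\<And>u. \<bar>f u\<bar> \<le> b" "0 < b" and \<eta>: "0 < \<eta>"
  shows "{\<omega> \<in> space M. \<eta> \<le> \<bar>emp_dev n (\<lambda>i. X i \<omega>) P f\<bar>} \<in> sets M"
    "measure M {\<omega> \<in> space M. \<eta> \<le> \<bar>emp_dev n (\<lambda>i. X i \<omega>) P f\<bar>} \<le> 2 * exp (- (\<eta>\<^sup>2 / (2 * b\<^sup>2)) * n)"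
proof -
  define y where "y = \<eta>\<^sup>2 / (2 * b\<^sup>2) * n"
  have y: "0 \<le> y" by (simp add: y_def)
  have "2 * y / n = (\<eta> / b)\<^sup>2" using n by (simp add: y_def power_divide)
  then have eq: "b * sqrt (2 * y / n) = \<eta>" using b(2) \<eta> by simp
  show "{\<omega> \<in> space M. \<eta> \<le> \<bar>emp_dev n (\<lambda>i. X i \<omega>) P f\<bar>} \<in> sets M"
    using iid_hoeffding(1)[OF M iid n f b y] unfolding eq .
  show "measure M {\<omega> \<in> space M. \<eta> \<le> \<bar>emp_dev n (\<lambda>i. X i \<omega>) P f\<bar>} \<le> 2 * exp (- (\<eta>\<^sup>2 / (2 * b\<^sup>2)) * n)"
    using iid_hoeffding(2)[OF M iid n f b y] unfolding eq by (simp only: y_def mult_minus_left)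
qed

text \<open>The 8 accounts for four exceptional events of probability at most 2 exp (- a n)
  each.\<close>

lemma eventually_exp_less_powr:
  fixes a q :: real
  assumes "0 < a"
  shows "\<forall>\<^sub>F n in sequentially. 8 * exp (- a * real n) < real n powr (- q)"
proof -
  define m where "m = nat \<lceil>q\<rceil>"
  have "filterlim (\<lambda>n. a * real n) at_top sequentially"
    using assms by (intro filterlim_tendsto_pos_mult_at_top[OF tendsto_const] filterlim_real_sequentially)
  from filterlim_compose[OF tendsto_power_div_exp_0[of m] this]
  have "(\<lambda>n. (a * real n) ^ m / exp (a * real n)) \<longlonglongrightarrow> 0" .
  then have "\<forall>\<^sub>F n in sequentially. (a * real n) ^ m / exp (a * real n) < a ^ m / 8"
    using assms by (intro order_tendstoD(2)) auto
  then show ?thesis using eventually_gt_at_top[of 0]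
  proof eventually_elim
    case (elim n)
    have n: "1 \<le> real n" using elim by simp
    have "a ^ m * (real n ^ m / exp (a * real n)) < a ^ m * (1 / 8)"
      using elim by (simp add: power_mult_distrib)
    then have "real n ^ m / exp (a * real n) < 1 / 8"
      using assms by (simp only: mult_less_cancel_left_pos[OF zero_less_power[OF assms]])
    then have 1: "8 * exp (- a * real n) * real n ^ m < 1"
      by (simp add: exp_minus field_simps)
    have "real n powr q \<le> real n powr real m"
      using n by (intro powr_mono) (auto simp: m_def real_nat_ceiling_ge)
    also have "\<dots> = real n ^ m" using n by (intro powr_realpow) auto
    finally have "8 * exp (- a * real n) * real n powr q \<le> 8 * exp (- a * real n) * real n ^ m"
      by (intro mult_left_mono) auto
    with 1 have "8 * exp (- a * real n) * real n powr q < 1" by linarith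
    then show ?case using n by (simp add: powr_minus field_simps)
  qed
qed

context bregman_support begin

lemma excess_distortion_bound:
  assumes P: "F_measure P" and h: "0 < h" "h < 1" and k: "2 \<le> k" and int: "integrable P norm"
    and gap: "optimal_distortion \<Omega> \<phi> P h k < optimal_distortion \<Omega> \<phi> P h (k - 1)"
  shows "\<exists>C>0. \<exists>N. \<forall>n\<ge>N. \<forall>x>0.
    \<forall>(M :: 'w measure) X chat cstar.
      prob_space M \<longrightarrow> iid_sample M P n X \<longrightarrow>
      (AE \<omega> in M. optimal_codebook \<Omega> \<phi> (empirical_measure n (\<lambda>i. X i \<omega>)) h k (chat \<omega>)) \<longrightarrow>
      optimal_codebook \<Omega> \<phi> P h k cstar \<longrightarrow>
      (\<exists>A\<in>sets M.
         (\<forall>\<omega>\<in>A. trimmed_distortion \<Omega> \<phi> P h (chat \<omega>) - trimmed_distortion \<Omega> \<phi> P h cstar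
                  \<le> C / sqrt (real n) * (1 + sqrt x)) \<and>
         measure M A > 1 - real n powr (- p / 2) - 2 * exp (- x))"
proof -
  note P' = F_measureD[OF P]
  interpret P: prob_space P by (rule P')
  define r1 where "r1 = optimal_distortion \<Omega> \<phi> P h (k - 1)"
  define r0 where "r0 = optimal_distortion \<Omega> \<phi> P h k"
  have k0: "0 < k" "0 < k - 1" using k by auto
  have gap': "r0 < r1" using gap by (simp add: r0_def r1_def)
  have r1: "r1 \<le> trimmed_distortion \<Omega> \<phi> P h c" if "set c \<subseteq> \<Omega>" "length c = k - 1" for c
    unfolding r1_def optimal_distortion_def
  proof (rule cINF_lower)
    show "bdd_below (trimmed_distortion \<Omega> \<phi> P h ` codebooks \<Omega> (k - 1))"
      using k0 by (intro bdd_belowI2[of _ 0] distortion_nonneg[OF P _ _ h]) (auto simp: codebooks_def)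
  qed (use that in \<open>simp add: codebooks_def\<close>)
  obtain K B B' \<epsilon> E where K: "compact K" "convex K" "K \<subseteq> interior \<Omega>" and B: "compact B" "B \<subseteq> F"
    and B': "compact B'" "B' \<subseteq> F"
    and PB: "(1 + h) / 2 < measure P B" "1 - \<epsilon> < measure P B'" "(\<integral>u. indicator B' u * norm u \<partial>P) < E"
    and loc': "localizes P h k r0 r1 K B B' \<epsilon> E"
    by (rule localization[OF P h k gap' _ int]) (erule (1) r1, blast)
  note loc = loc'[unfolded localizes_def, rule_format]
  have K\<Omega>: "K \<subseteq> \<Omega>" using K(3) interior_subset by blast
  have B\<Omega>: "B \<subseteq> \<Omega>" using B(2) F_dom by blast
  have [measurable]: "B \<in> sets borel" "B' \<in> sets borel" using B B' by (auto simp: compact_imp_closed)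
  obtain T0 where T0: "\<And>u c. u \<in> B \<Longrightarrow> c \<in> K \<Longrightarrow> d u c \<le> T0"
    using d_bounded[OF B(1) B\<Omega> K(1) K\<Omega>] by blast
  obtain T :: nat where T: "max 1 T0 \<le> real T" using real_arch_simple by blast
  then have T1: "1 \<le> T" by simp
  have dT: "d u c \<le> real T" if "u \<in> B" "c \<in> K" for u c using T0[OF that] T by simp
  obtain C where C0: "0 < C" and C: "\<forall>n>0. \<forall>x>0. \<forall>(M::'w measure) P X. prob_space M \<longrightarrow> iid_sample M P n X \<longrightarrow>
    (\<exists>E\<in>sets M. measure M E \<le> 2 * exp (- x) \<and>
      (\<forall>\<omega>\<in>space M - E. \<forall>c (s::real). set c \<subseteq> K \<longrightarrow> length c = k \<longrightarrow> 0 \<le> s \<longrightarrow> s \<le> real T \<longrightarrow>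
        \<bar>emp_dev n (\<lambda>i. X i \<omega>) P (\<lambda>u. max 0 (s - gd c u))\<bar> \<le> C * (1 + sqrt x) / sqrt n))"
    using uniform_deviation[OF K k0(1) T1] by (elim exE conjE) (rule that)
  obtain b0 where b0: "\<And>u. u \<in> B' \<Longrightarrow> norm u \<le> b0" using compact_imp_bounded[OF B'(1)] by (auto simp: bounded_iff)
  define b where "b = max 1 b0"
  have b: "0 < b" "\<bar>indicator B' u * norm u\<bar> \<le> b" for u :: 'a
    using b0[of u] by (auto simp: b_def split: split_indicator)
  define \<eta>1 \<eta>2 \<eta>3 where "\<eta>1 = measure P B - (1 + h) / 2" and "\<eta>2 = measure P B' - (1 - \<epsilon>)"
    and "\<eta>3 = E - (\<integral>u. indicator B' u * norm u \<partial>P)"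
  have \<eta>: "0 < \<eta>1" "0 < \<eta>2" "0 < \<eta>3" using PB by (auto simp: \<eta>1_def \<eta>2_def \<eta>3_def)
  \<comment> \<open>At y = \<kappa> n the deviation bound is C / sqrt n + C sqrt \<kappa>. This
    choice makes the second term an eighth of the gap, and N2 below does the same for the first;
    together they give the quarter that \<open>localizes\<close> tolerates.\<close>
  define \<kappa> where "\<kappa> = ((r1 - r0) / (8 * C))\<^sup>2"
  have \<kappa>: "0 < \<kappa>" "C * sqrt \<kappa> = (r1 - r0) / 8" using gap' C0 by (auto simp: \<kappa>_def)
  define a where "a = min (min (\<eta>1\<^sup>2 / (2 * 1\<^sup>2)) (\<eta>2\<^sup>2 / (2 * 1\<^sup>2))) (min (\<eta>3\<^sup>2 / (2 * b\<^sup>2)) \<kappa>)"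
  have a0: "0 < a" using \<eta> b(1) \<kappa> by (simp add: a_def)
  have a: "a \<le> \<eta>1\<^sup>2 / (2 * 1\<^sup>2)" "a \<le> \<eta>2\<^sup>2 / (2 * 1\<^sup>2)" "a \<le> \<eta>3\<^sup>2 / (2 * b\<^sup>2)" "a \<le> \<kappa>"
    unfolding a_def by (simp_all only: min.cobounded1 min.cobounded2 min.coboundedI1 min.coboundedI2)
  obtain N1 where N1: "\<And>n. N1 \<le> n \<Longrightarrow> 8 * exp (- a * real n) < real n powr (- (p / 2))"
    using eventually_exp_less_powr[OF a0, of "p / 2"] unfolding eventually_sequentially by blast
  obtain N2 :: nat where N2: "(8 * C / (r1 - r0))\<^sup>2 \<le> real N2" using real_arch_simple by blast
  define N where "N = max 1 (max N1 N2)"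
  have main: "\<exists>A\<in>sets M. (\<forall>\<omega>\<in>A. trimmed_distortion \<Omega> \<phi> P h (chat \<omega>) - trimmed_distortion \<Omega> \<phi> P h cstar
                  \<le> 2 * C / sqrt (real n) * (1 + sqrt x)) \<and>
         measure M A > 1 - real n powr (- p / 2) - 2 * exp (- x)"
    if n: "N \<le> n" and x: "0 < x" and M: "prob_space M" and iid: "iid_sample M P n X"
      and chat: "AE \<omega> in M. optimal_codebook \<Omega> \<phi> (empirical_measure n (\<lambda>i. X i \<omega>)) h k (chat \<omega>)"
      and cstar: "optimal_codebook \<Omega> \<phi> P h k cstar"
    for n x and M :: "'w measure" and X chat cstar
  proof -
    interpret M: prob_space M by (rule M)
    have n0: "0 < n" and nN: "N1 \<le> n" "N2 \<le> n" using n by (auto simp: N_def)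
    have sn: "0 < sqrt (real n)" using n0 by simp
    define y where "y = \<kappa> * real n"
    have y: "0 < y" using \<kappa> n0 by (simp add: y_def)
    define D where "D z = C * (1 + sqrt z) / sqrt n" for z
    have Dy: "D y \<le> (r1 - r0) / 4"
    proof -
      have "8 * C / (r1 - r0) \<le> sqrt (real n)"
        using N2 nN(2) by (intro real_le_rsqrt) simp
      then have "C / sqrt n \<le> (r1 - r0) / 8" using gap' sn by (simp add: field_simps)
      moreover have "D y = C / sqrt n + C * sqrt \<kappa>" using sn by (simp add: D_def y_def real_sqrt_mult field_simps)
      ultimately show ?thesis using \<kappa>(2) by argo
    qed
    from C[rule_format, OF n0 x M iid, folded D_def] obtain E0 where E0: "E0 \<in> sets M" "measure M E0 \<le> 2 * exp (- x)"
      "\<forall>\<omega>\<in>space M - E0. \<forall>c (s::real). set c \<subseteq> K \<longrightarrow> length c = k \<longrightarrow> 0 \<le> s \<longrightarrow> s \<le> real T \<longrightarrow>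
        \<bar>emp_dev n (\<lambda>i. X i \<omega>) P (\<lambda>u. max 0 (s - gd c u))\<bar> \<le> D x" by (elim bexE conjE) (rule that)
    \<comment> \<open>The second use of the uniform bound, with y proportional to n, serves the
      confinement only; its failure probability is exponentially small in n.\<close>
    from C[rule_format, OF n0 y M iid, folded D_def] obtain E1 where E1: "E1 \<in> sets M" "measure M E1 \<le> 2 * exp (- y)"
      "\<forall>\<omega>\<in>space M - E1. \<forall>c (s::real). set c \<subseteq> K \<longrightarrow> length c = k \<longrightarrow> 0 \<le> s \<longrightarrow> s \<le> real T \<longrightarrow>
        \<bar>emp_dev n (\<lambda>i. X i \<omega>) P (\<lambda>u. max 0 (s - gd c u))\<bar> \<le> D y" by (elim bexE conjE) (rule that)
    define H1 where "H1 = {\<omega> \<in> space M. \<eta>1 \<le> \<bar>emp_dev n (\<lambda>i. X i \<omega>) P (indicator B)\<bar>}"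
    define H2 where "H2 = {\<omega> \<in> space M. \<eta>2 \<le> \<bar>emp_dev n (\<lambda>i. X i \<omega>) P (indicator B')\<bar>}"
    define H3 where "H3 = {\<omega> \<in> space M. \<eta>3 \<le> \<bar>emp_dev n (\<lambda>i. X i \<omega>) P (\<lambda>u. indicator B' u * norm u)\<bar>}"
    have ind1: "\<bar>indicator S u :: real\<bar> \<le> 1" for S and u :: 'a by (simp split: split_indicator)
    have H1: "H1 \<in> sets M" "measure M H1 \<le> 2 * exp (- (\<eta>1\<^sup>2 / (2 * 1\<^sup>2)) * n)"
      unfolding H1_def by (rule iid_hoeffding_fixed[OF M iid n0 _ ind1 zero_less_one \<eta>(1)], measurable)+
    have H2: "H2 \<in> sets M" "measure M H2 \<le> 2 * exp (- (\<eta>2\<^sup>2 / (2 * 1\<^sup>2)) * n)"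
      unfolding H2_def by (rule iid_hoeffding_fixed[OF M iid n0 _ ind1 zero_less_one \<eta>(2)], measurable)+
    have H3: "H3 \<in> sets M" "measure M H3 \<le> 2 * exp (- (\<eta>3\<^sup>2 / (2 * b\<^sup>2)) * n)"
      unfolding H3_def by (rule iid_hoeffding_fixed[OF M iid n0 _ b(2) b(1) \<eta>(3)], measurable)+
    have XF: "AE \<omega> in M. \<forall>i\<in>{..<n}. X i \<omega> \<in> F"
    proof (rule AE_finite_allI)
      fix i assume "i \<in> {..<n}"
      then have i: "i < n" by simp
      have "AE u in distr M borel (X i). u \<in> F" unfolding iid_sampleD(2)[OF M iid i] by (rule P'(3))
      then show "AE \<omega> in M. X i \<omega> \<in> F" using iid_sampleD(1)[OF M iid i] by (subst (asm) AE_distr_iff) auto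
    qed simp
    have "AE \<omega> in M. (\<forall>i\<in>{..<n}. X i \<omega> \<in> F) \<and> optimal_codebook \<Omega> \<phi> (empirical_measure n (\<lambda>i. X i \<omega>)) h k (chat \<omega>)"
      using XF chat by eventually_elim blast
    \<comment> \<open>\<open>chat\<close> may fail to be measurable, so the exceptional set of the
      almost sure properties is enclosed in a null event.\<close>
    then obtain Z where Z: "{\<omega> \<in> space M. \<not> ((\<forall>i\<in>{..<n}. X i \<omega> \<in> F) \<and>
        optimal_codebook \<Omega> \<phi> (empirical_measure n (\<lambda>i. X i \<omega>)) h k (chat \<omega>))} \<subseteq> Z"
      "emeasure M Z = 0" "Z \<in> sets M" by (rule AE_E)
    define U where "U = E0 \<union> E1 \<union> H1 \<union> H2 \<union> H3 \<union> Z"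
    have U: "U \<in> sets M" using E0(1) E1(1) H1(1) H2(1) H3(1) Z(3) by (simp add: U_def)
    have ex: "2 * exp (- c * real n) \<le> 2 * exp (- a * real n)" if "a \<le> c" for c
      using mult_right_mono[OF that, of "real n"] by simp
    have "measure M U \<le> measure M E0 + measure M E1 + measure M H1 + measure M H2 + measure M H3 + measure M Z"
      unfolding U_def using E0(1) E1(1) H1(1) H2(1) H3(1) Z(3)
      by (intro order_trans[OF measure_Un_le] add_mono order_refl) auto
    also have "measure M Z = 0" using Z(2) by (simp add: measure_def)
    also have "measure M E0 + measure M E1 + measure M H1 + measure M H2 + measure M H3 + 0
       \<le> 2 * exp (- x) + 8 * exp (- a * real n)"
    proof -
      have "- y = - \<kappa> * real n" by (simp add: y_def)
      then have "measure M E1 \<le> 2 * exp (- \<kappa> * real n)" using E1(2) by (simp only:)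
      from order_trans[OF this ex[OF a(4)]] order_trans[OF H1(2) ex[OF a(1)]]
        order_trans[OF H2(2) ex[OF a(2)]] order_trans[OF H3(2) ex[OF a(3)]] E0(2)
      show ?thesis by linarith
    qed
    also have "\<dots> < 2 * exp (- x) + real n powr (- p / 2)" using N1[OF nN(1)] by simp
    finally have mU: "measure M U < 2 * exp (- x) + real n powr (- p / 2)" .
    have cs: "set cstar \<subseteq> \<Omega>" "length cstar = k"
      and cs_opt: "\<And>c'. set c' \<subseteq> \<Omega> \<Longrightarrow> length c' = k \<Longrightarrow> trimmed_distortion \<Omega> \<phi> P h cstar \<le> trimmed_distortion \<Omega> \<phi> P h c'"
      using cstar by (auto simp: optimal_codebook_def is_arg_min_def codebooks_def not_less)
    have cs_r0: "trimmed_distortion \<Omega> \<phi> P h cstar = r0"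
      unfolding r0_def optimal_distortion_def
    proof (rule cInf_eq_minimum[symmetric])
      show "trimmed_distortion \<Omega> \<phi> P h cstar \<in> trimmed_distortion \<Omega> \<phi> P h ` codebooks \<Omega> k"
        using cs by (auto simp: codebooks_def)
    qed (use cs_opt in \<open>auto simp: codebooks_def\<close>)
    \<comment> \<open>Localization applied to P itself as the measure \<mu>, with no deviation at
      all.\<close>
    have csK: "set cstar \<subseteq> K"
      by (rule loc[OF P _ _ _ _ cs cs_opt]) (use PB gap' cs_r0 in auto)
    have good: "trimmed_distortion \<Omega> \<phi> P h (chat \<omega>) - trimmed_distortion \<Omega> \<phi> P h cstar
                  \<le> 2 * C / sqrt (real n) * (1 + sqrt x)" if \<omega>: "\<omega> \<in> space M - U" for \<omega>
    proof -
      let ?\<mu> = "empirical_measure n (\<lambda>i. X i \<omega>)"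
      have \<omega>M: "\<omega> \<in> space M" and XF\<omega>: "\<And>i. i < n \<Longrightarrow> X i \<omega> \<in> F"
        and opt: "optimal_codebook \<Omega> \<phi> ?\<mu> h k (chat \<omega>)"
        using \<omega> Z(1) by (auto simp: U_def)
      note emp = empirical_measure_props[OF n0, where x = "\<lambda>i. X i \<omega>"]
      have \<mu>: "F_measure ?\<mu>" unfolding F_measure_def using emp(1,2) emp(4)[OF borel_F XF\<omega>] by blast
      interpret \<mu>: prob_space ?\<mu> by (rule emp(1))
      have dev: "emp_dev n (\<lambda>i. X i \<omega>) P f = (\<integral>u. f u \<partial>?\<mu>) - (\<integral>u. f u \<partial>P)"
        if "f \<in> borel_measurable borel" for f
        using emp(3)[OF that] by (simp add: emp_dev_def)
      have m1: "(1 + h) / 2 \<le> measure ?\<mu> B"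
      proof -
        have "\<omega> \<notin> H1" using \<omega> by (simp add: U_def)
        then have "\<bar>emp_dev n (\<lambda>i. X i \<omega>) P (indicator B)\<bar> < \<eta>1" using \<omega>M by (simp add: H1_def)
        then have "\<bar>measure ?\<mu> B - measure P B\<bar> < \<eta>1"
          using P' emp(2) by (subst (asm) dev) (auto simp: sets_eq_imp_space_eq[OF emp(2)])
        then show ?thesis unfolding \<eta>1_def by linarith
      qed
      have m2: "1 - \<epsilon> \<le> measure ?\<mu> B'"
      proof -
        have "\<omega> \<notin> H2" using \<omega> by (simp add: U_def)
        then have "\<bar>emp_dev n (\<lambda>i. X i \<omega>) P (indicator B')\<bar> < \<eta>2" using \<omega>M by (simp add: H2_def)
        then have "\<bar>measure ?\<mu> B' - measure P B'\<bar> < \<eta>2"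
          using P' emp(2) by (subst (asm) dev) (auto simp: sets_eq_imp_space_eq[OF emp(2)])
        then show ?thesis unfolding \<eta>2_def by linarith
      qed
      have m3: "(\<integral>u. indicator B' u * norm u \<partial>?\<mu>) \<le> E"
      proof -
        have "\<omega> \<notin> H3" using \<omega> by (simp add: U_def)
        then have "\<bar>emp_dev n (\<lambda>i. X i \<omega>) P (\<lambda>u. indicator B' u * norm u)\<bar> < \<eta>3" using \<omega>M by (simp add: H3_def)
        then have "\<bar>(\<integral>u. indicator B' u * norm u \<partial>?\<mu>) - (\<integral>u. indicator B' u * norm u \<partial>P)\<bar> < \<eta>3"
          by (subst (asm) dev) auto
        then show ?thesis unfolding \<eta>3_def by linarith
      qed
      have hB: "h < measure ?\<mu> B" "h < measure P B" using m1 PB(1) h by (auto simp: field_simps)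
      have comp: "trimmed_distortion \<Omega> \<phi> P h c \<le> trimmed_distortion \<Omega> \<phi> ?\<mu> h c + e"
        "trimmed_distortion \<Omega> \<phi> ?\<mu> h c \<le> trimmed_distortion \<Omega> \<phi> P h c + e"
        if c: "set c \<subseteq> K" "length c = k"
          and e: "\<And>s. 0 \<le> s \<Longrightarrow> s \<le> real T \<Longrightarrow> \<bar>emp_dev n (\<lambda>i. X i \<omega>) P (\<lambda>u. max 0 (s - gd c u))\<bar> \<le> e" for c e
      proof -
        have c\<Omega>: "set c \<subseteq> \<Omega>" "c \<noteq> []" using c K\<Omega> k0 by auto
        note [measurable] = gd_measurable[OF c\<Omega>]
        have e': "\<bar>(\<integral>u. max 0 (s - gd c u) \<partial>?\<mu>) - (\<integral>u. max 0 (s - gd c u) \<partial>P)\<bar> \<le> e"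
          if "0 \<le> s" "s \<le> real T" for s
          using e[OF that] by (subst (asm) dev) auto
        have dT': "d u z \<le> real T" if "u \<in> B" "z \<in> set c" for u z using dT that c(1) by blast
        have BB: "B \<in> sets borel" by measurable
        show "trimmed_distortion \<Omega> \<phi> ?\<mu> h c \<le> trimmed_distortion \<Omega> \<phi> P h c + e"
          by (rule distortion_le_of_deviation[OF \<mu> P c\<Omega> h BB B(2) hB(1) dT' e'])
        have e'': "\<bar>(\<integral>u. max 0 (s - gd c u) \<partial>P) - (\<integral>u. max 0 (s - gd c u) \<partial>?\<mu>)\<bar> \<le> e"
          if "0 \<le> s" "s \<le> real T" for s
          using e'[OF that] by (simp only: abs_minus_commute)
        show "trimmed_distortion \<Omega> \<phi> P h c \<le> trimmed_distortion \<Omega> \<phi> ?\<mu> h c + e"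
          by (rule distortion_le_of_deviation[OF P \<mu> c\<Omega> h BB B(2) hB(2) dT' e''])
      qed
      have \<omega>E: "\<omega> \<in> space M - E0" "\<omega> \<in> space M - E1" using \<omega> by (auto simp: U_def)
      have compx: "trimmed_distortion \<Omega> \<phi> P h c \<le> trimmed_distortion \<Omega> \<phi> ?\<mu> h c + D x"
        "trimmed_distortion \<Omega> \<phi> ?\<mu> h c \<le> trimmed_distortion \<Omega> \<phi> P h c + D x"
        if cc: "set c \<subseteq> K" "length c = k" for c
      proof -
        have e: "\<bar>emp_dev n (\<lambda>i. X i \<omega>) P (\<lambda>u. max 0 (s - gd c u))\<bar> \<le> D x"
          if "0 \<le> s" "s \<le> real T" for s
          by (rule bspec[OF E0(3) \<omega>E(1), rule_format, OF cc that])
        show "trimmed_distortion \<Omega> \<phi> P h c \<le> trimmed_distortion \<Omega> \<phi> ?\<mu> h c + D x"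
          by (rule comp(1)[OF cc e])
        show "trimmed_distortion \<Omega> \<phi> ?\<mu> h c \<le> trimmed_distortion \<Omega> \<phi> P h c + D x"
          by (rule comp(2)[OF cc e])
      qed
      have compy: "trimmed_distortion \<Omega> \<phi> P h c \<le> trimmed_distortion \<Omega> \<phi> ?\<mu> h c + D y"
        "trimmed_distortion \<Omega> \<phi> ?\<mu> h c \<le> trimmed_distortion \<Omega> \<phi> P h c + D y"
        if cc: "set c \<subseteq> K" "length c = k" for c
      proof -
        have e: "\<bar>emp_dev n (\<lambda>i. X i \<omega>) P (\<lambda>u. max 0 (s - gd c u))\<bar> \<le> D y"
          if "0 \<le> s" "s \<le> real T" for s
          by (rule bspec[OF E1(3) \<omega>E(2), rule_format, OF cc that])
        show "trimmed_distortion \<Omega> \<phi> P h c \<le> trimmed_distortion \<Omega> \<phi> ?\<mu> h c + D y"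
          by (rule comp(1)[OF cc e])
        show "trimmed_distortion \<Omega> \<phi> ?\<mu> h c \<le> trimmed_distortion \<Omega> \<phi> P h c + D y"
          by (rule comp(2)[OF cc e])
      qed
      have ch: "set (chat \<omega>) \<subseteq> \<Omega>" "length (chat \<omega>) = k"
        and ch_opt: "\<And>c'. set c' \<subseteq> \<Omega> \<Longrightarrow> length c' = k \<Longrightarrow> trimmed_distortion \<Omega> \<phi> ?\<mu> h (chat \<omega>) \<le> trimmed_distortion \<Omega> \<phi> ?\<mu> h c'"
        using opt by (auto simp: optimal_codebook_def is_arg_min_def codebooks_def not_less)
      have le: "trimmed_distortion \<Omega> \<phi> ?\<mu> h (chat \<omega>) \<le> trimmed_distortion \<Omega> \<phi> ?\<mu> h cstar"
        by (rule ch_opt[OF cs])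
      have chK: "set (chat \<omega>) \<subseteq> K"
      proof (rule loc[OF \<mu> m1 m2 m3 _ ch ch_opt])
        show "trimmed_distortion \<Omega> \<phi> P h c' \<le> trimmed_distortion \<Omega> \<phi> ?\<mu> h c' + (r1 - r0) / 4"
          if "set c' \<subseteq> K" "length c' = k" for c'
          using compy(1)[OF that] Dy by linarith
        show "trimmed_distortion \<Omega> \<phi> ?\<mu> h (chat \<omega>) \<le> r0 + (r1 - r0) / 4"
          using le compy(2)[OF csK cs(2)] Dy cs_r0 by linarith
      qed
      \<comment> \<open>Two comparisons between P and the empirical measure, one for each codebook,
        produce the factor 2 in the final constant.\<close>
      have "trimmed_distortion \<Omega> \<phi> P h (chat \<omega>) - trimmed_distortion \<Omega> \<phi> P h cstar \<le> 2 * D x"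
        using compx(1)[OF chK ch(2)] compx(2)[OF csK cs(2)] le by linarith
      also have "2 * D x = 2 * C / sqrt (real n) * (1 + sqrt x)" by (simp add: D_def)
      finally show ?thesis .
    qed
    have "measure M (space M - U) > 1 - real n powr (- p / 2) - 2 * exp (- x)"
      using mU M.prob_compl[OF U] by simp
    with good U show ?thesis by (intro bexI[of _ "space M - U"]) auto
  qed
  show ?thesis
    by (intro exI[of _ "2 * C"] conjI exI[of _ N] allI impI main) (use C0 in auto)
qed

end

theorem theorem11:
  fixes P :: "'a::euclidean_space measure"
    and \<Omega> :: "'a set" and \<phi> :: "'a \<Rightarrow> real"
    and h p :: real and k :: nat
  assumes "prob_space P" and "sets P = sets borel"
    and "0 < h" and "h < 1" and "k \<ge> 2"
    and "convex \<Omega>" and "strictly_convex_on \<Omega> \<phi>" and "C2_on \<Omega> \<phi>"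
    and "closure (convex hull (msupport P)) \<subseteq> interior \<Omega>"
    and "p \<ge> 2" and "integrable P (\<lambda>u. norm u powr p)"
    and "optimal_distortion \<Omega> \<phi> P h (k - 1) - optimal_distortion \<Omega> \<phi> P h k > 0"
  shows "\<exists>C>0. \<exists>N. \<forall>n\<ge>N. \<forall>x>0.
    \<forall>(M :: 'w measure) X chat cstar.
      prob_space M \<longrightarrow> iid_sample M P n X \<longrightarrow>
      (AE \<omega> in M. optimal_codebook \<Omega> \<phi> (empirical_measure n (\<lambda>i. X i \<omega>)) h k (chat \<omega>)) \<longrightarrow>
      optimal_codebook \<Omega> \<phi> P h k cstar \<longrightarrow>
      (\<exists>A\<in>sets M.
         (\<forall>\<omega>\<in>A. trimmed_distortion \<Omega> \<phi> P h (chat \<omega>) - trimmed_distortion \<Omega> \<phi> P h cstar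
                  \<le> C / sqrt (real n) * (1 + sqrt x)) \<and>
         measure M A > 1 - real n powr (- p / 2) - 2 * exp (- x))"
proof -
  interpret P: prob_space P by fact
  let ?F = "closure (convex hull (msupport P))"
  have supp: "AE u in P. u \<in> msupport P" by (rule AE_in_msupport[OF assms(2)])
  have sub: "msupport P \<subseteq> ?F" using hull_subset closure_subset by (meson order_trans)
  \<comment> \<open>An empty interior would force an empty support, but the support carries the
    whole mass of P.\<close>
  have ne: "interior \<Omega> \<noteq> {}"
  proof
    assume "interior \<Omega> = {}"
    with assms(9) sub have "msupport P = {}" by auto
    with supp have "AE u in P. False" by simp
    then show False using P.prob_space by (simp add: P.AE_False)
  qed
  interpret bregman_support \<Omega> \<phi> ?F
    by unfold_locales (use assms ne in \<open>auto intro: convex_closure\<close>)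
  have F: "F_measure P" unfolding F_measure_def
    using assms(1,2) supp sub by (auto elim!: eventually_mono)
  have int: "integrable P norm"
  proof (rule Bochner_Integration.integrable_bound)
    show "integrable P (\<lambda>u. 1 + norm u powr p)" using assms(11) by simp
    show "norm \<in> borel_measurable P" by (simp add: measurable_cong_sets[OF assms(2) refl])
    have "norm u \<le> 1 + norm u powr p" for u :: 'a
    proof (cases "norm u \<le> 1")
      case True then show ?thesis by (simp add: add_increasing2)
    next
      case False
      then have "norm u powr 1 \<le> norm u powr p" using assms(10) by (intro powr_mono) auto
      then show ?thesis using False by simp
    qed
    then show "AE u in P. norm (norm u) \<le> norm (1 + norm u powr p)" by (intro AE_I2) simp
  qed
  show ?thesis
    by (rule excess_distortion_bound[OF F assms(3-5) int]) (use assms(12) in simp)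
qed

end
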